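(* Let $R$ be a unital commutative ring and $G$ be a finite group. Then the Burnside algebra $RB(G)$ is a separable $R$-algebra if and only if the order of $G$ is invertible in $R$.
   Context: The Burnside ring $B(G)$ of a finite group $G$ is the Grothendieck ring of finite $G$-sets (addition from disjoint union, product from cartesian product with diagonal action), and $RB(G)=R\otimes_{\mathbb{Z}}B(G)$. An $R$-algebra $A$ is separable over $R$ if $A$ is projective as an $(A,A)$-bimodule, equivalently the product map $\mu_A:A\otimes_R A\to A$ is a split surjection of $(A,A)$-bimodules. *)

theory Defs
  imports "HOL-Algebra.Free_Abelian_Groups" "HOL-Algebra.Group_Action" "HOL-Algebra.Module"
    "HOL-Algebra.IntRing"
begin

section \<open>Finite G-sets\<close>

type_synonym ('g, 'x) gset = "'x set \<times> ('g \<Rightarrow> 'x \<Rightarrow> 'x)"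

definition finite_gset :: "('g, 'm) monoid_scheme \<Rightarrow> ('g, 'x) gset \<Rightarrow> bool" where
  "finite_gset G X \<longleftrightarrow> finite (fst X) \<and> group_action G (fst X) (snd X)"

definition gset_iso ::
    "('g, 'm) monoid_scheme \<Rightarrow> ('g, 'x) gset \<Rightarrow> ('g, 'y) gset \<Rightarrow> bool" where
  "gset_iso G X Y \<longleftrightarrow>
    (\<exists>f. bij_betw f (fst X) (fst Y) \<and>
         (\<forall>g \<in> carrier G. \<forall>x \<in> fst X. f (snd X g x) = snd Y g (f x)))"

definition gset_sum :: "('g, 'x) gset \<Rightarrow> ('g, 'y) gset \<Rightarrow> ('g, 'x + 'y) gset" where
  "gset_sum X Y =
    (fst X <+> fst Y, \<lambda>g. \<lambda>z \<in> fst X <+> fst Y. map_sum (snd X g) (snd Y g) z)"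

definition gset_prod :: "('g, 'x) gset \<Rightarrow> ('g, 'y) gset \<Rightarrow> ('g, 'x \<times> 'y) gset" where
  "gset_prod X Y =
    (fst X \<times> fst Y, \<lambda>g. \<lambda>z \<in> fst X \<times> fst Y. map_prod (snd X g) (snd Y g) z)"

definition trivial_gset :: "'x set \<Rightarrow> ('g, 'x) gset" where
  "trivial_gset X = (X, \<lambda>g. \<lambda>x \<in> X. x)"

text \<open>
  Every finite G-set is isomorphic to one whose points are natural numbers. The isomorphism
  class of a finite G-set over any type is therefore represented by the set of all G-sets on
  natural numbers that are isomorphic to it.
\<close>

definition gset_class ::
    "('g, 'm) monoid_scheme \<Rightarrow> ('g, 'x) gset \<Rightarrow> ('g, nat) gset set" where
  "gset_class G X = {Y. finite_gset G Y \<and> gset_iso G X Y}"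

definition gset_semiring :: "('g, 'm) monoid_scheme \<Rightarrow> ('g, nat) gset set ring" where
  "gset_semiring G =
    \<lparr>carrier = gset_class G ` {X :: ('g, nat) gset. finite_gset G X},
     monoid.mult = (\<lambda>U V. \<Union>X \<in> U. \<Union>Y \<in> V. gset_class G (gset_prod X Y)),
     one = gset_class G (trivial_gset {()}),
     ring.zero = gset_class G (trivial_gset ({} :: unit set)),
     ring.add = (\<lambda>U V. \<Union>X \<in> U. \<Union>Y \<in> V. gset_class G (gset_sum X Y))\<rparr>"


section \<open>The Burnside ring\<close>

text \<open>
  The Grothendieck ring of a commutative semiring: the class of \<open>(a, b)\<close> stands for the formal
  difference \<open>a - b\<close>.
\<close>

definition grothendieck_rel :: "('a, 'm) ring_scheme \<Rightarrow> (('a \<times> 'a) \<times> ('a \<times> 'a)) set" where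
  "grothendieck_rel S =
    {((a, b), (c, d)) | a b c d. a \<in> carrier S \<and> b \<in> carrier S \<and> c \<in> carrier S \<and> d \<in> carrier S \<and>
      (\<exists>k \<in> carrier S. a \<oplus>\<^bsub>S\<^esub> d \<oplus>\<^bsub>S\<^esub> k = c \<oplus>\<^bsub>S\<^esub> b \<oplus>\<^bsub>S\<^esub> k)}"

definition grothendieck_ring :: "('a, 'm) ring_scheme \<Rightarrow> ('a \<times> 'a) set ring" where
  "grothendieck_ring S =
    \<lparr>carrier = (carrier S \<times> carrier S) // grothendieck_rel S,
     monoid.mult = (\<lambda>U V. \<Union>(a, b) \<in> U. \<Union>(c, d) \<in> V.
       grothendieck_rel S `` {(a \<otimes>\<^bsub>S\<^esub> c \<oplus>\<^bsub>S\<^esub> b \<otimes>\<^bsub>S\<^esub> d, a \<otimes>\<^bsub>S\<^esub> d \<oplus>\<^bsub>S\<^esub> b \<otimes>\<^bsub>S\<^esub> c)}),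
     one = grothendieck_rel S `` {(\<one>\<^bsub>S\<^esub>, \<zero>\<^bsub>S\<^esub>)},
     ring.zero = grothendieck_rel S `` {(\<zero>\<^bsub>S\<^esub>, \<zero>\<^bsub>S\<^esub>)},
     ring.add = (\<lambda>U V. \<Union>(a, b) \<in> U. \<Union>(c, d) \<in> V.
       grothendieck_rel S `` {(a \<oplus>\<^bsub>S\<^esub> c, b \<oplus>\<^bsub>S\<^esub> d)})\<rparr>"

definition burnside_ring ::
    "('g, 'm) monoid_scheme \<Rightarrow> (('g, nat) gset set \<times> ('g, nat) gset set) set ring" where
  "burnside_ring G = grothendieck_ring (gset_semiring G)"


section \<open>Tensor products of algebras\<close>

definition with_smult ::
    "('a, 'm) ring_scheme \<Rightarrow> ('k \<Rightarrow> 'a \<Rightarrow> 'a) \<Rightarrow> ('k, 'a) module" where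
  "with_smult S f =
    \<lparr>carrier = carrier S, monoid.mult = monoid.mult S, one = one S,
     ring.zero = ring.zero S, ring.add = ring.add S, smult = f\<rparr>"

text \<open>
  The tensor product of two algebras over the commutative ring \<open>R\<close> is the free abelian group
  on pairs modulo the relations of biadditivity and \<open>R\<close>-balancedness.
\<close>

definition tensor_free ::
    "('k, 'a, 'm) module_scheme \<Rightarrow> ('k, 'b, 'n) module_scheme \<Rightarrow> (('a \<times> 'b) \<Rightarrow>\<^sub>0 int) monoid" where
  "tensor_free M N = free_Abelian_group (carrier M \<times> carrier N)"

definition tensor_null ::
    "('k, 'l) ring_scheme \<Rightarrow> ('k, 'a, 'm) module_scheme \<Rightarrow> ('k, 'b, 'n) module_scheme \<Rightarrow>
      (('a \<times> 'b) \<Rightarrow>\<^sub>0 int) set" where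
  "tensor_null R M N = generate (tensor_free M N)
    ({frag_of (x \<oplus>\<^bsub>M\<^esub> x', y) - (frag_of (x, y) + frag_of (x', y)) | x x' y.
        x \<in> carrier M \<and> x' \<in> carrier M \<and> y \<in> carrier N} \<union>
     {frag_of (x, y \<oplus>\<^bsub>N\<^esub> y') - (frag_of (x, y) + frag_of (x, y')) | x y y'.
        x \<in> carrier M \<and> y \<in> carrier N \<and> y' \<in> carrier N} \<union>
     {frag_of (r \<odot>\<^bsub>M\<^esub> x, y) - frag_of (x, r \<odot>\<^bsub>N\<^esub> y) | r x y.
        r \<in> carrier R \<and> x \<in> carrier M \<and> y \<in> carrier N})"

definition tensor_class ::
    "('k, 'l) ring_scheme \<Rightarrow> ('k, 'a, 'm) module_scheme \<Rightarrow> ('k, 'b, 'n) module_scheme \<Rightarrow>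
      (('a \<times> 'b) \<Rightarrow>\<^sub>0 int) \<Rightarrow> (('a \<times> 'b) \<Rightarrow>\<^sub>0 int) set" where
  "tensor_class R M N u = tensor_null R M N #>\<^bsub>tensor_free M N\<^esub> u"

definition pure_tensor ::
    "('k, 'l) ring_scheme \<Rightarrow> ('k, 'a, 'm) module_scheme \<Rightarrow> ('k, 'b, 'n) module_scheme \<Rightarrow>
      'a \<Rightarrow> 'b \<Rightarrow> (('a \<times> 'b) \<Rightarrow>\<^sub>0 int) set" where
  "pure_tensor R M N x y = tensor_class R M N (frag_of (x, y))"

text \<open>The biadditive extension of \<open>(x, y) (x', y') = (x x', y y')\<close> to formal sums.\<close>

definition frag_mult ::
    "('k, 'a, 'm) module_scheme \<Rightarrow> ('k, 'b, 'n) module_scheme \<Rightarrow>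
      (('a \<times> 'b) \<Rightarrow>\<^sub>0 int) \<Rightarrow> (('a \<times> 'b) \<Rightarrow>\<^sub>0 int) \<Rightarrow> (('a \<times> 'b) \<Rightarrow>\<^sub>0 int)" where
  "frag_mult M N u v =
    frag_extend (\<lambda>(x, y). frag_extend (\<lambda>(x', y'). frag_of (x \<otimes>\<^bsub>M\<^esub> x', y \<otimes>\<^bsub>N\<^esub> y')) v) u"

definition tensor_ring ::
    "('k, 'l) ring_scheme \<Rightarrow> ('k, 'a, 'm) module_scheme \<Rightarrow> ('k, 'b, 'n) module_scheme \<Rightarrow>
      (('a \<times> 'b) \<Rightarrow>\<^sub>0 int) set ring" where
  "tensor_ring R M N =
    \<lparr>carrier = carrier (tensor_free M N Mod tensor_null R M N),
     monoid.mult = (\<lambda>U V. \<Union>u \<in> U. \<Union>v \<in> V. tensor_class R M N (frag_mult M N u v)),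
     one = pure_tensor R M N \<one>\<^bsub>M\<^esub> \<one>\<^bsub>N\<^esub>,
     ring.zero = \<one>\<^bsub>tensor_free M N Mod tensor_null R M N\<^esub>,
     ring.add = monoid.mult (tensor_free M N Mod tensor_null R M N)\<rparr>"


section \<open>The Burnside algebra\<close>

definition int_algebra :: "('a, 'm) ring_scheme \<Rightarrow> (int, 'a) module" where
  "int_algebra S = with_smult S (\<lambda>n x. [n] \<cdot>\<^bsub>S\<^esub> x)"

text \<open>The scalar action is \<open>r (r' \<otimes> b) = (r r') \<otimes> b\<close>, written as multiplication by \<open>r \<otimes> 1\<close>.\<close>

definition scalar_extension ::
    "('r, 'l) ring_scheme \<Rightarrow> ('b, 'm) ring_scheme \<Rightarrow> ('r, (('r \<times> 'b) \<Rightarrow>\<^sub>0 int) set) module" where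
  "scalar_extension R B =
    (let T = tensor_ring \<Z> (int_algebra R) (int_algebra B) in
      with_smult T (\<lambda>r t. pure_tensor \<Z> (int_algebra R) (int_algebra B) r \<one>\<^bsub>B\<^esub> \<otimes>\<^bsub>T\<^esub> t))"

text \<open>RB(G), the tensor product of \<open>R\<close> and the Burnside ring over the integers.\<close>

definition burnside_algebra ::
    "('r, 'l) ring_scheme \<Rightarrow> ('g, 'm) monoid_scheme \<Rightarrow>
      ('r, (('r \<times> (('g, nat) gset set \<times> ('g, nat) gset set) set) \<Rightarrow>\<^sub>0 int) set) module" where
  "burnside_algebra R G = scalar_extension R (burnside_ring G)"


section \<open>Separable algebras\<close>

text \<open>
  The product map \<open>x \<otimes> y \<mapsto> x y\<close>. It is computed on formal sums; for an algebra \<open>A\<close> over \<open>R\<close> the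
  value is the same at all representatives \<open>u\<close> of a class \<open>U\<close> in \<open>A \<otimes> A\<close>.
\<close>

definition tensor_mult_map ::
    "('k, 'a, 'm) module_scheme \<Rightarrow> (('a \<times> 'a) \<Rightarrow>\<^sub>0 int) set \<Rightarrow> 'a" where
  "tensor_mult_map A U = the_elem
    ((\<lambda>u. \<Oplus>\<^bsub>A\<^esub>p \<in> Poly_Mapping.keys u.
        [Poly_Mapping.lookup u p] \<cdot>\<^bsub>A\<^esub> (fst p \<otimes>\<^bsub>A\<^esub> snd p)) ` U)"

text \<open>
  Separability: the product map \<open>A \<otimes> A \<rightarrow> A\<close> over \<open>R\<close> is a split surjection of (A,A)-bimodules.
  In the bimodule \<open>A \<otimes> A\<close> the element \<open>a\<close> acts on the left by \<open>a (x \<otimes> y) = (a x) \<otimes> y\<close> and on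
  the right by \<open>(x \<otimes> y) a = x \<otimes> (y a)\<close>; in terms of the ring structure of \<open>A \<otimes> A\<close> these are
  left multiplication by \<open>a \<otimes> 1\<close> and right multiplication by \<open>1 \<otimes> a\<close>.
\<close>

definition separable_algebra ::
    "('k, 'l) ring_scheme \<Rightarrow> ('k, 'a, 'm) module_scheme \<Rightarrow> bool" where
  "separable_algebra R A \<longleftrightarrow>
    (let T = tensor_ring R A A in
      \<exists>s \<in> hom (add_monoid A) (add_monoid T).
        (\<forall>a \<in> carrier A. \<forall>x \<in> carrier A.
          s (a \<otimes>\<^bsub>A\<^esub> x) = pure_tensor R A A a \<one>\<^bsub>A\<^esub> \<otimes>\<^bsub>T\<^esub> s x \<and>
          s (x \<otimes>\<^bsub>A\<^esub> a) = s x \<otimes>\<^bsub>T\<^esub> pure_tensor R A A \<one>\<^bsub>A\<^esub> a) \<and>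
        (\<forall>x \<in> carrier A. tensor_mult_map A (s x) = x))"

end

theory Submission
  imports Defs "HOL-Algebra.Divisibility"
begin

text \<open>
  Write \<open>A = RB(G)\<close>. Separability of \<open>A\<close> means that there is \<open>E\<close> in \<open>A \<otimes> A\<close> with
  \<open>(a \<otimes> 1) E = E (1 \<otimes> a)\<close> for all \<open>a\<close> and product \<open>1\<close>.

  Given such an \<open>E\<close>, let \<open>q : A \<rightarrow> R\<close> count points, let \<open>p : A \<rightarrow> R\<close> count free orbits, and let \<open>x\<close> be
  the class of the regular G-set, so that \<open>p (x a) = q a\<close>. Applying \<open>p \<otimes> q\<close> to the two sides of
  \<open>(x \<otimes> 1) E = E (1 \<otimes> x)\<close> gives \<open>q 1 = 1\<close> on the left and \<open>q x = |G|\<close> times an element of \<open>R\<close> on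
  the right.

  Conversely, for a transitive X every product \<open>[Y] [X]\<close> is an integer multiple of \<open>[X]\<close> plus
  classes of transitive sets with more points. For \<open>Y = X\<close> the multiplicity is the number of points
  of X fixed by a point stabilizer, which divides \<open>|G|\<close> and so is a unit of \<open>R\<close>. Going through the
  transitive sets by decreasing number of points, one splits off idempotents \<open>e\<close> with \<open>A e = R e\<close>
  whose sum is \<open>1\<close>, and \<open>E\<close> is the sum of the \<open>e \<otimes> e\<close>.
\<close>

section \<open>Tensor products of commutative algebras\<close>

text \<open>Necessity hinges on \<open>p\<close> counting orbits and not points. The product of the
  regular set with Y is free with |Y| orbits, which gives \<open>p (x a) = q a\<close> exactly;
  counting its points would give |G| times this, a factor that cannot be cancelled in R. The
  division by |G| is therefore done on integers, where it is exact, and only the resulting additive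
  map is extended to R.

  For sufficiency the obstacle is that a product \<open>[Y] [X]\<close> is a multiple of
  \<open>[X]\<close> only up to larger transitive sets. If an idempotent \<open>f\<close> fixes
  their classes, then \<open>1 - f\<close> annihilates the ideal which these generate, and on
  \<open>(1 - f) [X]\<close> the congruence becomes an equation; hence the order of treatment.
  Smaller orbits cannot occur in Y \<times> X because every orbit maps onto X. The multiplicity for
  Y = X is the index of a point stabilizer in its normalizer. The one-point set is transitive with
  class 1, so an idempotent that fixes all transitive classes is 1.\<close>

lemma hom_frag_combination:
  assumes "h \<in> hom (free_Abelian_group S) H" "comm_group H" "Poly_Mapping.keys u \<subseteq> S"
  shows "h u = finprod H (\<lambda>p. h (frag_of p) [^]\<^bsub>H\<^esub> Poly_Mapping.lookup u p) (Poly_Mapping.keys u)"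
proof -
  interpret H: comm_group H by fact
  interpret h: group_hom "free_Abelian_group S" H h
    by (simp add: group_hom_def group_hom_axioms_def assms H.group_axioms)
  \<comment> \<open>The coefficients \<open>c\<close> are arbitrary, so that the induction can run
    over the key set alone. Every formal sum is the combination of its keys, hence \<open>h\<close>
    is computed by the kind of explicit sum that occurs in \<open>tensor_mult_map\<close>.\<close>
  have "K \<subseteq> S \<Longrightarrow> h (\<Sum>p\<in>K. frag_cmul (c p) (frag_of p)) =
      finprod H (\<lambda>p. h (frag_of p) [^]\<^bsub>H\<^esub> c p) K" if "finite K" for K and c :: "_ \<Rightarrow> int"
    using that
  proof (induction K rule: finite_induct)
    case empty
    then show ?case using h.hom_one by simp
  next
    case (insert p K)
    have p: "p \<in> S" using insert by auto
    have *: "(\<Sum>p\<in>K. frag_cmul (c p) (frag_of p)) \<in> carrier (free_Abelian_group S)"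
      by (rule sum_closed_free_Abelian_group) (use insert in auto)
    have eq: "frag_cmul (c p) (frag_of p) = frag_of p [^]\<^bsub>free_Abelian_group S\<^esub> c p"
      using p by simp
    have h1: "h (frag_cmul (c p) (frag_of p)) = h (frag_of p) [^]\<^bsub>H\<^esub> c p"
      unfolding eq using p by (intro h.hom_int_pow) simp
    have "(\<lambda>p. h (frag_of p) [^]\<^bsub>H\<^esub> c p) \<in> K \<rightarrow> carrier H" "h (frag_of p) \<in> carrier H"
      using insert by (auto intro!: H.int_pow_closed h.hom_closed)
    then show ?case
      using insert p * h.hom_mult[of "frag_cmul (c p) (frag_of p)" "\<Sum>p\<in>K. frag_cmul (c p) (frag_of p)"]
        keys_cmul[of "c p" "frag_of p"]
      by (auto simp: h1)
  qed
  from this[OF finite_keys assms(3), of "Poly_Mapping.lookup u"] show ?thesis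
    using frag_expansion[of u] by (simp add: frag_extend_def)
qed

lemma frag_extend_fun_diff:
  "frag_extend (\<lambda>p. f p - g p) u = frag_extend f u - frag_extend g u"
  by (rule frag_induction[of u UNIV]) (auto simp: frag_extend_diff)

text \<open>\<open>algebra\<close> includes commutativity of M and N. This makes the tensor ring a
  \<open>cring\<close> and lets one-sided computations do for both sides.\<close>

locale algebra_pair = M: algebra R M + N: algebra R N for R M N
begin

abbreviation "F \<equiv> tensor_free M N"
abbreviation "Nul \<equiv> tensor_null R M N"
abbreviation "T \<equiv> tensor_ring R M N"
abbreviation "cls \<equiv> tensor_class R M N"
abbreviation tens (infixl \<open>\<otimes>\<^sub>T\<close> 75) where "x \<otimes>\<^sub>T y \<equiv> pure_tensor R M N x y"

definition relations where "relations =
    {frag_of (x \<oplus>\<^bsub>M\<^esub> x', y) - (frag_of (x, y) + frag_of (x', y)) | x x' y.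
        x \<in> carrier M \<and> x' \<in> carrier M \<and> y \<in> carrier N} \<union>
     {frag_of (x, y \<oplus>\<^bsub>N\<^esub> y') - (frag_of (x, y) + frag_of (x, y')) | x y y'.
        x \<in> carrier M \<and> y \<in> carrier N \<and> y' \<in> carrier N} \<union>
     {frag_of (r \<odot>\<^bsub>M\<^esub> x, y) - frag_of (x, r \<odot>\<^bsub>N\<^esub> y) | r x y.
        r \<in> carrier R \<and> x \<in> carrier M \<and> y \<in> carrier N}"

lemma Nul_eq: "Nul = generate F relations"
  by (simp add: tensor_null_def relations_def)

lemma relations_cases [consumes 1, case_names left right smult]:
  assumes "u \<in> relations"
  obtains x x' y where "u = frag_of (x \<oplus>\<^bsub>M\<^esub> x', y) - (frag_of (x, y) + frag_of (x', y))"
      "x \<in> carrier M" "x' \<in> carrier M" "y \<in> carrier N"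
    | x y y' where "u = frag_of (x, y \<oplus>\<^bsub>N\<^esub> y') - (frag_of (x, y) + frag_of (x, y'))"
      "x \<in> carrier M" "y \<in> carrier N" "y' \<in> carrier N"
    | r x y where "u = frag_of (r \<odot>\<^bsub>M\<^esub> x, y) - frag_of (x, r \<odot>\<^bsub>N\<^esub> y)"
      "r \<in> carrier R" "x \<in> carrier M" "y \<in> carrier N"
  using assms unfolding relations_def by blast

lemma relationsI:
  "\<lbrakk>x \<in> carrier M; x' \<in> carrier M; y \<in> carrier N\<rbrakk> \<Longrightarrow>
    frag_of (x \<oplus>\<^bsub>M\<^esub> x', y) - (frag_of (x, y) + frag_of (x', y)) \<in> relations"
  "\<lbrakk>x \<in> carrier M; y \<in> carrier N; y' \<in> carrier N\<rbrakk> \<Longrightarrow>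
    frag_of (x, y \<oplus>\<^bsub>N\<^esub> y') - (frag_of (x, y) + frag_of (x, y')) \<in> relations"
  "\<lbrakk>r \<in> carrier R; x \<in> carrier M; y \<in> carrier N\<rbrakk> \<Longrightarrow>
    frag_of (r \<odot>\<^bsub>M\<^esub> x, y) - frag_of (x, r \<odot>\<^bsub>N\<^esub> y) \<in> relations"
  unfolding relations_def by blast+

section \<open>The free abelian group on pairs and its subgroup of relations\<close>

lemma F_simps [simp]:
  "u \<in> carrier F \<longleftrightarrow> Poly_Mapping.keys u \<subseteq> carrier M \<times> carrier N"
  "\<one>\<^bsub>F\<^esub> = 0" "u \<otimes>\<^bsub>F\<^esub> v = u + v"
  "Poly_Mapping.keys u \<subseteq> carrier M \<times> carrier N \<Longrightarrow> inv\<^bsub>F\<^esub> u = - u"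
  by (simp_all add: tensor_free_def)

sublocale F: comm_group F
  unfolding tensor_free_def by (rule abelian_free_Abelian_group)

lemma F_add: "u \<in> carrier F \<Longrightarrow> v \<in> carrier F \<Longrightarrow> u + v \<in> carrier F"
  and F_diff: "u \<in> carrier F \<Longrightarrow> v \<in> carrier F \<Longrightarrow> u - v \<in> carrier F"
  and F_uminus: "u \<in> carrier F \<Longrightarrow> - u \<in> carrier F"
  and F_zero: "0 \<in> carrier F"
  and F_of: "x \<in> carrier M \<Longrightarrow> y \<in> carrier N \<Longrightarrow> frag_of (x, y) \<in> carrier F"
  using keys_add[of u v] keys_diff[of u v] by (auto simp: keys_minus)

text \<open>Closure under differences yields sums and negatives at once. For biadditive expressions
  the cases 0 and difference are formal, so the content sits on the generators.\<close>

lemma F_induct [consumes 1, case_names zero diff of]: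
  assumes "u \<in> carrier F" "P 0"
    "\<And>u v. u \<in> carrier F \<Longrightarrow> v \<in> carrier F \<Longrightarrow> P u \<Longrightarrow> P v \<Longrightarrow> P (u - v)"
    "\<And>x y. x \<in> carrier M \<Longrightarrow> y \<in> carrier N \<Longrightarrow> P (frag_of (x, y))"
  shows "P u"
  by (rule free_Abelian_group_induct[of u "carrier M \<times> carrier N"]) (use assms in auto)

lemma relations_subset: "relations \<subseteq> carrier F"
proof
  fix u assume "u \<in> relations"
  then show "u \<in> carrier F"
    by (cases rule: relations_cases) (auto intro!: F_add F_diff F_of simp del: F_simps)
qed

lemma Nul_subgroup: "subgroup Nul F"
  unfolding Nul_eq by (rule F.generate_is_subgroup[OF relations_subset])

sublocale Nul: normal Nul F
  by (rule F.subgroup_imp_normal[OF Nul_subgroup])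

lemma Nul_simps:
  "0 \<in> Nul" "u \<in> Nul \<Longrightarrow> v \<in> Nul \<Longrightarrow> u + v \<in> Nul" "u \<in> Nul \<Longrightarrow> - u \<in> Nul"
  "u \<in> Nul \<Longrightarrow> v \<in> Nul \<Longrightarrow> u - v \<in> Nul" "u \<in> Nul \<Longrightarrow> u \<in> carrier F"
proof -
  show add: "u \<in> Nul \<Longrightarrow> v \<in> Nul \<Longrightarrow> u + v \<in> Nul" for u v using Nul.m_closed by simp
  show "u \<in> Nul \<Longrightarrow> u \<in> carrier F" for u using Nul.mem_carrier .
  then show um: "u \<in> Nul \<Longrightarrow> - u \<in> Nul" for u using Nul.m_inv_closed by simp
  show "u \<in> Nul \<Longrightarrow> v \<in> Nul \<Longrightarrow> u - v \<in> Nul" using add[OF _ um] by simp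
qed (use Nul.one_closed in simp)

lemma cls_eq: "cls u = (\<lambda>n. n + u) ` Nul"
  by (auto simp: tensor_class_def r_coset_def)

lemma cls_eq_iff: "cls u = cls v \<longleftrightarrow> u - v \<in> Nul"
proof
  assume "cls u = cls v"
  then have "0 + u \<in> cls v" unfolding cls_eq using Nul_simps(1) by blast
  then show "u - v \<in> Nul" by (auto simp: cls_eq)
next
  have *: "cls u \<subseteq> cls v" if "u - v \<in> Nul" for u v
  proof
    fix w assume "w \<in> cls u"
    then obtain n where "n \<in> Nul" "w = n + u" by (auto simp: cls_eq)
    then have "w = (n + (u - v)) + v" "n + (u - v) \<in> Nul" using that Nul_simps(2) by auto
    then show "w \<in> cls v" unfolding cls_eq by (rule image_eqI)
  qed
  assume "u - v \<in> Nul"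
  with *[OF this] *[of v u] Nul_simps(3)[of "u - v"] show "cls u = cls v" by auto
qed

lemma carrier_T: "carrier T = cls ` carrier F"
  by (auto simp: tensor_ring_def carrier_FactGroup tensor_class_def simp del: F_simps)

lemma cls_carrier: "u \<in> carrier F \<Longrightarrow> cls u \<in> carrier T"
  by (simp add: carrier_T del: F_simps)

lemma cls_add: "u \<in> carrier F \<Longrightarrow> v \<in> carrier F \<Longrightarrow> cls u \<oplus>\<^bsub>T\<^esub> cls v = cls (u + v)"
  using Nul.rcos_sum[of u v] by (simp add: tensor_ring_def tensor_class_def)

lemma zero_T: "\<zero>\<^bsub>T\<^esub> = cls 0"
  by (simp add: tensor_ring_def cls_eq)

section \<open>Multiplication of formal sums and its descent to classes\<close>

lemma frag_mult_of: "frag_mult M N (frag_of (x, y)) (frag_of (x', y')) =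
    frag_of (x \<otimes>\<^bsub>M\<^esub> x', y \<otimes>\<^bsub>N\<^esub> y')"
  by (simp add: frag_mult_def)

lemma frag_mult_diff:
  "frag_mult M N (u - u') v = frag_mult M N u v - frag_mult M N u' v"
  "frag_mult M N u (v - v') = frag_mult M N u v - frag_mult M N u v'"
  by (simp_all add: frag_mult_def frag_extend_diff case_prod_unfold frag_extend_fun_diff)

lemma frag_mult_zero [simp]: "frag_mult M N 0 v = 0" "frag_mult M N u 0 = 0"
  using frag_mult_diff(1)[of 0 0] frag_mult_diff(2)[of _ 0 0] by auto

lemma frag_mult_uminus:
  "frag_mult M N (- u) v = - frag_mult M N u v"  "frag_mult M N u (- v) = - frag_mult M N u v"
  using frag_mult_diff(1)[of 0 u] frag_mult_diff(2)[of _ 0 v] by auto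

lemma frag_mult_add:
  "frag_mult M N (u + u') v = frag_mult M N u v + frag_mult M N u' v"
  "frag_mult M N u (v + v') = frag_mult M N u v + frag_mult M N u v'"
  using frag_mult_diff(1)[of u "- u'"] frag_mult_diff(2)[of _ v "- v'"]
  by (auto simp: frag_mult_uminus)

lemma frag_mult_closed:
  assumes "u \<in> carrier F" "v \<in> carrier F" shows "frag_mult M N u v \<in> carrier F"
  using assms
proof (induction u rule: F_induct)
  case (of x y)
  show ?case using \<open>v \<in> carrier F\<close>
    by (induction v rule: F_induct)
      (use of in \<open>auto simp: frag_mult_diff frag_mult_of F_diff F_of F_zero simp del: F_simps\<close>)
qed (auto simp: frag_mult_diff F_diff F_zero simp del: F_simps)

lemma frag_mult_comm:
  assumes "u \<in> carrier F" "v \<in> carrier F" shows "frag_mult M N u v = frag_mult M N v u"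
  using assms
proof (induction u rule: F_induct)
  case (of x y)
  show ?case using \<open>v \<in> carrier F\<close>
    by (induction v rule: F_induct)
      (use of in \<open>auto simp: frag_mult_diff frag_mult_of M.m_comm N.m_comm simp del: F_simps\<close>)
qed (auto simp: frag_mult_diff)

lemma frag_mult_assoc:
  assumes "u \<in> carrier F" "v \<in> carrier F" "w \<in> carrier F"
  shows "frag_mult M N (frag_mult M N u v) w = frag_mult M N u (frag_mult M N v w)"
  using assms
proof (induction u rule: F_induct)
  case u: (of x y)
  show ?case using \<open>v \<in> carrier F\<close>
  proof (induction v rule: F_induct)
    case v: (of x' y')
    show ?case using \<open>w \<in> carrier F\<close>
      by (induction w rule: F_induct)
        (use u v in \<open>auto simp: frag_mult_diff frag_mult_of M.m_assoc N.m_assoc simp del: F_simps\<close>)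
  qed (auto simp: frag_mult_diff)
qed (auto simp: frag_mult_diff)

lemma frag_mult_one:
  assumes "u \<in> carrier F" shows "frag_mult M N (frag_of (\<one>\<^bsub>M\<^esub>, \<one>\<^bsub>N\<^esub>)) u = u"
  using assms by (induction u rule: F_induct) (auto simp: frag_mult_diff frag_mult_of)

text \<open>A relation times a generator \<open>(a, b)\<close> is again a relation of the same kind;
  for the scalar relations this is the law (r x) a = r (x a) in both factors. Additivity in
  \<open>v\<close> then reaches all formal sums.\<close>

lemma frag_mult_relations:
  assumes "u \<in> relations" "v \<in> carrier F" shows "frag_mult M N u v \<in> Nul"
  using assms(2)
proof (induction v rule: F_induct)
  case (of a b)
  have "frag_mult M N u (frag_of (a, b)) \<in> relations" using assms(1)
  proof (cases rule: relations_cases)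
    case (left x x' y)
    then show ?thesis using relationsI(1)[of "x \<otimes>\<^bsub>M\<^esub> a" "x' \<otimes>\<^bsub>M\<^esub> a" "y \<otimes>\<^bsub>N\<^esub> b"] of
      by (simp add: frag_mult_diff frag_mult_add frag_mult_of M.l_distr)
  next
    case (right x y y')
    then show ?thesis using relationsI(2)[of "x \<otimes>\<^bsub>M\<^esub> a" "y \<otimes>\<^bsub>N\<^esub> b" "y' \<otimes>\<^bsub>N\<^esub> b"] of
      by (simp add: frag_mult_diff frag_mult_add frag_mult_of N.l_distr)
  next
    case (smult r x y)
    then show ?thesis using relationsI(3)[of r "x \<otimes>\<^bsub>M\<^esub> a" "y \<otimes>\<^bsub>N\<^esub> b"] of
      by (simp add: frag_mult_diff frag_mult_add frag_mult_of M.smult_assoc2 N.smult_assoc2)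
  qed
  then show ?case unfolding Nul_eq by (rule generate.incl)
qed (auto simp: frag_mult_diff Nul_simps)

text \<open>\<open>Nul\<close> is an ideal: its elements arise from relations by sums and negatives,
  and the second side follows from commutativity.\<close>

lemma frag_mult_Nul:
  assumes "u \<in> Nul" "v \<in> carrier F"
  shows "frag_mult M N u v \<in> Nul" "frag_mult M N v u \<in> Nul"
proof -
  show *: "frag_mult M N u v \<in> Nul" using assms(1) unfolding Nul_eq
  proof (induction u rule: generate.induct)
    case (inv h)
    then have "inv\<^bsub>F\<^esub> h = - h" using relations_subset by auto
    then show ?case
      using inv frag_mult_relations[OF inv assms(2)] by (simp add: frag_mult_uminus Nul_simps flip: Nul_eq)
  qed (use assms(2) frag_mult_relations in
    \<open>auto simp: frag_mult_add Nul_simps simp flip: Nul_eq\<close>)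
  show "frag_mult M N v u \<in> Nul"
    using * frag_mult_comm[of u v] assms Nul_simps(5) by metis
qed

lemma cls_self: "u \<in> cls u"
  using Nul_simps(1) by (auto simp: cls_eq intro: image_eqI[of _ _ 0])

lemma cls_subset: "u \<in> carrier F \<Longrightarrow> v \<in> cls u \<Longrightarrow> v \<in> carrier F"
  by (auto simp: cls_eq F_add Nul_simps(5) simp del: F_simps)

text \<open>The product in \<open>tensor_ring\<close> is a union over all representatives. It is a
  single class because u' v' - u v = (u' - u) v' + u (v' - v), and both terms lie in the ideal
  \<open>Nul\<close>.\<close>

lemma cls_mult:
  assumes "u \<in> carrier F" "v \<in> carrier F"
  shows "cls u \<otimes>\<^bsub>T\<^esub> cls v = cls (frag_mult M N u v)"
proof -
  have "cls (frag_mult M N u' v') = cls (frag_mult M N u v)"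
    if "u' \<in> cls u" "v' \<in> cls v" for u' v'
  proof -
    have "frag_mult M N u' v' - frag_mult M N u v =
        frag_mult M N (u' - u) v' + frag_mult M N u (v' - v)"
      by (simp add: frag_mult_diff)
    moreover have "u' - u \<in> Nul" "v' - v \<in> Nul" "v' \<in> carrier F"
      using that assms cls_subset by (auto simp: cls_eq)
    ultimately show ?thesis
      using assms frag_mult_Nul by (simp add: cls_eq_iff Nul_simps del: F_simps)
  qed
  moreover have "cls u \<noteq> {}" "cls v \<noteq> {}" using cls_self by blast+
  ultimately have "(\<Union>u' \<in> cls u. \<Union>v' \<in> cls v. cls (frag_mult M N u' v')) = cls (frag_mult M N u v)"
    by (intro SUP_eq_const)
  then show ?thesis
    by (simp add: tensor_ring_def)
qed

lemma add_monoid_T: "add_monoid T = F Mod Nul"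
  by (simp add: tensor_ring_def FactGroup_def)

lemma cring_T: "cring T"
proof (rule cringI)
  show ab: "abelian_group T"
    by (rule comm_group_abelian_groupI)
      (simp only: add_monoid_T F.abelian_FactGroup[OF Nul_subgroup])
  note [simp del] = F_simps
  show "Group.comm_monoid T"
  proof (rule comm_monoidI)
    have one: "\<one>\<^bsub>T\<^esub> = cls (frag_of (\<one>\<^bsub>M\<^esub>, \<one>\<^bsub>N\<^esub>))"
      by (simp add: tensor_ring_def pure_tensor_def)
    show "\<one>\<^bsub>T\<^esub> \<in> carrier T"
      by (simp add: one cls_carrier F_of)
    show "\<one>\<^bsub>T\<^esub> \<otimes>\<^bsub>T\<^esub> x = x" if "x \<in> carrier T" for x
      using that by (auto simp: one carrier_T cls_mult frag_mult_one F_of)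
    show "x \<otimes>\<^bsub>T\<^esub> y = y \<otimes>\<^bsub>T\<^esub> x" if xy: "x \<in> carrier T" "y \<in> carrier T" for x y
    proof -
      obtain u v where "x = cls u" "y = cls v" "u \<in> carrier F" "v \<in> carrier F"
        using xy unfolding carrier_T by blast
      then show ?thesis using frag_mult_comm[of u v] by (simp add: cls_mult)
    qed
  qed (auto simp: carrier_T cls_mult frag_mult_closed frag_mult_assoc)
  show "(x \<oplus>\<^bsub>T\<^esub> y) \<otimes>\<^bsub>T\<^esub> z = x \<otimes>\<^bsub>T\<^esub> z \<oplus>\<^bsub>T\<^esub> y \<otimes>\<^bsub>T\<^esub> z"
    if "x \<in> carrier T" "y \<in> carrier T" "z \<in> carrier T" for x y z
    using that by (auto simp: carrier_T cls_mult cls_add frag_mult_closed frag_mult_add F_add)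
qed

sublocale T: cring T by (rule cring_T)

section \<open>Calculus of pure tensors\<close>

lemma tens_closed [simp, intro]:
  "x \<in> carrier M \<Longrightarrow> y \<in> carrier N \<Longrightarrow> x \<otimes>\<^sub>T y \<in> carrier T"
  by (simp add: pure_tensor_def cls_carrier F_of del: F_simps)

lemma tens_mult:
  "\<lbrakk>x \<in> carrier M; y \<in> carrier N; x' \<in> carrier M; y' \<in> carrier N\<rbrakk> \<Longrightarrow>
    (x \<otimes>\<^sub>T y) \<otimes>\<^bsub>T\<^esub> (x' \<otimes>\<^sub>T y') = (x \<otimes>\<^bsub>M\<^esub> x') \<otimes>\<^sub>T (y \<otimes>\<^bsub>N\<^esub> y')"
  by (simp add: pure_tensor_def cls_mult F_of frag_mult_of del: F_simps)

lemma tens_one: "\<one>\<^bsub>T\<^esub> = \<one>\<^bsub>M\<^esub> \<otimes>\<^sub>T \<one>\<^bsub>N\<^esub>"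
  by (simp add: tensor_ring_def)

lemma relations_Nul: "u \<in> relations \<Longrightarrow> u \<in> Nul"
  unfolding Nul_eq by (rule generate.incl)

lemma tens_add_left:
  "\<lbrakk>x \<in> carrier M; x' \<in> carrier M; y \<in> carrier N\<rbrakk> \<Longrightarrow>
    (x \<oplus>\<^bsub>M\<^esub> x') \<otimes>\<^sub>T y = (x \<otimes>\<^sub>T y) \<oplus>\<^bsub>T\<^esub> (x' \<otimes>\<^sub>T y)"
  by (simp add: pure_tensor_def cls_add F_of cls_eq_iff relationsI relations_Nul del: F_simps)

lemma tens_add_right:
  "\<lbrakk>x \<in> carrier M; y \<in> carrier N; y' \<in> carrier N\<rbrakk> \<Longrightarrow>
    x \<otimes>\<^sub>T (y \<oplus>\<^bsub>N\<^esub> y') = (x \<otimes>\<^sub>T y) \<oplus>\<^bsub>T\<^esub> (x \<otimes>\<^sub>T y')"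
  by (simp add: pure_tensor_def cls_add F_of cls_eq_iff relationsI relations_Nul del: F_simps)

lemma tens_smult:
  "\<lbrakk>r \<in> carrier R; x \<in> carrier M; y \<in> carrier N\<rbrakk> \<Longrightarrow> (r \<odot>\<^bsub>M\<^esub> x) \<otimes>\<^sub>T y = x \<otimes>\<^sub>T (r \<odot>\<^bsub>N\<^esub> y)"
  by (simp add: pure_tensor_def cls_eq_iff relationsI relations_Nul)

lemma tens_zero:
  "y \<in> carrier N \<Longrightarrow> \<zero>\<^bsub>M\<^esub> \<otimes>\<^sub>T y = \<zero>\<^bsub>T\<^esub>" "x \<in> carrier M \<Longrightarrow> x \<otimes>\<^sub>T \<zero>\<^bsub>N\<^esub> = \<zero>\<^bsub>T\<^esub>"
  using tens_add_left[of "\<zero>\<^bsub>M\<^esub>" "\<zero>\<^bsub>M\<^esub>" y] tens_add_right[of x "\<zero>\<^bsub>N\<^esub>" "\<zero>\<^bsub>N\<^esub>"]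
    T.add.r_cancel_one'[of "\<zero>\<^bsub>M\<^esub> \<otimes>\<^sub>T y" "\<zero>\<^bsub>M\<^esub> \<otimes>\<^sub>T y"] T.add.r_cancel_one'[of "x \<otimes>\<^sub>T \<zero>\<^bsub>N\<^esub>" "x \<otimes>\<^sub>T \<zero>\<^bsub>N\<^esub>"]
  by auto

lemma tens_uminus_left:
  assumes "x \<in> carrier M" "y \<in> carrier N"
  shows "\<ominus>\<^bsub>T\<^esub> (x \<otimes>\<^sub>T y) = (\<ominus>\<^bsub>M\<^esub> x) \<otimes>\<^sub>T y"
proof (rule T.minus_equality)
  show "(\<ominus>\<^bsub>M\<^esub> x) \<otimes>\<^sub>T y \<oplus>\<^bsub>T\<^esub> x \<otimes>\<^sub>T y = \<zero>\<^bsub>T\<^esub>"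
    using assms by (simp add: M.l_neg tens_zero flip: tens_add_left)
qed (use assms in simp_all)

text \<open>The negative of a pure tensor is pure, so sums of pure tensors already exhaust
  \<open>T\<close> and negatives need no case of their own.\<close>

lemma tensor_induct [consumes 1, case_names pure add]:
  assumes "U \<in> carrier T"
    and pure: "\<And>x y. x \<in> carrier M \<Longrightarrow> y \<in> carrier N \<Longrightarrow> P (x \<otimes>\<^sub>T y)"
    and add: "\<And>U V. U \<in> carrier T \<Longrightarrow> V \<in> carrier T \<Longrightarrow> P U \<Longrightarrow> P V \<Longrightarrow> P (U \<oplus>\<^bsub>T\<^esub> V)"
  shows "P U"
proof -
  \<comment> \<open>A class and its negative are carried together because \<open>F_induct\<close>
    produces differences.\<close>
  have "u \<in> carrier F \<Longrightarrow> P (cls u) \<and> P (\<ominus>\<^bsub>T\<^esub> cls u)" for u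
  proof (induction u rule: F_induct)
    case zero
    then show ?case using pure[of "\<zero>\<^bsub>M\<^esub>" "\<zero>\<^bsub>N\<^esub>"] by (simp add: tens_zero flip: zero_T)
  next
    case (diff u v)
    then have uv: "cls u \<in> carrier T" "cls v \<in> carrier T" by (auto simp: cls_carrier simp del: F_simps)
    have "cls (u - v) \<oplus>\<^bsub>T\<^esub> cls v = cls u"
      using diff by (simp add: cls_add F_diff del: F_simps)
    moreover have "cls (u - v) \<in> carrier T" using diff by (simp add: cls_carrier F_diff del: F_simps)
    ultimately have "cls (u - v) = cls u \<oplus>\<^bsub>T\<^esub> \<ominus>\<^bsub>T\<^esub> cls v"
      using uv by (metis T.add.inv_solve_right)
    then show ?case using add diff uv by (simp add: T.minus_add)
  next
    case (of x y)
    then show ?case using pure[of x y] pure[of "\<ominus>\<^bsub>M\<^esub> x" y]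
      by (simp add: tens_uminus_left flip: pure_tensor_def)
  qed
  then show ?thesis using assms(1) by (auto simp: carrier_T simp del: F_simps)
qed

end

text \<open>Has the shape of \<open>tensor_mult_map\<close> with an arbitrary map \<open>f\<close>
  in place of the product, so that one universal property covers the product map and the functionals
  on tensor products.\<close>

definition tensor_lift :: "('c, 'p) ring_scheme \<Rightarrow> ('a \<times> 'b \<Rightarrow> 'c) \<Rightarrow> (('a \<times> 'b) \<Rightarrow>\<^sub>0 int) set \<Rightarrow> 'c" where
  "tensor_lift P f U = the_elem
    ((\<lambda>u. \<Oplus>\<^bsub>P\<^esub>p \<in> Poly_Mapping.keys u. [Poly_Mapping.lookup u p] \<cdot>\<^bsub>P\<^esub> f p) ` U)"

locale balanced_map = algebra_pair R M N + P: abelian_group P for R M N P +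
  fixes f
  assumes closed: "\<lbrakk>x \<in> carrier M; y \<in> carrier N\<rbrakk> \<Longrightarrow> f (x, y) \<in> carrier P"
    and add_left: "\<lbrakk>x \<in> carrier M; x' \<in> carrier M; y \<in> carrier N\<rbrakk> \<Longrightarrow>
      f (x \<oplus>\<^bsub>M\<^esub> x', y) = f (x, y) \<oplus>\<^bsub>P\<^esub> f (x', y)"
    and add_right: "\<lbrakk>x \<in> carrier M; y \<in> carrier N; y' \<in> carrier N\<rbrakk> \<Longrightarrow>
      f (x, y \<oplus>\<^bsub>N\<^esub> y') = f (x, y) \<oplus>\<^bsub>P\<^esub> f (x, y')"
    and balanced: "\<lbrakk>r \<in> carrier R; x \<in> carrier M; y \<in> carrier N\<rbrakk> \<Longrightarrow>
      f (r \<odot>\<^bsub>M\<^esub> x, y) = f (x, r \<odot>\<^bsub>N\<^esub> y)"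
begin

abbreviation "lift \<equiv> tensor_lift P f"

text \<open>The universal property. The extension of \<open>f\<close> to a homomorphism
  \<open>h\<close> on formal sums kills the relations and is thus constant on each class. By
  \<open>hom_frag_combination\<close> the explicit sum in \<open>tensor_lift\<close> equals
  \<open>h\<close>, so the set handed to \<open>the_elem\<close> is a singleton.\<close>

lemma lift_props:
  "\<And>U V. U \<in> carrier T \<Longrightarrow> V \<in> carrier T \<Longrightarrow> lift (U \<oplus>\<^bsub>T\<^esub> V) = lift U \<oplus>\<^bsub>P\<^esub> lift V"
  "\<And>x y. x \<in> carrier M \<Longrightarrow> y \<in> carrier N \<Longrightarrow> lift (x \<otimes>\<^sub>T y) = f (x, y)"
proof -
  have f: "f ` (carrier M \<times> carrier N) \<subseteq> carrier (add_monoid P)" using closed by auto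
  obtain h where h: "h \<in> hom F (add_monoid P)"
    and hf: "\<And>x. x \<in> carrier M \<times> carrier N \<Longrightarrow> h (frag_of x) = f x"
    using comm_group.free_Abelian_group_universal[OF P.a_comm_group f] unfolding tensor_free_def
    by metis
  interpret h: group_hom F "add_monoid P" h
    by (simp add: group_hom_def group_hom_axioms_def h P.a_group F.group_axioms)
  have hF: "h (u - v) = h u \<oplus>\<^bsub>P\<^esub> \<ominus>\<^bsub>P\<^esub> h v" "h u \<in> carrier P" "h (u + v) = h u \<oplus>\<^bsub>P\<^esub> h v"
    if "u \<in> carrier F" "v \<in> carrier F" for u v
    using h.hom_mult[of u "- v"] h.hom_mult[of u v] h.hom_inv[of v] h.hom_closed[of u] that F_uminus[of v]
    by (auto simp: a_inv_def)
  note [simp del] = F_simps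
  have rel: "h u = \<zero>\<^bsub>P\<^esub>" if "u \<in> relations" for u
    using that by (cases rule: relations_cases)
      (auto simp: hF hf F_of F_add F_diff closed add_left add_right balanced P.r_neg)
  have Nul: "h u = \<zero>\<^bsub>P\<^esub>" if "u \<in> Nul" for u
    using that unfolding Nul_eq
  proof (induction rule: generate.induct)
    case (inv u)
    then show ?case using relations_subset h.hom_inv[of u] rel[of u] by (auto simp flip: a_inv_def)
  next
    case (eng u v)
    then show ?case using h.hom_mult[of u v] Nul.mem_carrier unfolding Nul_eq by auto
  qed (use rel h.hom_one in auto)
  have sum: "(\<Oplus>\<^bsub>P\<^esub>p \<in> Poly_Mapping.keys u. [Poly_Mapping.lookup u p] \<cdot>\<^bsub>P\<^esub> f p) = h u"
    if "u \<in> carrier F" for u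
  proof -
    have k: "Poly_Mapping.keys u \<subseteq> carrier M \<times> carrier N" using that by (simp add: F_simps)
    have "h u = (\<Oplus>\<^bsub>P\<^esub>p \<in> Poly_Mapping.keys u. [Poly_Mapping.lookup u p] \<cdot>\<^bsub>P\<^esub> h (frag_of p))"
      using hom_frag_combination[OF h[unfolded tensor_free_def] P.a_comm_group k]
      by (simp add: finsum_def add_pow_def)
    also have "\<dots> = (\<Oplus>\<^bsub>P\<^esub>p \<in> Poly_Mapping.keys u. [Poly_Mapping.lookup u p] \<cdot>\<^bsub>P\<^esub> f p)"
      by (rule P.finsum_cong') (use k hf closed in \<open>auto intro!: P.add.int_pow_closed\<close>)
    finally show ?thesis ..
  qed
  have lift: "lift (cls u) = h u" if "u \<in> carrier F" for u
  proof -
    have v: "(\<Oplus>\<^bsub>P\<^esub>p \<in> Poly_Mapping.keys v. [Poly_Mapping.lookup v p] \<cdot>\<^bsub>P\<^esub> f p) = h u" if v: "v \<in> cls u" for v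
    proof -
      obtain n where n: "n \<in> Nul" "v = n + u" using v by (auto simp: cls_eq)
      have "h v = h u"
        using hF(3)[of n u] Nul[OF n(1)] hF(2)[of u u] \<open>u \<in> carrier F\<close> Nul_simps(5)[OF n(1)] n(2) by simp
      then show ?thesis using sum[OF cls_subset[OF \<open>u \<in> carrier F\<close> v]] by simp
    qed
    let ?g = "\<lambda>v. \<Oplus>\<^bsub>P\<^esub>p \<in> Poly_Mapping.keys v. [Poly_Mapping.lookup v p] \<cdot>\<^bsub>P\<^esub> f p"
    have "the_elem (?g ` cls u) = ?g u"
      by (rule the_elem_image_unique) (use cls_self[of u] v in auto)
    then show ?thesis
      using v[OF cls_self] by (simp add: tensor_lift_def)
  qed
  show "lift (U \<oplus>\<^bsub>T\<^esub> V) = lift U \<oplus>\<^bsub>P\<^esub> lift V" if UV: "U \<in> carrier T" "V \<in> carrier T" for U V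
  proof -
    obtain u v where "U = cls u" "V = cls v" "u \<in> carrier F" "v \<in> carrier F"
      using UV unfolding carrier_T by blast
    then show ?thesis by (simp add: cls_add lift F_add hF(3))
  qed
  show "lift (x \<otimes>\<^sub>T y) = f (x, y)" if "x \<in> carrier M" "y \<in> carrier N" for x y
    using that by (simp add: pure_tensor_def lift F_of hf)
qed

lemma lift_closed: "U \<in> carrier T \<Longrightarrow> lift U \<in> carrier P"
  by (induction U rule: tensor_induct) (auto simp: lift_props closed)

end

section \<open>Extension of scalars\<close>

lemma with_smult_simps [simp]:
  "carrier (with_smult S f) = carrier S" "monoid.mult (with_smult S f) = monoid.mult S"
  "\<one>\<^bsub>with_smult S f\<^esub> = \<one>\<^bsub>S\<^esub>" "\<zero>\<^bsub>with_smult S f\<^esub> = \<zero>\<^bsub>S\<^esub>"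
  "ring.add (with_smult S f) = ring.add S" "smult (with_smult S f) = f"
  by (simp_all add: with_smult_def)

lemma cring_with_smult:
  assumes "cring S" shows "cring (with_smult S f)"
proof -
  interpret S: cring S by fact
  show ?thesis
  proof (rule cringI)
    show "abelian_group (with_smult S f)"
      by (rule abelian_groupI) (auto simp: S.a_ac intro: S.l_neg S.add.l_inv_ex)
    show "Group.comm_monoid (with_smult S f)"
      by (rule comm_monoidI) (auto simp: S.m_ac)
  qed (simp add: S.l_distr)
qed

lemma algebra_int_algebra:
  assumes "cring S" shows "algebra \<Z> (int_algebra S)"
proof -
  interpret S: cring S by fact
  show ?thesis
    unfolding int_algebra_def
    by (rule algebraI[OF int_is_cring cring_with_smult[OF assms]])
      (auto simp: S.add.int_pow_mult S.add.int_pow_distrib S.add.int_pow_pow S.add_pow_ldistr_int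
        mult.commute S.add.int_pow_closed)
qed

lemma int_algebra_simps [simp]:
  "carrier (int_algebra S) = carrier S" "monoid.mult (int_algebra S) = monoid.mult S"
  "\<one>\<^bsub>int_algebra S\<^esub> = \<one>\<^bsub>S\<^esub>" "\<zero>\<^bsub>int_algebra S\<^esub> = \<zero>\<^bsub>S\<^esub>"
  "ring.add (int_algebra S) = ring.add S" "smult (int_algebra S) = (\<lambda>n x. [n] \<cdot>\<^bsub>S\<^esub> x)"
  by (simp_all add: int_algebra_def)

locale scalar_ext = R: cring R + B: cring B for R B
begin

sublocale E: algebra_pair \<Z> "int_algebra R" "int_algebra B"
  by (intro algebra_pair.intro algebra_int_algebra R.is_cring B.is_cring)

abbreviation "A \<equiv> scalar_extension R B"
abbreviation ten (infixl \<open>\<otimes>\<^sub>A\<close> 75) where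
  "r \<otimes>\<^sub>A b \<equiv> pure_tensor \<Z> (int_algebra R) (int_algebra B) r b"

lemma A_simps [simp]:
  "carrier A = carrier E.T" "monoid.mult A = monoid.mult E.T"
  "\<one>\<^bsub>A\<^esub> = \<one>\<^bsub>E.T\<^esub>" "\<zero>\<^bsub>A\<^esub> = \<zero>\<^bsub>E.T\<^esub>" "ring.add A = ring.add E.T"
  "r \<odot>\<^bsub>A\<^esub> t = (r \<otimes>\<^sub>A \<one>\<^bsub>B\<^esub>) \<otimes>\<^bsub>E.T\<^esub> t"
  by (simp_all add: scalar_extension_def Let_def)

lemma ten_closed: "r \<in> carrier R \<Longrightarrow> b \<in> carrier B \<Longrightarrow> r \<otimes>\<^sub>A b \<in> carrier A"
  by simp

lemma ten_mult: "\<lbrakk>r \<in> carrier R; b \<in> carrier B; r' \<in> carrier R; b' \<in> carrier B\<rbrakk> \<Longrightarrow>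
    (r \<otimes>\<^sub>A b) \<otimes>\<^bsub>A\<^esub> (r' \<otimes>\<^sub>A b') = (r \<otimes>\<^bsub>R\<^esub> r') \<otimes>\<^sub>A (b \<otimes>\<^bsub>B\<^esub> b')"
  by (simp add: E.tens_mult)

lemma ten_one: "\<one>\<^bsub>A\<^esub> = \<one>\<^bsub>R\<^esub> \<otimes>\<^sub>A \<one>\<^bsub>B\<^esub>"
  by (simp add: E.tens_one)

lemma ten_smult: "\<lbrakk>s \<in> carrier R; r \<in> carrier R; b \<in> carrier B\<rbrakk> \<Longrightarrow>
    s \<odot>\<^bsub>A\<^esub> (r \<otimes>\<^sub>A b) = (s \<otimes>\<^bsub>R\<^esub> r) \<otimes>\<^sub>A b"
  by (simp add: E.tens_mult)

lemma ten_int: "\<lbrakk>r \<in> carrier R; b \<in> carrier B\<rbrakk> \<Longrightarrow> ([(n :: int)] \<cdot>\<^bsub>R\<^esub> r) \<otimes>\<^sub>A b = r \<otimes>\<^sub>A ([n] \<cdot>\<^bsub>B\<^esub> b)"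
  using E.tens_smult[of n r b] by simp

lemma ten_add_left: "\<lbrakk>r \<in> carrier R; r' \<in> carrier R; b \<in> carrier B\<rbrakk> \<Longrightarrow>
    (r \<oplus>\<^bsub>R\<^esub> r') \<otimes>\<^sub>A b = (r \<otimes>\<^sub>A b) \<oplus>\<^bsub>A\<^esub> (r' \<otimes>\<^sub>A b)"
  using E.tens_add_left[of r r' b] by simp

lemma ten_add_right: "\<lbrakk>r \<in> carrier R; b \<in> carrier B; b' \<in> carrier B\<rbrakk> \<Longrightarrow>
    r \<otimes>\<^sub>A (b \<oplus>\<^bsub>B\<^esub> b') = (r \<otimes>\<^sub>A b) \<oplus>\<^bsub>A\<^esub> (r \<otimes>\<^sub>A b')"
  using E.tens_add_right[of r b b'] by simp

lemma ten_induct [consumes 1, case_names pure add]: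
  assumes "a \<in> carrier A"
    and "\<And>r b. r \<in> carrier R \<Longrightarrow> b \<in> carrier B \<Longrightarrow> P (r \<otimes>\<^sub>A b)"
    and "\<And>a a'. a \<in> carrier A \<Longrightarrow> a' \<in> carrier A \<Longrightarrow> P a \<Longrightarrow> P a' \<Longrightarrow> P (a \<oplus>\<^bsub>A\<^esub> a')"
  shows "P a"
  by (rule E.tensor_induct[of a P]) (use assms in auto)

lemma algebra_A: "algebra R A"
proof (rule algebraI[OF R.is_cring])
  show "cring A"
    using cring_with_smult[OF E.cring_T] by (simp add: scalar_extension_def Let_def)
qed (auto simp: E.tens_mult ten_add_left[simplified] E.T.l_distr E.T.r_distr
    simp flip: E.T.m_assoc ten_one[simplified])

sublocale A: algebra R A by (rule algebra_A)

text \<open>Turns an integer invariant of B into an R-linear map on R \<otimes> B, namely r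
  \<otimes> b \<mapsto> h(b) r. An additive h satisfies h(n b) = n h(b), which is balancedness over
  the integers.\<close>

lemma hom_extend:
  fixes h :: "_ \<Rightarrow> int"
  assumes h: "\<And>b b'. b \<in> carrier B \<Longrightarrow> b' \<in> carrier B \<Longrightarrow> h (b \<oplus>\<^bsub>B\<^esub> b') = h b + h b'"
  obtains \<phi> where "\<And>r b. r \<in> carrier R \<Longrightarrow> b \<in> carrier B \<Longrightarrow> \<phi> (r \<otimes>\<^sub>A b) = [h b] \<cdot>\<^bsub>R\<^esub> r"
    "\<And>a. a \<in> carrier A \<Longrightarrow> \<phi> a \<in> carrier R"
    "\<And>a a'. a \<in> carrier A \<Longrightarrow> a' \<in> carrier A \<Longrightarrow> \<phi> (a \<oplus>\<^bsub>A\<^esub> a') = \<phi> a \<oplus>\<^bsub>R\<^esub> \<phi> a'"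
    "\<And>r a. r \<in> carrier R \<Longrightarrow> a \<in> carrier A \<Longrightarrow> \<phi> (r \<odot>\<^bsub>A\<^esub> a) = r \<otimes>\<^bsub>R\<^esub> \<phi> a"
proof -
  have "h \<in> hom (add_monoid B) (add_monoid \<Z>)"
    using h by (auto simp: hom_def)
  then interpret h: group_hom "add_monoid B" "add_monoid \<Z>" h
    by (intro group_hom.intro group_hom_axioms.intro B.a_group abelian_group.a_group
        ring.is_abelian_group cring.axioms(1) int_is_cring)
  have hn: "h ([n] \<cdot>\<^bsub>B\<^esub> b) = n * h b" if "b \<in> carrier B" for b and n :: int
  proof -
    have nat: "h ([k] \<cdot>\<^bsub>B\<^esub> b) = int k * h b" for k :: nat
      using that h.hom_one by (induction k) (auto simp: h algebra_simps)
    have neg: "h (\<ominus>\<^bsub>B\<^esub> c) = - h c" if "c \<in> carrier B" for c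
      using h[of c "\<ominus>\<^bsub>B\<^esub> c"] h.hom_one that by (simp add: B.r_neg)
    show ?thesis
      using that by (cases "n \<ge> 0") (auto simp: add_pow_int_ge add_pow_int_lt nat neg)
  qed
  interpret L: balanced_map \<Z> "int_algebra R" "int_algebra B" R "\<lambda>(r, b). [h b] \<cdot>\<^bsub>R\<^esub> r"
    by unfold_locales
      (auto simp: h hn R.add.int_pow_mult R.add.int_pow_distrib R.add.int_pow_pow mult.commute)
  show thesis
  proof (rule that[of L.lift])
    show pure: "L.lift (r \<otimes>\<^sub>A b) = [h b] \<cdot>\<^bsub>R\<^esub> r" if "r \<in> carrier R" "b \<in> carrier B" for r b
      using that by (simp add: L.lift_props)
    show cl: "L.lift a \<in> carrier R" if "a \<in> carrier A" for a
      using that by (simp add: L.lift_closed)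
    show add: "L.lift (a \<oplus>\<^bsub>A\<^esub> a') = L.lift a \<oplus>\<^bsub>R\<^esub> L.lift a'" if "a \<in> carrier A" "a' \<in> carrier A" for a a'
      using that by (simp add: L.lift_props)
    show "L.lift (r \<odot>\<^bsub>A\<^esub> a) = r \<otimes>\<^bsub>R\<^esub> L.lift a" if "r \<in> carrier R" "a \<in> carrier A" for r a
      using that(2)
    proof (induction a rule: ten_induct)
      case (pure s b)
      then show ?case using that(1) by (simp add: E.tens_mult L.lift_props R.add_pow_rdistr_int)
    next
      case (add a a')
      then show ?case using that(1) by (simp add: E.T.r_distr L.lift_props L.lift_closed R.r_distr)
    qed
  qed
qed

end

section \<open>Separability of commutative algebras\<close>

locale self_tensor = A: algebra R A for R A
begin

sublocale P: algebra_pair R A A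
  by (intro algebra_pair.intro A.algebra_axioms)

abbreviation "T \<equiv> tensor_ring R A A"
abbreviation tens (infixl \<open>\<otimes>\<^sub>T\<close> 75) where "x \<otimes>\<^sub>T y \<equiv> pure_tensor R A A x y"
abbreviation "\<mu> \<equiv> tensor_mult_map A"

lemma smult_mult: "\<lbrakk>r \<in> carrier R; x \<in> carrier A; y \<in> carrier A\<rbrakk> \<Longrightarrow>
    x \<otimes>\<^bsub>A\<^esub> (r \<odot>\<^bsub>A\<^esub> y) = r \<odot>\<^bsub>A\<^esub> (x \<otimes>\<^bsub>A\<^esub> y)"
  using A.smult_assoc2[of r y x] by (simp add: A.m_comm)

sublocale \<mu>: balanced_map R A A A "\<lambda>p. fst p \<otimes>\<^bsub>A\<^esub> snd p"
  by unfold_locales (auto simp: A.l_distr A.r_distr A.smult_assoc2 smult_mult)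

lemma \<mu>_eq: "\<mu> = tensor_lift A (\<lambda>p. fst p \<otimes>\<^bsub>A\<^esub> snd p)"
  by (simp add: tensor_mult_map_def tensor_lift_def fun_eq_iff)

lemma \<mu>_closed [simp]: "U \<in> carrier T \<Longrightarrow> \<mu> U \<in> carrier A"
  and \<mu>_add: "U \<in> carrier T \<Longrightarrow> V \<in> carrier T \<Longrightarrow> \<mu> (U \<oplus>\<^bsub>T\<^esub> V) = \<mu> U \<oplus>\<^bsub>A\<^esub> \<mu> V"
  and \<mu>_tens: "x \<in> carrier A \<Longrightarrow> y \<in> carrier A \<Longrightarrow> \<mu> (x \<otimes>\<^sub>T y) = x \<otimes>\<^bsub>A\<^esub> y"
  by (simp_all add: \<mu>_eq \<mu>.lift_closed \<mu>.lift_props)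

lemma \<mu>_left:
  assumes "U \<in> carrier T" "a \<in> carrier A"
  shows "\<mu> ((a \<otimes>\<^sub>T \<one>\<^bsub>A\<^esub>) \<otimes>\<^bsub>T\<^esub> U) = a \<otimes>\<^bsub>A\<^esub> \<mu> U"
  using assms(1)
proof (induction U rule: P.tensor_induct)
  case (pure x y)
  then show ?case using assms(2) by (simp add: P.tens_mult \<mu>_tens A.m_assoc)
next
  case (add U V)
  then show ?case using assms(2) by (simp add: P.T.r_distr \<mu>_add A.r_distr)
qed

text \<open>A section \<open>s\<close> is generated by its value E at 1: computing
  \<open>s a\<close> by left and by right linearity gives the commutation rule for E, and conversely
  that rule makes \<open>s x = (x \<otimes> 1) E\<close> a bimodule map. E is known as a
  separability idempotent.\<close>

lemma separable_iff:
  "separable_algebra R A \<longleftrightarrow>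
    (\<exists>E \<in> carrier T. (\<forall>a \<in> carrier A. (a \<otimes>\<^sub>T \<one>\<^bsub>A\<^esub>) \<otimes>\<^bsub>T\<^esub> E = E \<otimes>\<^bsub>T\<^esub> (\<one>\<^bsub>A\<^esub> \<otimes>\<^sub>T a)) \<and> \<mu> E = \<one>\<^bsub>A\<^esub>)"
  (is "_ \<longleftrightarrow> ?R")
proof
  assume "separable_algebra R A"
  then obtain s where s: "s \<in> hom (add_monoid A) (add_monoid T)"
    and bi: "\<And>a x. a \<in> carrier A \<Longrightarrow> x \<in> carrier A \<Longrightarrow> s (a \<otimes>\<^bsub>A\<^esub> x) = (a \<otimes>\<^sub>T \<one>\<^bsub>A\<^esub>) \<otimes>\<^bsub>T\<^esub> s x"
      "\<And>a x. a \<in> carrier A \<Longrightarrow> x \<in> carrier A \<Longrightarrow> s (x \<otimes>\<^bsub>A\<^esub> a) = s x \<otimes>\<^bsub>T\<^esub> (\<one>\<^bsub>A\<^esub> \<otimes>\<^sub>T a)"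
    and sec: "\<And>x. x \<in> carrier A \<Longrightarrow> \<mu> (s x) = x"
    unfolding separable_algebra_def Let_def by blast
  have "s \<one>\<^bsub>A\<^esub> \<in> carrier T" using s by (auto simp: hom_def Pi_iff)
  moreover have "(a \<otimes>\<^sub>T \<one>\<^bsub>A\<^esub>) \<otimes>\<^bsub>T\<^esub> s \<one>\<^bsub>A\<^esub> = s \<one>\<^bsub>A\<^esub> \<otimes>\<^bsub>T\<^esub> (\<one>\<^bsub>A\<^esub> \<otimes>\<^sub>T a)" if "a \<in> carrier A" for a
    using bi(1)[of a "\<one>\<^bsub>A\<^esub>"] bi(2)[of a "\<one>\<^bsub>A\<^esub>"] that by simp
  ultimately show ?R using sec[of "\<one>\<^bsub>A\<^esub>"] by auto
next
  assume ?R
  then obtain E where E: "E \<in> carrier T" "\<mu> E = \<one>\<^bsub>A\<^esub>"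
    and comm: "\<And>a. a \<in> carrier A \<Longrightarrow> (a \<otimes>\<^sub>T \<one>\<^bsub>A\<^esub>) \<otimes>\<^bsub>T\<^esub> E = E \<otimes>\<^bsub>T\<^esub> (\<one>\<^bsub>A\<^esub> \<otimes>\<^sub>T a)"
    by blast
  define s where "s x = (x \<otimes>\<^sub>T \<one>\<^bsub>A\<^esub>) \<otimes>\<^bsub>T\<^esub> E" for x
  have "s \<in> hom (add_monoid A) (add_monoid T)"
    using E by (auto simp: hom_def s_def P.tens_add_left P.T.l_distr)
  moreover have left: "s (a \<otimes>\<^bsub>A\<^esub> x) = (a \<otimes>\<^sub>T \<one>\<^bsub>A\<^esub>) \<otimes>\<^bsub>T\<^esub> s x" if "a \<in> carrier A" "x \<in> carrier A" for a x
    using that E by (simp add: s_def P.tens_mult flip: P.T.m_assoc)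
  moreover have "s (x \<otimes>\<^bsub>A\<^esub> a) = s x \<otimes>\<^bsub>T\<^esub> (\<one>\<^bsub>A\<^esub> \<otimes>\<^sub>T a)" if "a \<in> carrier A" "x \<in> carrier A" for a x
    using that E left[of x a] comm[of a] by (simp add: s_def P.T.m_assoc)
  moreover have "\<mu> (s x) = x" if "x \<in> carrier A" for x
    using that E by (simp add: s_def \<mu>_left)
  ultimately show "separable_algebra R A"
    unfolding separable_algebra_def Let_def by (intro bexI[of _ s] conjI ballI)
qed

text \<open>For every U the functional p \<otimes> q sends (x \<otimes> 1) U to q(\<mu> U), since on
  pure tensors p(x a) q(b) = q(a) q(b) = q(a b). It sends U (1 \<otimes> x) to q(x) times its value
  at U. For U = E the two agree, so its value at E is an inverse of q(x).\<close>

lemma separable_imp_unit: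
  assumes sep: "separable_algebra R A"
    and p: "\<And>a. a \<in> carrier A \<Longrightarrow> p a \<in> carrier R"
      "\<And>a b. a \<in> carrier A \<Longrightarrow> b \<in> carrier A \<Longrightarrow> p (a \<oplus>\<^bsub>A\<^esub> b) = p a \<oplus>\<^bsub>R\<^esub> p b"
      "\<And>r a. r \<in> carrier R \<Longrightarrow> a \<in> carrier A \<Longrightarrow> p (r \<odot>\<^bsub>A\<^esub> a) = r \<otimes>\<^bsub>R\<^esub> p a"
    and q: "\<And>a. a \<in> carrier A \<Longrightarrow> q a \<in> carrier R"
      "\<And>a b. a \<in> carrier A \<Longrightarrow> b \<in> carrier A \<Longrightarrow> q (a \<oplus>\<^bsub>A\<^esub> b) = q a \<oplus>\<^bsub>R\<^esub> q b"
      "\<And>r a. r \<in> carrier R \<Longrightarrow> a \<in> carrier A \<Longrightarrow> q (r \<odot>\<^bsub>A\<^esub> a) = r \<otimes>\<^bsub>R\<^esub> q a"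
      "\<And>a b. a \<in> carrier A \<Longrightarrow> b \<in> carrier A \<Longrightarrow> q (a \<otimes>\<^bsub>A\<^esub> b) = q a \<otimes>\<^bsub>R\<^esub> q b"
      "q \<one>\<^bsub>A\<^esub> = \<one>\<^bsub>R\<^esub>"
    and x: "x \<in> carrier A" "\<And>a. a \<in> carrier A \<Longrightarrow> p (x \<otimes>\<^bsub>A\<^esub> a) = q a"
  shows "q x \<in> Units R"
proof -
  obtain E where E: "E \<in> carrier T" "\<mu> E = \<one>\<^bsub>A\<^esub>"
    "(x \<otimes>\<^sub>T \<one>\<^bsub>A\<^esub>) \<otimes>\<^bsub>T\<^esub> E = E \<otimes>\<^bsub>T\<^esub> (\<one>\<^bsub>A\<^esub> \<otimes>\<^sub>T x)"
    using sep x(1) unfolding separable_iff by blast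
  interpret F: balanced_map R A A R "\<lambda>(a, b). p a \<otimes>\<^bsub>R\<^esub> q b"
    by unfold_locales (auto simp: p q A.R.l_distr A.R.r_distr A.R.m_ac)
  have "F.lift ((x \<otimes>\<^sub>T \<one>\<^bsub>A\<^esub>) \<otimes>\<^bsub>T\<^esub> U) = q (\<mu> U)" if "U \<in> carrier T" for U
    using that
  proof (induction U rule: P.tensor_induct)
    case (pure a b)
    then show ?case using x by (simp add: P.tens_mult F.lift_props \<mu>_tens q)
  next
    case (add U V)
    then show ?case using x by (simp add: P.T.r_distr F.lift_props \<mu>_add q)
  qed
  moreover have "F.lift (U \<otimes>\<^bsub>T\<^esub> (\<one>\<^bsub>A\<^esub> \<otimes>\<^sub>T x)) = q x \<otimes>\<^bsub>R\<^esub> F.lift U" if "U \<in> carrier T" for U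
    using that
  proof (induction U rule: P.tensor_induct)
    case (pure a b)
    then show ?case using x(1) by (simp add: P.tens_mult F.lift_props p q A.R.m_ac)
  next
    case (add U V)
    then show ?case using x(1) by (simp add: P.T.l_distr F.lift_props F.lift_closed q A.R.r_distr)
  qed
  ultimately have "q x \<otimes>\<^bsub>R\<^esub> F.lift E = \<one>\<^bsub>R\<^esub>"
    using E q by metis
  then show ?thesis
    using A.R.m_comm[of "q x" "F.lift E"] F.lift_closed[OF E(1)] q(1)[OF x(1)]
    by (auto simp: Units_def)
qed

text \<open>Applied to g = 1 - f: once g kills the \<open>t j\<close> of larger size, it kills the
  whole ideal they generate.\<close>

lemma annihilator_ideal:
  assumes "g \<in> carrier A" shows "ideal {a \<in> carrier A. g \<otimes>\<^bsub>A\<^esub> a = \<zero>\<^bsub>A\<^esub>} A"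
proof (rule idealI)
  show "subgroup {a \<in> carrier A. g \<otimes>\<^bsub>A\<^esub> a = \<zero>\<^bsub>A\<^esub>} (add_monoid A)"
    by (rule A.add.subgroupI) (use assms in \<open>auto simp: A.r_distr A.r_minus\<close>)
next
  fix a x assume "a \<in> {a \<in> carrier A. g \<otimes>\<^bsub>A\<^esub> a = \<zero>\<^bsub>A\<^esub>}" "x \<in> carrier A"
  then show "x \<otimes>\<^bsub>A\<^esub> a \<in> {a \<in> carrier A. g \<otimes>\<^bsub>A\<^esub> a = \<zero>\<^bsub>A\<^esub>}" "a \<otimes>\<^bsub>A\<^esub> x \<in> {a \<in> carrier A. g \<otimes>\<^bsub>A\<^esub> a = \<zero>\<^bsub>A\<^esub>}"
    using assms by (auto simp: A.m_lcomm[of g x a] simp flip: A.m_assoc[of g a x])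
qed (rule A.ring_axioms)

text \<open>
  If \<open>f = \<mu> E\<close> is an idempotent that fixes all larger \<open>t j\<close>, then \<open>(1 - f) t i\<close> spans an ideal on
  which \<open>A\<close> acts through scalars, and its multiple by the inverse of the diagonal coefficient is an
  idempotent \<open>e\<close> orthogonal to \<open>f\<close>; \<open>E\<close> is replaced by \<open>E + e \<otimes> e\<close>.
\<close>

lemma separable_if_triangular:
  fixes t :: "'i \<Rightarrow> _" and size :: "'i \<Rightarrow> nat"
  assumes I: "finite I" "\<And>i. i \<in> I \<Longrightarrow> t i \<in> carrier A" "\<one>\<^bsub>A\<^esub> \<in> t ` I"
    and tri: "\<And>i a. i \<in> I \<Longrightarrow> a \<in> carrier A \<Longrightarrow>
      \<exists>c \<in> carrier R. a \<otimes>\<^bsub>A\<^esub> t i \<ominus>\<^bsub>A\<^esub> c \<odot>\<^bsub>A\<^esub> t i \<in> Idl\<^bsub>A\<^esub> (t ` {j \<in> I. size i < size j})"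
    and diag: "\<And>i. i \<in> I \<Longrightarrow>
      \<exists>c \<in> Units R. t i \<otimes>\<^bsub>A\<^esub> t i \<ominus>\<^bsub>A\<^esub> c \<odot>\<^bsub>A\<^esub> t i \<in> Idl\<^bsub>A\<^esub> (t ` {j \<in> I. size i < size j})"
  shows "separable_algebra R A"
proof -
  \<comment> \<open>The sets L are closed under passing to larger size, and \<open>\<mu> E\<close>
    fixes \<open>t\<close> on L. Idempotence is carried along because it makes 1 - f an idempotent
    orthogonal to f.\<close>
  have "\<exists>E \<in> carrier T. (\<forall>a \<in> carrier A. (a \<otimes>\<^sub>T \<one>\<^bsub>A\<^esub>) \<otimes>\<^bsub>T\<^esub> E = E \<otimes>\<^bsub>T\<^esub> (\<one>\<^bsub>A\<^esub> \<otimes>\<^sub>T a)) \<and>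
      \<mu> E \<otimes>\<^bsub>A\<^esub> \<mu> E = \<mu> E \<and> (\<forall>i \<in> L. \<mu> E \<otimes>\<^bsub>A\<^esub> t i = t i)"
    if "L \<subseteq> I" "\<And>i j. i \<in> L \<Longrightarrow> j \<in> I \<Longrightarrow> size i < size j \<Longrightarrow> j \<in> L" for L
    using finite_subset[OF that(1) I(1)] that
  proof (induction L rule: finite_psubset_induct)
    case (psubset L)
    show ?case
    proof (cases "L = {}")
      case True
      have "\<mu> \<zero>\<^bsub>T\<^esub> = \<zero>\<^bsub>A\<^esub>" using \<mu>_tens[of "\<zero>\<^bsub>A\<^esub>" "\<zero>\<^bsub>A\<^esub>"] by (simp add: P.tens_zero)
      then show ?thesis using True by (intro bexI[of _ "\<zero>\<^bsub>T\<^esub>"]) auto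
    next
      case False
      \<comment> \<open>An index of least size in L: every index of strictly larger size lies in L -
        {i}, and L - {i} is again closed upwards.\<close>
      then obtain i where i: "i \<in> L" "\<And>j. j \<in> L \<Longrightarrow> size i \<le> size j"
        using arg_min_if_finite(1)[of L size] arg_min_least[of L _ size] psubset.hyps by blast
      define x where "x = t i"
      have tS: "i \<in> I" "x \<in> carrier A" using i psubset.prems I by (auto simp: x_def)
      obtain E where E: "E \<in> carrier T"
        and Ea: "\<And>a. a \<in> carrier A \<Longrightarrow> (a \<otimes>\<^sub>T \<one>\<^bsub>A\<^esub>) \<otimes>\<^bsub>T\<^esub> E = E \<otimes>\<^bsub>T\<^esub> (\<one>\<^bsub>A\<^esub> \<otimes>\<^sub>T a)"
        and idem: "\<mu> E \<otimes>\<^bsub>A\<^esub> \<mu> E = \<mu> E" and fix': "\<And>j. j \<in> L - {i} \<Longrightarrow> \<mu> E \<otimes>\<^bsub>A\<^esub> t j = t j"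
      proof -
        have "L - {i} \<subset> L" "L - {i} \<subseteq> I" using i psubset.prems by auto
        moreover have "k \<in> L - {i}" if "j \<in> L - {i}" "k \<in> I" "size j < size k" for j k
          using psubset.prems(2)[of j k] i(2)[of j] that by auto
        ultimately have "\<exists>E \<in> carrier T. (\<forall>a \<in> carrier A. (a \<otimes>\<^sub>T \<one>\<^bsub>A\<^esub>) \<otimes>\<^bsub>T\<^esub> E = E \<otimes>\<^bsub>T\<^esub> (\<one>\<^bsub>A\<^esub> \<otimes>\<^sub>T a)) \<and>
            \<mu> E \<otimes>\<^bsub>A\<^esub> \<mu> E = \<mu> E \<and> (\<forall>j \<in> L - {i}. \<mu> E \<otimes>\<^bsub>A\<^esub> t j = t j)"
          by (rule psubset.IH)
        then show thesis by (elim bexE conjE) (rule that, auto)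
      qed
      define f where "f = \<mu> E"
      define g where "g = \<one>\<^bsub>A\<^esub> \<ominus>\<^bsub>A\<^esub> f"
      define t1 where "t1 = g \<otimes>\<^bsub>A\<^esub> x"
      have cl: "f \<in> carrier A" "g \<in> carrier A" "t1 \<in> carrier A"
        using E tS by (auto simp: f_def g_def t1_def)
      have ff: "f \<otimes>\<^bsub>A\<^esub> f = f" using idem by (simp add: f_def)
      have fg: "f \<otimes>\<^bsub>A\<^esub> g = \<zero>\<^bsub>A\<^esub>"
        using cl(1) ff by (simp add: g_def A.minus_eq A.r_distr A.r_minus A.r_neg)
      have gg: "g \<otimes>\<^bsub>A\<^esub> g = g"
      proof -
        have "g \<otimes>\<^bsub>A\<^esub> g = \<one>\<^bsub>A\<^esub> \<otimes>\<^bsub>A\<^esub> g \<ominus>\<^bsub>A\<^esub> f \<otimes>\<^bsub>A\<^esub> g"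
          using cl by (subst g_def) (simp add: A.minus_eq A.l_distr A.l_minus)
        then show ?thesis using cl fg by (simp add: A.minus_eq)
      qed
      have gfix: "g \<otimes>\<^bsub>A\<^esub> t j = \<zero>\<^bsub>A\<^esub>" if "j \<in> L - {i}" for j
      proof -
        have "t j \<in> carrier A" using that psubset.prems I by auto
        then show ?thesis
          using fix'[OF that] cl(1) by (simp add: g_def f_def[symmetric] A.minus_eq A.l_distr A.l_minus A.r_neg)
      qed
      have "t ` {j \<in> I. size i < size j} \<subseteq> {a \<in> carrier A. g \<otimes>\<^bsub>A\<^esub> a = \<zero>\<^bsub>A\<^esub>}"
        using psubset.prems(2)[OF i(1)] I(2) gfix by auto
      then have J: "Idl\<^bsub>A\<^esub> (t ` {j \<in> I. size i < size j}) \<subseteq> {a \<in> carrier A. g \<otimes>\<^bsub>A\<^esub> a = \<zero>\<^bsub>A\<^esub>}"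
        by (rule A.genideal_minimal[OF annihilator_ideal[OF cl(2)]])
      \<comment> \<open>Multiplication by \<open>g\<close> kills the error term, so a congruence for
        \<open>x\<close> becomes an equation for \<open>t1 = g x\<close>.\<close>
      have mod: "a \<otimes>\<^bsub>A\<^esub> t1 = c \<odot>\<^bsub>A\<^esub> t1"
        if "a \<otimes>\<^bsub>A\<^esub> x \<ominus>\<^bsub>A\<^esub> c \<odot>\<^bsub>A\<^esub> x \<in> Idl\<^bsub>A\<^esub> (t ` {j \<in> I. size i < size j})" "a \<in> carrier A" "c \<in> carrier R"
        for a c
      proof -
        have "g \<otimes>\<^bsub>A\<^esub> (a \<otimes>\<^bsub>A\<^esub> x \<ominus>\<^bsub>A\<^esub> c \<odot>\<^bsub>A\<^esub> x) = \<zero>\<^bsub>A\<^esub>" using that(1) J by auto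
        moreover have "g \<otimes>\<^bsub>A\<^esub> (a \<otimes>\<^bsub>A\<^esub> x \<ominus>\<^bsub>A\<^esub> c \<odot>\<^bsub>A\<^esub> x) = a \<otimes>\<^bsub>A\<^esub> t1 \<ominus>\<^bsub>A\<^esub> c \<odot>\<^bsub>A\<^esub> t1"
          using that(2,3) cl tS by (simp add: t1_def A.minus_eq A.r_distr A.r_minus smult_mult A.m_lcomm)
        ultimately have "a \<otimes>\<^bsub>A\<^esub> t1 \<oplus>\<^bsub>A\<^esub> \<ominus>\<^bsub>A\<^esub> (c \<odot>\<^bsub>A\<^esub> t1) = \<zero>\<^bsub>A\<^esub>" by (simp add: A.minus_eq)
        then show ?thesis using that(2,3) cl A.minus_equality[of "a \<otimes>\<^bsub>A\<^esub> t1" "\<ominus>\<^bsub>A\<^esub> (c \<odot>\<^bsub>A\<^esub> t1)"] by simp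
      qed
      obtain u where u: "u \<in> Units R" "x \<otimes>\<^bsub>A\<^esub> t1 = u \<odot>\<^bsub>A\<^esub> t1"
        using diag[OF tS(1), folded x_def] mod[OF _ tS(2)] by (auto simp: Units_def)
      define v where "v = inv\<^bsub>R\<^esub> u"
      have v: "u \<in> carrier R" "v \<in> carrier R" "v \<otimes>\<^bsub>R\<^esub> u = \<one>\<^bsub>R\<^esub>" using u by (auto simp: v_def)
      \<comment> \<open>The scalar \<open>v\<close> undoes the unit \<open>u\<close> by which
        \<open>x\<close> acts on \<open>t1\<close>. Hence x e = t1, and e e = v g (x e) = v g t1 =
        e.\<close>
      define e where "e = v \<odot>\<^bsub>A\<^esub> t1"
      have e: "e \<in> carrier A" using v cl by (simp add: e_def)
      have ge: "g \<otimes>\<^bsub>A\<^esub> e = e"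
        using cl tS v gg by (simp add: e_def t1_def smult_mult flip: A.m_assoc)
      have fe: "f \<otimes>\<^bsub>A\<^esub> e = \<zero>\<^bsub>A\<^esub>"
        using cl tS v fg by (simp add: e_def t1_def smult_mult flip: A.m_assoc)
      have te: "x \<otimes>\<^bsub>A\<^esub> e = t1"
        using cl tS v u by (simp add: e_def smult_mult flip: A.smult_assoc1)
      have ee: "e \<otimes>\<^bsub>A\<^esub> e = e"
      proof -
        have "e \<otimes>\<^bsub>A\<^esub> e = v \<odot>\<^bsub>A\<^esub> (g \<otimes>\<^bsub>A\<^esub> (x \<otimes>\<^bsub>A\<^esub> e))"
          using cl tS v e by (subst (1) e_def) (simp add: t1_def A.smult_assoc2 A.m_assoc)
        also have "\<dots> = e" using gg cl tS v by (simp add: te) (simp add: t1_def e_def flip: A.m_assoc)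
        finally show ?thesis .
      qed
      \<comment> \<open>The element \<open>a\<close> acts on \<open>e\<close> by a scalar, and a
        scalar moves across the tensor sign; this is the commutation rule for e \<otimes> e.\<close>
      have ae: "(a \<otimes>\<^bsub>A\<^esub> e) \<otimes>\<^sub>T e = e \<otimes>\<^sub>T (e \<otimes>\<^bsub>A\<^esub> a)" if a: "a \<in> carrier A" for a
      proof -
        obtain c where c: "c \<in> carrier R" "a \<otimes>\<^bsub>A\<^esub> t1 = c \<odot>\<^bsub>A\<^esub> t1"
          using tri[OF tS(1) a, folded x_def] mod[OF _ a] by auto
        then have "a \<otimes>\<^bsub>A\<^esub> e = c \<odot>\<^bsub>A\<^esub> e"
          using a cl v by (simp add: e_def smult_mult A.R.m_comm flip: A.smult_assoc1)
        then show ?thesis using a e c P.tens_smult[of c e e] by (simp add: A.m_comm[of e])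
      qed
      define E' where "E' = E \<oplus>\<^bsub>T\<^esub> e \<otimes>\<^sub>T e"
      have \<mu>: "\<mu> E' = f \<oplus>\<^bsub>A\<^esub> e" using E e ee by (simp add: E'_def f_def \<mu>_add \<mu>_tens)
      have "(a \<otimes>\<^sub>T \<one>\<^bsub>A\<^esub>) \<otimes>\<^bsub>T\<^esub> E' = E' \<otimes>\<^bsub>T\<^esub> (\<one>\<^bsub>A\<^esub> \<otimes>\<^sub>T a)" if "a \<in> carrier A" for a
        using that E e Ea[OF that] ae[OF that]
        by (simp add: E'_def P.T.r_distr P.T.l_distr P.tens_mult)
      moreover have "\<mu> E' \<otimes>\<^bsub>A\<^esub> \<mu> E' = \<mu> E'"
        using cl e ff ee fe by (simp add: \<mu> A.l_distr A.r_distr A.m_comm[of e f])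
      moreover have "\<mu> E' \<otimes>\<^bsub>A\<^esub> t j = t j" if "j \<in> L" for j
      proof (cases "j = i")
        case True
        \<comment> \<open>Here e x = t1 = g x, and f + g = 1 restores \<open>x\<close>.\<close>
        have "f \<otimes>\<^bsub>A\<^esub> x \<oplus>\<^bsub>A\<^esub> g \<otimes>\<^bsub>A\<^esub> x = (f \<oplus>\<^bsub>A\<^esub> g) \<otimes>\<^bsub>A\<^esub> x" using cl tS by (simp add: A.l_distr)
        also have "f \<oplus>\<^bsub>A\<^esub> g = \<one>\<^bsub>A\<^esub>"
          using cl(1) by (simp add: g_def A.minus_eq A.a_lcomm[of f "\<one>\<^bsub>A\<^esub>"] A.r_neg)
        finally show ?thesis using True cl e tS te by (simp add: \<mu> A.l_distr A.m_comm[of e x] t1_def flip: x_def)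
      next
        case False
        have j: "t j \<in> carrier A" using that psubset.prems I by auto
        have "e \<otimes>\<^bsub>A\<^esub> t j = v \<odot>\<^bsub>A\<^esub> (x \<otimes>\<^bsub>A\<^esub> (g \<otimes>\<^bsub>A\<^esub> t j))"
          using j cl tS v by (simp add: e_def t1_def smult_mult A.m_ac)
        then have "e \<otimes>\<^bsub>A\<^esub> t j = \<zero>\<^bsub>A\<^esub>" using gfix[of j] False that tS v by simp
        then show ?thesis using j cl e fix'[of j] False that by (simp add: \<mu> A.l_distr f_def)
      qed
      ultimately show ?thesis
        using E e by (intro bexI[of _ E']) (auto simp: E'_def)
    qed
  qed
  \<comment> \<open>For L = I the element \<open>\<mu> E\<close> fixes every \<open>t i\<close>,
    among them 1, and is therefore 1.\<close>
  from this[of I] obtain E where E: "E \<in> carrier T" "\<And>i. i \<in> I \<Longrightarrow> \<mu> E \<otimes>\<^bsub>A\<^esub> t i = t i"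
    "\<forall>a \<in> carrier A. (a \<otimes>\<^sub>T \<one>\<^bsub>A\<^esub>) \<otimes>\<^bsub>T\<^esub> E = E \<otimes>\<^bsub>T\<^esub> (\<one>\<^bsub>A\<^esub> \<otimes>\<^sub>T a)" by auto
  obtain i where "i \<in> I" "t i = \<one>\<^bsub>A\<^esub>" using I(3) by auto
  then have "\<mu> E \<otimes>\<^bsub>A\<^esub> \<one>\<^bsub>A\<^esub> = \<one>\<^bsub>A\<^esub>" using E(2)[of i] by simp
  then show ?thesis
    unfolding separable_iff using E by auto
qed

end

section \<open>Both criteria for an algebra obtained by extension of scalars\<close>

context scalar_ext
begin

sublocale AA: self_tensor R A
  by (rule self_tensor.intro[OF algebra_A])

text \<open>The functionals come from integer invariants h and k of B, and x becomes 1 \<otimes> x.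
  By additivity, the multiplicativity of q and the rule p(x a) = q(a) need checking on pure tensors
  only, where they reduce to the integer identities.\<close>

lemma separable_imp_unit:
  fixes h k :: "_ \<Rightarrow> int"
  assumes "separable_algebra R A"
    and h: "\<And>b b'. b \<in> carrier B \<Longrightarrow> b' \<in> carrier B \<Longrightarrow> h (b \<oplus>\<^bsub>B\<^esub> b') = h b + h b'"
    and k: "\<And>b b'. b \<in> carrier B \<Longrightarrow> b' \<in> carrier B \<Longrightarrow> k (b \<oplus>\<^bsub>B\<^esub> b') = k b + k b'"
      "\<And>b b'. b \<in> carrier B \<Longrightarrow> b' \<in> carrier B \<Longrightarrow> k (b \<otimes>\<^bsub>B\<^esub> b') = k b * k b'" "k \<one>\<^bsub>B\<^esub> = 1"
    and x: "x \<in> carrier B" "\<And>b. b \<in> carrier B \<Longrightarrow> h (x \<otimes>\<^bsub>B\<^esub> b) = k b"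
  shows "[k x] \<cdot>\<^bsub>R\<^esub> \<one>\<^bsub>R\<^esub> \<in> Units R"
proof -
  obtain p where p: "\<And>r b. r \<in> carrier R \<Longrightarrow> b \<in> carrier B \<Longrightarrow> p (r \<otimes>\<^sub>A b) = [h b] \<cdot>\<^bsub>R\<^esub> r"
    "\<And>a. a \<in> carrier A \<Longrightarrow> p a \<in> carrier R"
    "\<And>a a'. a \<in> carrier A \<Longrightarrow> a' \<in> carrier A \<Longrightarrow> p (a \<oplus>\<^bsub>A\<^esub> a') = p a \<oplus>\<^bsub>R\<^esub> p a'"
    "\<And>r a. r \<in> carrier R \<Longrightarrow> a \<in> carrier A \<Longrightarrow> p (r \<odot>\<^bsub>A\<^esub> a) = r \<otimes>\<^bsub>R\<^esub> p a"
    using hom_extend[of h] h by blast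
  obtain q where q: "\<And>r b. r \<in> carrier R \<Longrightarrow> b \<in> carrier B \<Longrightarrow> q (r \<otimes>\<^sub>A b) = [k b] \<cdot>\<^bsub>R\<^esub> r"
    "\<And>a. a \<in> carrier A \<Longrightarrow> q a \<in> carrier R"
    "\<And>a a'. a \<in> carrier A \<Longrightarrow> a' \<in> carrier A \<Longrightarrow> q (a \<oplus>\<^bsub>A\<^esub> a') = q a \<oplus>\<^bsub>R\<^esub> q a'"
    "\<And>r a. r \<in> carrier R \<Longrightarrow> a \<in> carrier A \<Longrightarrow> q (r \<odot>\<^bsub>A\<^esub> a) = r \<otimes>\<^bsub>R\<^esub> q a"
    using hom_extend[of k] k(1) by blast
  have mult: "q (a \<otimes>\<^bsub>A\<^esub> a') = q a \<otimes>\<^bsub>R\<^esub> q a'" if a: "a \<in> carrier A" and a': "a' \<in> carrier A" for a a'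
    using a
  proof (induction a rule: ten_induct)
    case (pure r b)
    show ?case using a'
    proof (induction a' rule: ten_induct)
      case (pure r' b')
      then show ?case using \<open>r \<in> carrier R\<close> \<open>b \<in> carrier B\<close>
        by (simp only: ten_mult R.m_closed B.m_closed q k)
          (simp add: R.add_pow_rdistr_int R.add_pow_ldistr_int R.add.int_pow_pow mult.commute)
    next
      case (add a a')
      then show ?case using \<open>r \<in> carrier R\<close> \<open>b \<in> carrier B\<close> ten_closed[of r b]
        by (simp only: A.r_distr A.m_closed q R.r_distr R.add.int_pow_closed)
    qed
  next
    case (add a a')
    then show ?case using \<open>a' \<in> carrier A\<close> that(2)
      by (simp only: A.l_distr A.m_closed q R.l_distr)
  qed
  have px: "p ((\<one>\<^bsub>R\<^esub> \<otimes>\<^sub>A x) \<otimes>\<^bsub>A\<^esub> a) = q a" if "a \<in> carrier A" for a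
    using that
  proof (induction a rule: ten_induct)
    case (pure r b)
    then show ?case using x by (simp only: ten_mult R.m_closed B.m_closed R.one_closed p q R.l_one)
  next
    case (add a a')
    then show ?case using ten_closed[OF R.one_closed x(1)] by (simp only: A.r_distr A.m_closed p q)
  qed
  have "q \<one>\<^bsub>A\<^esub> = \<one>\<^bsub>R\<^esub>" using k(3) by (simp only: ten_one q R.one_closed B.one_closed) simp
  from AA.separable_imp_unit[OF assms(1) p(2,3,4) q(2,3,4) mult this ten_closed[OF R.one_closed x(1)] px]
  have "q (\<one>\<^bsub>R\<^esub> \<otimes>\<^sub>A x) \<in> Units R" .
  then show ?thesis using q(1) x(1) by simp
qed

text \<open>The map b \<mapsto> 1 \<otimes> b is a ring homomorphism. Together with the minimality
  of generated ideals this carries membership in \<open>Idl\<close> from B to R \<otimes> B.\<close>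

lemma ideal_preimage:
  assumes "ideal J A" shows "ideal {b \<in> carrier B. \<one>\<^bsub>R\<^esub> \<otimes>\<^sub>A b \<in> J} B"
proof (rule idealI)
  interpret J: ideal J A by fact
  have add: "\<one>\<^bsub>R\<^esub> \<otimes>\<^sub>A (b \<oplus>\<^bsub>B\<^esub> b') = (\<one>\<^bsub>R\<^esub> \<otimes>\<^sub>A b) \<oplus>\<^bsub>A\<^esub> (\<one>\<^bsub>R\<^esub> \<otimes>\<^sub>A b')" if "b \<in> carrier B" "b' \<in> carrier B" for b b'
    using that by (rule ten_add_right[OF R.one_closed])
  have mult: "\<one>\<^bsub>R\<^esub> \<otimes>\<^sub>A (b \<otimes>\<^bsub>B\<^esub> b') = (\<one>\<^bsub>R\<^esub> \<otimes>\<^sub>A b) \<otimes>\<^bsub>A\<^esub> (\<one>\<^bsub>R\<^esub> \<otimes>\<^sub>A b')" if "b \<in> carrier B" "b' \<in> carrier B" for b b'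
    using that by (subst ten_mult) auto
  have zero: "\<one>\<^bsub>R\<^esub> \<otimes>\<^sub>A \<zero>\<^bsub>B\<^esub> = \<zero>\<^bsub>A\<^esub>" using E.tens_zero(2)[of "\<one>\<^bsub>R\<^esub>"] by simp
  have neg: "\<one>\<^bsub>R\<^esub> \<otimes>\<^sub>A (\<ominus>\<^bsub>B\<^esub> b) = \<ominus>\<^bsub>A\<^esub> (\<one>\<^bsub>R\<^esub> \<otimes>\<^sub>A b)" if "b \<in> carrier B" for b
    using add[of "\<ominus>\<^bsub>B\<^esub> b" b] that zero ten_closed[OF R.one_closed]
    by (intro A.minus_equality[symmetric]) (auto simp: B.l_neg)
  show "subgroup {b \<in> carrier B. \<one>\<^bsub>R\<^esub> \<otimes>\<^sub>A b \<in> J} (add_monoid B)"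
    by (rule B.add.subgroupI)
      (use zero J.zero_closed neg J.a_inv_closed add J.a_closed in \<open>auto simp del: A_simps\<close>)
  fix a x assume "a \<in> {b \<in> carrier B. \<one>\<^bsub>R\<^esub> \<otimes>\<^sub>A b \<in> J}" "x \<in> carrier B"
  then show "x \<otimes>\<^bsub>B\<^esub> a \<in> {b \<in> carrier B. \<one>\<^bsub>R\<^esub> \<otimes>\<^sub>A b \<in> J}" "a \<otimes>\<^bsub>B\<^esub> x \<in> {b \<in> carrier B. \<one>\<^bsub>R\<^esub> \<otimes>\<^sub>A b \<in> J}"
    using J.I_l_closed J.I_r_closed ten_closed[OF R.one_closed] by (auto simp: mult simp del: A_simps)
qed (rule B.ring_axioms)

text \<open>The triangular relations are given over the integers: b s \<equiv> m s in B yields (r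
  \<otimes> b)(1 \<otimes> s) \<equiv> (m r)(1 \<otimes> s). The index set is S and not its image,
  since distinct elements of S may become equal in R \<otimes> B although their sizes
  differ.\<close>

lemma separable_if_triangular:
  fixes size :: "_ \<Rightarrow> nat"
  assumes S: "finite S" "S \<subseteq> carrier B" "\<one>\<^bsub>B\<^esub> \<in> S"
    and tri: "\<And>s b. s \<in> S \<Longrightarrow> b \<in> carrier B \<Longrightarrow>
      \<exists>m :: int. b \<otimes>\<^bsub>B\<^esub> s \<ominus>\<^bsub>B\<^esub> [m] \<cdot>\<^bsub>B\<^esub> s \<in> Idl\<^bsub>B\<^esub> {s' \<in> S. size s < size s'}"
    and diag: "\<And>s. s \<in> S \<Longrightarrow> \<exists>m :: int. [m] \<cdot>\<^bsub>R\<^esub> \<one>\<^bsub>R\<^esub> \<in> Units R \<and>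
      s \<otimes>\<^bsub>B\<^esub> s \<ominus>\<^bsub>B\<^esub> [m] \<cdot>\<^bsub>B\<^esub> s \<in> Idl\<^bsub>B\<^esub> {s' \<in> S. size s < size s'}"
  shows "separable_algebra R A"
proof (rule AA.separable_if_triangular[of S "\<lambda>b. \<one>\<^bsub>R\<^esub> \<otimes>\<^sub>A b" size])
  note cl = ten_closed[OF R.one_closed]
  let ?J = "\<lambda>s. Idl\<^bsub>A\<^esub> ((\<lambda>b. \<one>\<^bsub>R\<^esub> \<otimes>\<^sub>A b) ` {s' \<in> S. size s < size s'})"
  have J: "ideal (?J s) A" for s
    by (rule A.genideal_ideal) (use S cl in auto)
  have up: "\<one>\<^bsub>R\<^esub> \<otimes>\<^sub>A w \<in> ?J s" if "w \<in> Idl\<^bsub>B\<^esub> {s' \<in> S. size s < size s'}" for s w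
  proof -
    have "(\<lambda>b. \<one>\<^bsub>R\<^esub> \<otimes>\<^sub>A b) ` {s' \<in> S. size s < size s'} \<subseteq> ?J s"
      by (rule A.genideal_self) (use S cl in auto)
    then have "Idl\<^bsub>B\<^esub> {s' \<in> S. size s < size s'} \<subseteq> {b \<in> carrier B. \<one>\<^bsub>R\<^esub> \<otimes>\<^sub>A b \<in> ?J s}"
      using S by (intro B.genideal_minimal ideal_preimage J) auto
    then show ?thesis using that by auto
  qed
  have coeff: "(r \<otimes>\<^sub>A b) \<otimes>\<^bsub>A\<^esub> (\<one>\<^bsub>R\<^esub> \<otimes>\<^sub>A s) \<ominus>\<^bsub>A\<^esub> ([m] \<cdot>\<^bsub>R\<^esub> r) \<odot>\<^bsub>A\<^esub> (\<one>\<^bsub>R\<^esub> \<otimes>\<^sub>A s) \<in> ?J s"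
    if "r \<in> carrier R" "b \<in> carrier B" "s \<in> S" and m: "b \<otimes>\<^bsub>B\<^esub> s \<ominus>\<^bsub>B\<^esub> [m] \<cdot>\<^bsub>B\<^esub> s \<in> Idl\<^bsub>B\<^esub> {s' \<in> S. size s < size s'}"
    for r b s and m :: int
  proof -
    let ?w = "b \<otimes>\<^bsub>B\<^esub> s \<ominus>\<^bsub>B\<^esub> [m] \<cdot>\<^bsub>B\<^esub> s"
    have s: "s \<in> carrier B" "[m] \<cdot>\<^bsub>B\<^esub> s \<in> carrier B" "?w \<in> carrier B" using that S by auto
    have "b \<otimes>\<^bsub>B\<^esub> s = ?w \<oplus>\<^bsub>B\<^esub> [m] \<cdot>\<^bsub>B\<^esub> s"
      using s that(2) by (simp add: B.minus_eq B.a_assoc B.l_neg)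
    then have "r \<otimes>\<^sub>A (b \<otimes>\<^bsub>B\<^esub> s) = (r \<otimes>\<^sub>A ?w) \<oplus>\<^bsub>A\<^esub> (([m] \<cdot>\<^bsub>R\<^esub> r) \<otimes>\<^sub>A s)"
      using ten_add_right[of r ?w "[m] \<cdot>\<^bsub>B\<^esub> s"] s that(1) by (simp only: ten_int)
    then have eq: "(r \<otimes>\<^sub>A b) \<otimes>\<^bsub>A\<^esub> (\<one>\<^bsub>R\<^esub> \<otimes>\<^sub>A s) = (r \<otimes>\<^sub>A ?w) \<oplus>\<^bsub>A\<^esub> (([m] \<cdot>\<^bsub>R\<^esub> r) \<odot>\<^bsub>A\<^esub> (\<one>\<^bsub>R\<^esub> \<otimes>\<^sub>A s))"
      using that s by (simp only: ten_mult ten_smult R.one_closed R.r_one R.add.int_pow_closed)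
    \<comment> \<open>The error term is the multiple by r \<otimes> 1 of the image of
      \<open>?w\<close>, and that image lies in the ideal by \<open>up\<close>.\<close>
    have "r \<otimes>\<^sub>A ?w = (r \<otimes>\<^sub>A \<one>\<^bsub>B\<^esub>) \<otimes>\<^bsub>A\<^esub> (\<one>\<^bsub>R\<^esub> \<otimes>\<^sub>A ?w)"
      using that s by (simp only: ten_mult R.one_closed R.r_one B.one_closed B.l_one)
    then have "r \<otimes>\<^sub>A ?w \<in> ?J s"
      using ideal.I_l_closed[OF J up[OF m]] ten_closed that(1) by simp
    moreover have "(r \<otimes>\<^sub>A b) \<otimes>\<^bsub>A\<^esub> (\<one>\<^bsub>R\<^esub> \<otimes>\<^sub>A s) \<ominus>\<^bsub>A\<^esub> ([m] \<cdot>\<^bsub>R\<^esub> r) \<odot>\<^bsub>A\<^esub> (\<one>\<^bsub>R\<^esub> \<otimes>\<^sub>A s) = r \<otimes>\<^sub>A ?w"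
      unfolding eq A.minus_eq using A.smult_closed[of "[m] \<cdot>\<^bsub>R\<^esub> r" "\<one>\<^bsub>R\<^esub> \<otimes>\<^sub>A s"] cl[OF s(1)] ten_closed[OF that(1) s(3)] that(1)
      by (simp only: A.a_assoc A.r_neg A.r_zero A.a_inv_closed R.add.int_pow_closed)
    ultimately show ?thesis by simp
  qed
  show "\<one>\<^bsub>A\<^esub> \<in> (\<lambda>b. \<one>\<^bsub>R\<^esub> \<otimes>\<^sub>A b) ` S" using ten_one S(3) by blast
  show "\<one>\<^bsub>R\<^esub> \<otimes>\<^sub>A s \<in> carrier A" if "s \<in> S" for s using that S cl by blast
  show "\<exists>c \<in> carrier R. a \<otimes>\<^bsub>A\<^esub> (\<one>\<^bsub>R\<^esub> \<otimes>\<^sub>A s) \<ominus>\<^bsub>A\<^esub> c \<odot>\<^bsub>A\<^esub> (\<one>\<^bsub>R\<^esub> \<otimes>\<^sub>A s) \<in> ?J s"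
    if s: "s \<in> S" and "a \<in> carrier A" for s a
    using that(2)
  proof (induction a rule: ten_induct)
    case (pure r b)
    obtain m :: int where m: "b \<otimes>\<^bsub>B\<^esub> s \<ominus>\<^bsub>B\<^esub> [m] \<cdot>\<^bsub>B\<^esub> s \<in> Idl\<^bsub>B\<^esub> {s' \<in> S. size s < size s'}"
      using tri[OF s \<open>b \<in> carrier B\<close>] by blast
    have "[m] \<cdot>\<^bsub>R\<^esub> r \<in> carrier R" using \<open>r \<in> carrier R\<close> by simp
    then show ?case using coeff[OF \<open>r \<in> carrier R\<close> \<open>b \<in> carrier B\<close> s m] by blast
  next
    case (add a a')
    then obtain c c' where c: "c \<in> carrier R" "c' \<in> carrier R"
      "a \<otimes>\<^bsub>A\<^esub> (\<one>\<^bsub>R\<^esub> \<otimes>\<^sub>A s) \<ominus>\<^bsub>A\<^esub> c \<odot>\<^bsub>A\<^esub> (\<one>\<^bsub>R\<^esub> \<otimes>\<^sub>A s) \<in> ?J s"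
      "a' \<otimes>\<^bsub>A\<^esub> (\<one>\<^bsub>R\<^esub> \<otimes>\<^sub>A s) \<ominus>\<^bsub>A\<^esub> c' \<odot>\<^bsub>A\<^esub> (\<one>\<^bsub>R\<^esub> \<otimes>\<^sub>A s) \<in> ?J s" by blast
    define t where "t = \<one>\<^bsub>R\<^esub> \<otimes>\<^sub>A s"
    have t: "t \<in> carrier A" using cl s S unfolding t_def by blast
    have "(a \<oplus>\<^bsub>A\<^esub> a') \<otimes>\<^bsub>A\<^esub> t \<ominus>\<^bsub>A\<^esub> (c \<oplus>\<^bsub>R\<^esub> c') \<odot>\<^bsub>A\<^esub> t =
        (a \<otimes>\<^bsub>A\<^esub> t \<ominus>\<^bsub>A\<^esub> c \<odot>\<^bsub>A\<^esub> t) \<oplus>\<^bsub>A\<^esub> (a' \<otimes>\<^bsub>A\<^esub> t \<ominus>\<^bsub>A\<^esub> c' \<odot>\<^bsub>A\<^esub> t)"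
      using add.hyps c(1,2) t
      by (simp add: A.l_distr A.smult_l_distr A.minus_eq A.minus_add A.a_ac del: A_simps)
    also have "\<dots> \<in> ?J s"
      using c(3,4) additive_subgroup.a_closed[OF ideal.axioms(1)[OF J]] unfolding t_def by blast
    finally show ?case unfolding t_def using c(1,2) by blast
  qed
  show "\<exists>c \<in> Units R. (\<one>\<^bsub>R\<^esub> \<otimes>\<^sub>A s) \<otimes>\<^bsub>A\<^esub> (\<one>\<^bsub>R\<^esub> \<otimes>\<^sub>A s) \<ominus>\<^bsub>A\<^esub> c \<odot>\<^bsub>A\<^esub> (\<one>\<^bsub>R\<^esub> \<otimes>\<^sub>A s) \<in> ?J s"
    if "s \<in> S" for s
  proof -
    obtain m :: int where "[m] \<cdot>\<^bsub>R\<^esub> \<one>\<^bsub>R\<^esub> \<in> Units R"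
      "s \<otimes>\<^bsub>B\<^esub> s \<ominus>\<^bsub>B\<^esub> [m] \<cdot>\<^bsub>B\<^esub> s \<in> Idl\<^bsub>B\<^esub> {s' \<in> S. size s < size s'}"
      using diag[OF \<open>s \<in> S\<close>] by blast
    then show ?thesis using coeff[OF R.one_closed _ \<open>s \<in> S\<close>] \<open>s \<in> S\<close> S by blast
  qed
qed (rule S(1))

end

section \<open>The Grothendieck ring of a commutative semiring\<close>

locale comm_semiring = semiring S + Group.comm_monoid S for S (structure)
begin

abbreviation "\<G> \<equiv> grothendieck_ring S"
definition difference where "difference a b = grothendieck_rel S `` {(a, b)}"

lemma rel_iff: "((a, b), (c, d)) \<in> grothendieck_rel S \<longleftrightarrow>
    a \<in> carrier S \<and> b \<in> carrier S \<and> c \<in> carrier S \<and> d \<in> carrier S \<and>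
    (\<exists>k \<in> carrier S. a \<oplus> d \<oplus> k = c \<oplus> b \<oplus> k)"
  by (auto simp: grothendieck_rel_def)

lemma equiv_rel: "equiv (carrier S \<times> carrier S) (grothendieck_rel S)"
proof (rule equivI)
  show "refl_on (carrier S \<times> carrier S) (grothendieck_rel S)"
    by (auto simp: refl_on_def rel_iff)
  show "sym (grothendieck_rel S)"
    by (auto simp: sym_def rel_iff) metis
  show "trans (grothendieck_rel S)"
  proof (rule transI)
    fix p q r assume *: "(p, q) \<in> grothendieck_rel S" "(q, r) \<in> grothendieck_rel S"
    obtain a b c d e f where p: "p = (a, b)" "q = (c, d)" "r = (e, f)" by (cases p, cases q, cases r)
    from * obtain k l where k: "a \<oplus> d \<oplus> k = c \<oplus> b \<oplus> k" and l: "c \<oplus> f \<oplus> l = e \<oplus> d \<oplus> l"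
      and cl: "a \<in> carrier S" "b \<in> carrier S" "c \<in> carrier S" "d \<in> carrier S" "e \<in> carrier S"
        "f \<in> carrier S" "k \<in> carrier S" "l \<in> carrier S"
      unfolding p rel_iff by blast
    \<comment> \<open>Without cancellation in S the two witnesses have to be combined; the middle
      term \<open>d\<close> is absorbed into the new witness d + k + l.\<close>
    have "a \<oplus> f \<oplus> (d \<oplus> k \<oplus> l) = (a \<oplus> d \<oplus> k) \<oplus> (f \<oplus> l)" using cl by (simp add: a_ac)
    also have "\<dots> = (c \<oplus> f \<oplus> l) \<oplus> (b \<oplus> k)" unfolding k using cl by (simp add: a_ac)
    also have "\<dots> = e \<oplus> b \<oplus> (d \<oplus> k \<oplus> l)" unfolding l using cl by (simp add: a_ac)
    finally show "(p, r) \<in> grothendieck_rel S"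
      unfolding p rel_iff using cl by blast
  qed
qed (auto simp: grothendieck_rel_def)

lemma difference_eq_iff:
  "\<lbrakk>a \<in> carrier S; b \<in> carrier S; c \<in> carrier S; d \<in> carrier S\<rbrakk> \<Longrightarrow>
    difference a b = difference c d \<longleftrightarrow> (\<exists>k \<in> carrier S. a \<oplus> d \<oplus> k = c \<oplus> b \<oplus> k)"
  unfolding difference_def by (subst eq_equiv_class_iff[OF equiv_rel]) (auto simp: rel_iff)

lemma difference_self: "a \<in> carrier S \<Longrightarrow> b \<in> carrier S \<Longrightarrow> (a, b) \<in> difference a b"
  unfolding difference_def by (rule equiv_class_self[OF equiv_rel]) simp

lemma in_difference_iff: "\<lbrakk>a \<in> carrier S; b \<in> carrier S\<rbrakk> \<Longrightarrow> (c, d) \<in> difference a b \<longleftrightarrow>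
    c \<in> carrier S \<and> d \<in> carrier S \<and> difference c d = difference a b"
proof -
  assume ab: "a \<in> carrier S" "b \<in> carrier S"
  have "(c, d) \<in> difference a b \<longleftrightarrow>
      c \<in> carrier S \<and> d \<in> carrier S \<and> (\<exists>k \<in> carrier S. a \<oplus> d \<oplus> k = c \<oplus> b \<oplus> k)"
    using ab by (simp add: difference_def rel_iff)
  then show ?thesis
    using ab difference_eq_iff[of a b c d] by (metis (no_types, lifting))
qed

lemma carrier_G: "carrier \<G> = {difference a b | a b. a \<in> carrier S \<and> b \<in> carrier S}"
  by (auto simp: grothendieck_ring_def quotient_def difference_def)

lemma difference_closed [simp]:
  "a \<in> carrier S \<Longrightarrow> b \<in> carrier S \<Longrightarrow> difference a b \<in> carrier \<G>"
  by (auto simp: carrier_G)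

lemma carrier_G_cases:
  assumes "x \<in> carrier \<G>"
  obtains a b where "a \<in> carrier S" "b \<in> carrier S" "x = difference a b"
  using assms by (auto simp: carrier_G)

text \<open>The operations of \<open>grothendieck_ring\<close> are unions over representatives. When
  the value F does not depend on the representatives, the union collapses to it.\<close>

lemma difference_image2:
  assumes "a \<in> carrier S" "b \<in> carrier S" "c \<in> carrier S" "d \<in> carrier S"
    and eq: "\<And>a' b' c' d'. \<lbrakk>a' \<in> carrier S; b' \<in> carrier S; c' \<in> carrier S; d' \<in> carrier S;
      difference a' b' = difference a b; difference c' d' = difference c d\<rbrakk> \<Longrightarrow> F a' b' c' d' = F a b c d"
  shows "(\<Union>(a', b') \<in> difference a b. \<Union>(c', d') \<in> difference c d. F a' b' c' d') = F a b c d"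
proof (rule SUP_eq_const)
  show "difference a b \<noteq> {}" using difference_self[OF assms(1,2)] by blast
  fix p assume "p \<in> difference a b"
  then obtain a' b' where p: "p = (a', b')" "a' \<in> carrier S" "b' \<in> carrier S" "difference a' b' = difference a b"
    using in_difference_iff[OF assms(1,2)] by (cases p) metis
  have "(\<Union>(c', d') \<in> difference c d. F a' b' c' d') = F a b c d"
  proof (rule SUP_eq_const)
    show "difference c d \<noteq> {}" using difference_self[OF assms(3,4)] by blast
    fix q assume "q \<in> difference c d"
    then obtain c' d' where "q = (c', d')" "c' \<in> carrier S" "d' \<in> carrier S" "difference c' d' = difference c d"
      using in_difference_iff[OF assms(3,4)] by (cases q) metis
    then show "(case q of (c', d') \<Rightarrow> F a' b' c' d') = F a b c d"
      using eq p by simp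
  qed
  then show "(case p of (a', b') \<Rightarrow> \<Union>(c', d') \<in> difference c d. F a' b' c' d') = F a b c d"
    by (simp add: p(1))
qed

lemma difference_add_cong:
  assumes "difference c d = difference a b" and
    "a \<in> carrier S" "b \<in> carrier S" "c \<in> carrier S" "d \<in> carrier S" "e \<in> carrier S" "f \<in> carrier S"
  shows "difference (c \<oplus> e) (d \<oplus> f) = difference (a \<oplus> e) (b \<oplus> f)"
proof -
  obtain k where k: "k \<in> carrier S" "c \<oplus> b \<oplus> k = a \<oplus> d \<oplus> k"
    using assms by (auto simp: difference_eq_iff)
  have "c \<oplus> e \<oplus> (b \<oplus> f) \<oplus> k = (c \<oplus> b \<oplus> k) \<oplus> (e \<oplus> f)" using assms k(1) by (simp add: a_ac)
  also have "\<dots> = a \<oplus> e \<oplus> (d \<oplus> f) \<oplus> k" unfolding k(2) using assms k(1) by (simp add: a_ac)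
  finally show ?thesis using assms k(1) by (auto simp: difference_eq_iff)
qed

lemma difference_mult_cong:
  assumes "difference c d = difference a b" and
    "a \<in> carrier S" "b \<in> carrier S" "c \<in> carrier S" "d \<in> carrier S" "e \<in> carrier S" "f \<in> carrier S"
  shows "difference (c \<otimes> e \<oplus> d \<otimes> f) (c \<otimes> f \<oplus> d \<otimes> e) = difference (a \<otimes> e \<oplus> b \<otimes> f) (a \<otimes> f \<oplus> b \<otimes> e)"
proof -
  obtain k where k: "k \<in> carrier S" "c \<oplus> b \<oplus> k = a \<oplus> d \<oplus> k"
    using assms by (auto simp: difference_eq_iff)
  \<comment> \<open>The witness equation is used times \<open>e\<close> in one direction and times
    \<open>f\<close> in the other, which accounts for the two summands.\<close>
  let ?k = "k \<otimes> e \<oplus> k \<otimes> f"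
  have "c \<otimes> e \<oplus> d \<otimes> f \<oplus> (a \<otimes> f \<oplus> b \<otimes> e) \<oplus> ?k = (c \<oplus> b \<oplus> k) \<otimes> e \<oplus> (a \<oplus> d \<oplus> k) \<otimes> f"
    using assms k(1) by (simp add: a_ac l_distr)
  also have "\<dots> = (a \<oplus> d \<oplus> k) \<otimes> e \<oplus> (c \<oplus> b \<oplus> k) \<otimes> f"
    by (simp add: k(2))
  also have "\<dots> = a \<otimes> e \<oplus> b \<otimes> f \<oplus> (c \<otimes> f \<oplus> d \<otimes> e) \<oplus> ?k"
    using assms k(1) by (simp add: a_ac l_distr)
  finally show ?thesis using assms k(1) by (subst difference_eq_iff) auto
qed

lemma difference_add:
  assumes "a \<in> carrier S" "b \<in> carrier S" "c \<in> carrier S" "d \<in> carrier S"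
  shows "difference a b \<oplus>\<^bsub>\<G>\<^esub> difference c d = difference (a \<oplus> c) (b \<oplus> d)"
proof -
  have "difference (a' \<oplus> c') (b' \<oplus> d') = difference (a \<oplus> c) (b \<oplus> d)"
    if "a' \<in> carrier S" "b' \<in> carrier S" "c' \<in> carrier S" "d' \<in> carrier S"
      "difference a' b' = difference a b" "difference c' d' = difference c d" for a' b' c' d'
    using difference_add_cong[of a' b' a b c' d'] difference_add_cong[of c' d' c d a b] that assms
    by (simp add: a_comm)
  from difference_image2[OF assms, where F = "\<lambda>a b c d. difference (a \<oplus> c) (b \<oplus> d)", OF this] show ?thesis
    by (simp add: grothendieck_ring_def difference_def)
qed

lemma difference_mult:
  assumes "a \<in> carrier S" "b \<in> carrier S" "c \<in> carrier S" "d \<in> carrier S"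
  shows "difference a b \<otimes>\<^bsub>\<G>\<^esub> difference c d =
    difference (a \<otimes> c \<oplus> b \<otimes> d) (a \<otimes> d \<oplus> b \<otimes> c)"
proof -
  have "difference (a' \<otimes> c' \<oplus> b' \<otimes> d') (a' \<otimes> d' \<oplus> b' \<otimes> c') =
      difference (a \<otimes> c \<oplus> b \<otimes> d) (a \<otimes> d \<oplus> b \<otimes> c)"
    if "a' \<in> carrier S" "b' \<in> carrier S" "c' \<in> carrier S" "d' \<in> carrier S"
      "difference a' b' = difference a b" "difference c' d' = difference c d" for a' b' c' d'
    using difference_mult_cong[of a' b' a b c' d'] difference_mult_cong[of c' d' c d a b] that assms
    by (simp add: a_comm m_comm)
  from difference_image2[OF assms,
      where F = "\<lambda>a b c d. difference (a \<otimes> c \<oplus> b \<otimes> d) (a \<otimes> d \<oplus> b \<otimes> c)", OF this] show ?thesis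
    by (simp add: grothendieck_ring_def difference_def)
qed

lemma zero_G: "\<zero>\<^bsub>\<G>\<^esub> = difference \<zero> \<zero>" and one_G: "\<one>\<^bsub>\<G>\<^esub> = difference \<one> \<zero>"
  by (simp_all add: grothendieck_ring_def difference_def)

lemma cring_grothendieck: "cring \<G>"
proof (rule cringI)
  show "abelian_group \<G>"
  proof (rule abelian_groupI)
    show "\<exists>y \<in> carrier \<G>. y \<oplus>\<^bsub>\<G>\<^esub> x = \<zero>\<^bsub>\<G>\<^esub>" if "x \<in> carrier \<G>" for x
      using that
    proof (cases rule: carrier_G_cases)
      case (1 a b)
      then have "difference b a \<oplus>\<^bsub>\<G>\<^esub> x = \<zero>\<^bsub>\<G>\<^esub>"
        by (simp add: difference_add zero_G difference_eq_iff a_comm)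
          (rule exI[of _ "\<zero>"], simp)
      then show ?thesis using 1(1,2) difference_closed by blast
    qed
  qed (auto elim!: carrier_G_cases simp: difference_add zero_G a_ac)
  show "Group.comm_monoid \<G>"
    by (rule comm_monoidI)
      (auto elim!: carrier_G_cases simp: difference_mult one_G m_ac l_distr r_distr a_ac)
qed (auto elim!: carrier_G_cases simp: difference_add difference_mult l_distr a_ac)

sublocale \<G>: cring \<G> by (rule cring_grothendieck)

text \<open>Reduces additive statements on the Grothendieck ring to the images of elements of
  S.\<close>

lemma difference_eq_minus:
  assumes "a \<in> carrier S" "b \<in> carrier S"
  shows "difference a b = difference a \<zero> \<ominus>\<^bsub>\<G>\<^esub> difference b \<zero>"
proof -
  have "difference \<zero> b \<oplus>\<^bsub>\<G>\<^esub> difference b \<zero> = \<zero>\<^bsub>\<G>\<^esub>"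
    using assms by (simp add: difference_add zero_G difference_eq_iff) (rule exI[of _ "\<zero>"], simp)
  then have "\<ominus>\<^bsub>\<G>\<^esub> difference b \<zero> = difference \<zero> b"
    using assms by (intro \<G>.minus_equality) auto
  then show ?thesis using assms by (simp add: \<G>.minus_eq difference_add)
qed

text \<open>The auxiliary summand of the equivalence relation cancels in the integers, so h(a) -
  h(b) is the same for all pairs in a class.\<close>

lemma grothendieck_extend:
  fixes h :: "_ \<Rightarrow> int"
  assumes h: "\<And>a b. a \<in> carrier S \<Longrightarrow> b \<in> carrier S \<Longrightarrow> h (a \<oplus> b) = h a + h b"
  obtains H where "\<And>a b. a \<in> carrier S \<Longrightarrow> b \<in> carrier S \<Longrightarrow> H (difference a b) = h a - h b"
    "\<And>x y. x \<in> carrier \<G> \<Longrightarrow> y \<in> carrier \<G> \<Longrightarrow> H (x \<oplus>\<^bsub>\<G>\<^esub> y) = H x + H y"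
proof
  let ?H = "\<lambda>U. the_elem ((\<lambda>(a, b). h a - h b) ` U)"
  show *: "?H (difference a b) = h a - h b" if ab: "a \<in> carrier S" "b \<in> carrier S" for a b
  proof -
    have "h c - h d = h a - h b" if cd: "c \<in> carrier S" "d \<in> carrier S" "difference c d = difference a b" for c d
    proof -
      obtain k where "k \<in> carrier S" "c \<oplus> b \<oplus> k = a \<oplus> d \<oplus> k"
        using cd ab by (auto simp: difference_eq_iff)
      then have "h (c \<oplus> b \<oplus> k) = h (a \<oplus> d \<oplus> k)" by simp
      then show ?thesis using \<open>k \<in> carrier S\<close> cd ab by (simp add: h)
    qed
    note * = this
    have "(\<lambda>(a, b). h a - h b) p = (\<lambda>(a, b). h a - h b) (a, b)" if "p \<in> difference a b" for p
    proof -
      obtain c d where "p = (c, d)" by (cases p)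
      then show ?thesis using that * by (simp add: in_difference_iff[OF ab])
    qed
    then have "?H (difference a b) = (\<lambda>(a, b). h a - h b) (a, b)"
      by (intro the_elem_image_unique) (use difference_self[OF ab] in auto)
    then show ?thesis by simp
  qed
  show "?H (x \<oplus>\<^bsub>\<G>\<^esub> y) = ?H x + ?H y" if "x \<in> carrier \<G>" "y \<in> carrier \<G>" for x y
    using that by (auto elim!: carrier_G_cases simp: difference_add * h)
qed

end

section \<open>The semiring of isomorphism classes of finite G-sets\<close>

lemma gset_isoI:
  assumes "\<And>x. x \<in> fst X \<Longrightarrow> f x \<in> fst Y" "\<And>y. y \<in> fst Y \<Longrightarrow> f' y \<in> fst X"
    "\<And>x. x \<in> fst X \<Longrightarrow> f' (f x) = x" "\<And>y. y \<in> fst Y \<Longrightarrow> f (f' y) = y"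
    "\<And>g x. g \<in> carrier G \<Longrightarrow> x \<in> fst X \<Longrightarrow> f (snd X g x) = snd Y g (f x)"
  shows "gset_iso G X Y"
  unfolding gset_iso_def
  by (rule exI[of _ f]) (use assms in \<open>auto intro!: bij_betw_byWitness[of _ f']\<close>)

lemma gset_isoE:
  assumes "gset_iso G X Y"
  obtains f f' where "\<And>x. x \<in> fst X \<Longrightarrow> f x \<in> fst Y" "\<And>y. y \<in> fst Y \<Longrightarrow> f' y \<in> fst X"
    "\<And>x. x \<in> fst X \<Longrightarrow> f' (f x) = x" "\<And>y. y \<in> fst Y \<Longrightarrow> f (f' y) = y"
    "\<And>g x. g \<in> carrier G \<Longrightarrow> x \<in> fst X \<Longrightarrow> f (snd X g x) = snd Y g (f x)"
    "bij_betw f (fst X) (fst Y)"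
proof -
  from assms obtain f where f: "bij_betw f (fst X) (fst Y)"
    "\<And>g x. g \<in> carrier G \<Longrightarrow> x \<in> fst X \<Longrightarrow> f (snd X g x) = snd Y g (f x)"
    unfolding gset_iso_def by blast
  show thesis
    by (rule that[of f "inv_into (fst X) f"])
      (use f in \<open>auto simp: bij_betw_def inv_into_into f_inv_into_f\<close>)
qed

context group
begin

text \<open>Replaces homomorphisms into the group of bijections by pointwise laws; bijectivity is
  recovered from the action of \<open>inv g\<close>. The extensionality clause is inherited from
  \<open>Bij\<close>, and it is the reason why the constructions on G-sets carry
  restrictions.\<close>

lemma finite_gset_iff:
  "finite_gset G X \<longleftrightarrow> finite (fst X) \<and>
    (\<forall>g \<in> carrier G. snd X g \<in> extensional (fst X)) \<and>
    (\<forall>g \<in> carrier G. \<forall>x \<in> fst X. snd X g x \<in> fst X) \<and>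
    (\<forall>x \<in> fst X. snd X \<one> x = x) \<and>
    (\<forall>g \<in> carrier G. \<forall>h \<in> carrier G. \<forall>x \<in> fst X. snd X (g \<otimes> h) x = snd X g (snd X h x))"
  (is "?L \<longleftrightarrow> ?R")
proof
  assume ?L
  then interpret group_action G "fst X" "snd X" by (simp add: finite_gset_def)
  show ?R
  proof (intro conjI ballI)
    show "finite (fst X)" using \<open>?L\<close> by (simp add: finite_gset_def)
    show "snd X g \<in> extensional (fst X)" if "g \<in> carrier G" for g
      using bij_prop0[OF that] by (simp add: Bij_def)
    show "snd X \<one> x = x" if "x \<in> fst X" for x
      using that by (metis id_eq_one restrict_apply')
    show "snd X g x \<in> fst X" if "g \<in> carrier G" "x \<in> fst X" for g x
      using element_image[OF that refl] .
    show "snd X (g \<otimes> h) x = snd X g (snd X h x)" if "g \<in> carrier G" "h \<in> carrier G" "x \<in> fst X" for g h x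
      using composition_rule[OF that(3,1,2)] .
  qed
next
  assume R: ?R
  have "bij_betw (snd X g) (fst X) (fst X)" if g: "g \<in> carrier G" for g
  proof (rule bij_betw_byWitness[of _ "snd X (inv g)"])
    have "snd X (inv g \<otimes> g) x = snd X (inv g) (snd X g x)" "snd X (g \<otimes> inv g) x = snd X g (snd X (inv g) x)"
      if "x \<in> fst X" for x
      using R g that inv_closed[OF g] by blast+
    then show "\<forall>x \<in> fst X. snd X (inv g) (snd X g x) = x" "\<forall>x \<in> fst X. snd X g (snd X (inv g) x) = x"
      using R g by auto
  qed (use R g in auto)
  then have B: "snd X g \<in> Bij (fst X)" if "g \<in> carrier G" for g
    using that R by (simp add: Bij_def)
  have "snd X (g \<otimes> h) = compose (fst X) (snd X g) (snd X h)" if "g \<in> carrier G" "h \<in> carrier G" for g h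
    by (rule extensionalityI[of _ "fst X"]) (use that R in \<open>auto simp: compose_def\<close>)
  then have "snd X \<in> hom G (BijGroup (fst X))"
    using B by (auto simp: hom_def BijGroup_def)
  then show ?L
    using R by (simp add: finite_gset_def group_action_def group_hom_def group_hom_axioms_def
        group_BijGroup group_axioms)
qed

lemma gset_finite: "finite_gset G X \<Longrightarrow> finite (fst X)"
  and gset_closed: "finite_gset G X \<Longrightarrow> g \<in> carrier G \<Longrightarrow> x \<in> fst X \<Longrightarrow> snd X g x \<in> fst X"
  and gset_one: "finite_gset G X \<Longrightarrow> x \<in> fst X \<Longrightarrow> snd X \<one> x = x"
  and gset_mult: "finite_gset G X \<Longrightarrow> g \<in> carrier G \<Longrightarrow> h \<in> carrier G \<Longrightarrow> x \<in> fst X \<Longrightarrow>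
    snd X (g \<otimes> h) x = snd X g (snd X h x)"
  by (auto simp: finite_gset_iff)

lemma gset_inv:
  assumes "finite_gset G X" "g \<in> carrier G" "x \<in> fst X"
  shows "snd X (inv g) (snd X g x) = x" "snd X g (snd X (inv g) x) = x"
  using gset_mult[OF assms(1), of "inv g" g x] gset_mult[OF assms(1), of g "inv g" x]
    gset_one[OF assms(1,3)] assms by auto

lemma gset_iso_sym:
  assumes "finite_gset G X" "gset_iso G X Y" shows "gset_iso G Y X"
  using assms(2)
proof (cases rule: gset_isoE)
  case (1 f f')
  show ?thesis
  proof (rule gset_isoI[of _ f' _ f])
    show "f' (snd Y g y) = snd X g (f' y)" if "g \<in> carrier G" "y \<in> fst Y" for g y
      using 1(5)[OF that(1) 1(2)[OF that(2)]] 1(3)[OF gset_closed[OF assms(1) that(1) 1(2)[OF that(2)]]]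
        1(4)[OF that(2)] by simp
  qed (use 1 in auto)
qed

lemma gset_iso_trans:
  assumes "gset_iso G X Y" "gset_iso G Y Z" shows "gset_iso G X Z"
  using assms(1)
proof (cases rule: gset_isoE)
  case f: (1 f f')
  show ?thesis using assms(2)
  proof (cases rule: gset_isoE)
    case h: (1 h h')
    show ?thesis
      by (rule gset_isoI[of _ "h \<circ> f" _ "f' \<circ> h'"]) (use f(1-5) h(1-5) in auto)
  qed
qed

text \<open>The action laws are transported along the bijection. An isomorphism does not see values
  off the point set, hence the extensionality hypothesis.\<close>

lemma gset_iso_finite:
  assumes "finite_gset G X" "gset_iso G X Y"
    "\<And>g. g \<in> carrier G \<Longrightarrow> snd Y g \<in> extensional (fst Y)"
  shows "finite_gset G Y"
  using gset_iso_sym[OF assms(1,2)]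
proof (cases rule: gset_isoE)
  case h: (1 h h')
  have cl: "snd Y g y \<in> fst Y" if "g \<in> carrier G" "y \<in> fst Y" for g y
  proof -
    obtain f f' where f: "\<And>x. x \<in> fst X \<Longrightarrow> f x \<in> fst Y" "\<And>y. y \<in> fst Y \<Longrightarrow> f' y \<in> fst X"
      "\<And>y. y \<in> fst Y \<Longrightarrow> f (f' y) = y"
      "\<And>g x. g \<in> carrier G \<Longrightarrow> x \<in> fst X \<Longrightarrow> f (snd X g x) = snd Y g (f x)"
      using assms(2) by (rule gset_isoE) blast
    show ?thesis
      using f(4)[OF that(1) f(2)[OF that(2)]] f(1)[OF gset_closed[OF assms(1) that(1) f(2)[OF that(2)]]]
        f(3)[OF that(2)] by simp
  qed
  have inj: "y = y'" if "h y = h y'" "y \<in> fst Y" "y' \<in> fst Y" for y y'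
    using that h(3) by metis
  show ?thesis
    unfolding finite_gset_iff
  proof (intro conjI ballI)
    show "finite (fst Y)" using h(6) gset_finite[OF assms(1)] bij_betw_finite by blast
    show "snd Y \<one> y = y" if "y \<in> fst Y" for y
      by (rule inj) (use that cl h(1,5) gset_one[OF assms(1)] in auto)
    show "snd Y (g \<otimes> k) y = snd Y g (snd Y k y)" if "g \<in> carrier G" "k \<in> carrier G" "y \<in> fst Y" for g k y
      by (rule inj) (use that cl h(1,5) gset_mult[OF assms(1)] in auto)
  qed (use assms cl in auto)
qed

text \<open>The points are numbered and the action is transported. Classes contain only G-sets on
  natural numbers, and this makes the class of a G-set over any other type nonempty.\<close>

lemma gset_representative:
  assumes "finite_gset G X"
  obtains Z :: "('a, nat) gset" where "finite_gset G Z" "gset_iso G X Z"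
proof -
  obtain f :: "_ \<Rightarrow> nat" where f: "inj_on f (fst X)"
    using finite_imp_inj_to_nat_seg[OF gset_finite[OF assms]] by blast
  define Z where "Z = (f ` fst X, \<lambda>g. \<lambda>z \<in> f ` fst X. f (snd X g (inv_into (fst X) f z)))"
  have "gset_iso G X Z"
    by (rule gset_isoI[of _ f _ "inv_into (fst X) f"]) (use f in \<open>auto simp: Z_def\<close>)
  moreover have "finite_gset G Z"
    by (rule gset_iso_finite[OF assms \<open>gset_iso G X Z\<close>]) (simp add: Z_def)
  ultimately show thesis using that by blast
qed

lemma gset_class_eq:
  assumes "finite_gset G X" "gset_iso G X Y"
  shows "gset_class G X = gset_class G Y"
  unfolding gset_class_def
proof (intro Collect_cong conj_cong refl iffI)
  show "gset_iso G Y Z" if "gset_iso G X Z" for Z :: "('a, nat) gset"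
    using gset_iso_sym[OF assms] that by (rule gset_iso_trans)
  show "gset_iso G X Z" if "gset_iso G Y Z" for Z :: "('a, nat) gset"
    using assms(2) that by (rule gset_iso_trans)
qed

lemma gset_class_nonempty: "finite_gset G X \<Longrightarrow> gset_class G X \<noteq> {}"
  using gset_representative[of X] unfolding gset_class_def by blast

lemma finite_gset_sum: "finite_gset G X \<Longrightarrow> finite_gset G Y \<Longrightarrow> finite_gset G (gset_sum X Y)"
  by (subst finite_gset_iff)
    (auto simp: gset_sum_def gset_finite gset_closed gset_one gset_mult)

lemma finite_gset_prod: "finite_gset G X \<Longrightarrow> finite_gset G Y \<Longrightarrow> finite_gset G (gset_prod X Y)"
  by (subst finite_gset_iff)
    (auto simp: gset_prod_def gset_finite gset_closed gset_one gset_mult)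

lemma finite_gset_trivial: "finite X \<Longrightarrow> finite_gset G (trivial_gset X)"
  by (subst finite_gset_iff) (auto simp: trivial_gset_def)

lemma gset_sum_cong:
  assumes "gset_iso G X X'" "gset_iso G Y Y'"
  shows "gset_iso G (gset_sum X Y) (gset_sum X' Y')"
  using assms(1)
proof (cases rule: gset_isoE)
  case f: (1 f f')
  show ?thesis using assms(2)
  proof (cases rule: gset_isoE)
    case h: (1 h h')
    show ?thesis
      by (rule gset_isoI[of _ "map_sum f h" _ "map_sum f' h'"])
        (use f(1-5) h(1-5) in \<open>auto simp: gset_sum_def\<close>)
  qed
qed

lemma gset_prod_cong:
  assumes "gset_iso G X X'" "gset_iso G Y Y'"
  shows "gset_iso G (gset_prod X Y) (gset_prod X' Y')"
  using assms(1)
proof (cases rule: gset_isoE)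
  case f: (1 f f')
  show ?thesis using assms(2)
  proof (cases rule: gset_isoE)
    case h: (1 h h')
    show ?thesis
      by (rule gset_isoI[of _ "map_prod f h" _ "map_prod f' h'"])
        (use f(1-5) h(1-5) in \<open>auto simp: gset_prod_def\<close>)
  qed
qed

section \<open>The semiring laws for isomorphism classes\<close>

abbreviation "\<S> \<equiv> gset_semiring G"

lemma gset_class_closed:
  assumes "finite_gset G X" shows "gset_class G X \<in> carrier \<S>"
proof -
  obtain Z :: "('a, nat) gset" where Z: "finite_gset G Z" "gset_iso G X Z"
    using gset_representative[OF assms] .
  then have "gset_class G X = gset_class G Z" using gset_class_eq[OF assms] by blast
  then show ?thesis using Z by (auto simp: gset_semiring_def)
qed

lemma gset_class_cases:
  assumes "U \<in> carrier \<S>"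
  obtains X :: "('a, nat) gset" where "finite_gset G X" "U = gset_class G X"
  using assms by (auto simp: gset_semiring_def)

text \<open>The sum of classes is a union over representatives; it collapses because isomorphic
  summands have isomorphic sums and classes are nonempty.\<close>

lemma gset_class_sum:
  assumes "finite_gset G X" "finite_gset G Y"
  shows "gset_class G X \<oplus>\<^bsub>\<S>\<^esub> gset_class G Y = gset_class G (gset_sum X Y)"
proof -
  have "gset_class G (gset_sum X' Y') = gset_class G (gset_sum X Y)"
    if "X' \<in> gset_class G X" "Y' \<in> gset_class G Y" for X' Y'
    using that gset_class_eq[OF finite_gset_sum[OF assms] gset_sum_cong]
    by (metis (mono_tags, lifting) gset_class_def mem_Collect_eq)
  then have "(\<Union>X' \<in> gset_class G X. \<Union>Y' \<in> gset_class G Y. gset_class G (gset_sum X' Y')) =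
      gset_class G (gset_sum X Y)"
    by (intro SUP_eq_const gset_class_nonempty assms)
  then show ?thesis by (simp add: gset_semiring_def)
qed

lemma gset_class_prod:
  assumes "finite_gset G X" "finite_gset G Y"
  shows "gset_class G X \<otimes>\<^bsub>\<S>\<^esub> gset_class G Y = gset_class G (gset_prod X Y)"
proof -
  have "gset_class G (gset_prod X' Y') = gset_class G (gset_prod X Y)"
    if "X' \<in> gset_class G X" "Y' \<in> gset_class G Y" for X' Y'
    using that gset_class_eq[OF finite_gset_prod[OF assms] gset_prod_cong]
    by (metis (mono_tags, lifting) gset_class_def mem_Collect_eq)
  then have "(\<Union>X' \<in> gset_class G X. \<Union>Y' \<in> gset_class G Y. gset_class G (gset_prod X' Y')) =
      gset_class G (gset_prod X Y)"
    by (intro SUP_eq_const gset_class_nonempty assms)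
  then show ?thesis by (simp add: gset_semiring_def)
qed

lemma gset_class_zero: "\<zero>\<^bsub>\<S>\<^esub> = gset_class G (trivial_gset ({} :: unit set))"
  and gset_class_one: "\<one>\<^bsub>\<S>\<^esub> = gset_class G (trivial_gset {()})"
  by (simp_all add: gset_semiring_def)

lemmas gset_class_simps = gset_class_sum gset_class_prod gset_class_zero gset_class_one
  gset_class_closed finite_gset_sum finite_gset_prod finite_gset_trivial
lemmas gset_defs = gset_sum_def gset_prod_def trivial_gset_def

text \<open>Each law is a natural isomorphism of G-sets, given by an explicit pair of inverse maps.
  Distributivity and absorption by zero are shown on one side and mirrored by commutativity.\<close>

lemma comm_semiring_gset: "comm_semiring \<S>"
proof (intro comm_semiring.intro semiring.intro semiring_axioms.intro)
  show "abelian_monoid \<S>"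
  proof (rule abelian_monoidI)
    fix U V W assume UVW: "U \<in> carrier \<S>" "V \<in> carrier \<S>" "W \<in> carrier \<S>"
    obtain X Y Z :: "('a, nat) gset" where
      XYZ: "finite_gset G X" "finite_gset G Y" "finite_gset G Z"
      and U: "U = gset_class G X" "V = gset_class G Y" "W = gset_class G Z"
      using UVW by (metis gset_class_cases)
    have "gset_iso G (gset_sum (gset_sum X Y) Z) (gset_sum X (gset_sum Y Z))"
      by (rule gset_isoI[of _ "case_sum (case_sum Inl (Inr \<circ> Inl)) (Inr \<circ> Inr)"
            _ "case_sum (Inl \<circ> Inl) (case_sum (Inl \<circ> Inr) Inr)"])
        (auto simp: gset_defs gset_closed XYZ)
    then show "U \<oplus>\<^bsub>\<S>\<^esub> V \<oplus>\<^bsub>\<S>\<^esub> W = U \<oplus>\<^bsub>\<S>\<^esub> (V \<oplus>\<^bsub>\<S>\<^esub> W)"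
      using XYZ by (simp add: U gset_class_simps gset_class_eq)
  next
    fix U V assume UV: "U \<in> carrier \<S>" "V \<in> carrier \<S>"
    obtain X Y :: "('a, nat) gset" where
      XY: "finite_gset G X" "finite_gset G Y" and U: "U = gset_class G X" "V = gset_class G Y"
      using UV by (metis gset_class_cases)
    have "gset_iso G (gset_sum X Y) (gset_sum Y X)"
      by (rule gset_isoI[of _ "case_sum Inr Inl" _ "case_sum Inr Inl"])
        (auto simp: gset_defs gset_closed XY)
    then show "U \<oplus>\<^bsub>\<S>\<^esub> V = V \<oplus>\<^bsub>\<S>\<^esub> U"
      using XY by (simp add: U gset_class_simps gset_class_eq)
  next
    fix U assume "U \<in> carrier \<S>"
    then obtain X :: "('a, nat) gset" where X: "finite_gset G X" and U: "U = gset_class G X"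
      by (rule gset_class_cases)
    have "gset_iso G (gset_sum (trivial_gset ({} :: unit set)) X) X"
      \<comment> \<open>The left summand has no points, so the map is arbitrary there.\<close>
      by (rule gset_isoI[of _ "case_sum undefined id" _ Inr]) (auto simp: gset_defs gset_closed X)
    then show "\<zero>\<^bsub>\<S>\<^esub> \<oplus>\<^bsub>\<S>\<^esub> U = U"
      using X by (simp add: U gset_class_simps gset_class_eq)
  qed (auto elim!: gset_class_cases simp: gset_class_simps)
  show "Group.comm_monoid \<S>"
  proof (rule comm_monoidI)
    fix U V W assume UVW: "U \<in> carrier \<S>" "V \<in> carrier \<S>" "W \<in> carrier \<S>"
    obtain X Y Z :: "('a, nat) gset" where
      XYZ: "finite_gset G X" "finite_gset G Y" "finite_gset G Z"
      and U: "U = gset_class G X" "V = gset_class G Y" "W = gset_class G Z"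
      using UVW by (metis gset_class_cases)
    have "gset_iso G (gset_prod (gset_prod X Y) Z) (gset_prod X (gset_prod Y Z))"
      by (rule gset_isoI[of _ "\<lambda>((x, y), z). (x, (y, z))" _ "\<lambda>(x, (y, z)). ((x, y), z)"])
        (auto simp: gset_defs gset_closed XYZ)
    then show "U \<otimes>\<^bsub>\<S>\<^esub> V \<otimes>\<^bsub>\<S>\<^esub> W = U \<otimes>\<^bsub>\<S>\<^esub> (V \<otimes>\<^bsub>\<S>\<^esub> W)"
      using XYZ by (simp add: U gset_class_simps gset_class_eq)
  next
    fix U V assume UV: "U \<in> carrier \<S>" "V \<in> carrier \<S>"
    obtain X Y :: "('a, nat) gset" where
      XY: "finite_gset G X" "finite_gset G Y" and U: "U = gset_class G X" "V = gset_class G Y"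
      using UV by (metis gset_class_cases)
    have "gset_iso G (gset_prod X Y) (gset_prod Y X)"
      by (rule gset_isoI[of _ prod.swap _ prod.swap]) (auto simp: gset_defs gset_closed XY)
    then show "U \<otimes>\<^bsub>\<S>\<^esub> V = V \<otimes>\<^bsub>\<S>\<^esub> U"
      using XY by (simp add: U gset_class_simps gset_class_eq)
  next
    fix U assume "U \<in> carrier \<S>"
    then obtain X :: "('a, nat) gset" where X: "finite_gset G X" and U: "U = gset_class G X"
      by (rule gset_class_cases)
    have "gset_iso G (gset_prod (trivial_gset {()}) X) X"
      by (rule gset_isoI[of _ snd _ "Pair ()"]) (auto simp: gset_defs gset_closed X)
    then show "\<one>\<^bsub>\<S>\<^esub> \<otimes>\<^bsub>\<S>\<^esub> U = U"
      using X by (simp add: U gset_class_simps gset_class_eq)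
  qed (auto elim!: gset_class_cases simp: gset_class_simps)
  then interpret S: Group.comm_monoid \<S> .
  show "monoid \<S>" ..
  have distr: "(U \<oplus>\<^bsub>\<S>\<^esub> V) \<otimes>\<^bsub>\<S>\<^esub> W = U \<otimes>\<^bsub>\<S>\<^esub> W \<oplus>\<^bsub>\<S>\<^esub> V \<otimes>\<^bsub>\<S>\<^esub> W"
    if UVW: "U \<in> carrier \<S>" "V \<in> carrier \<S>" "W \<in> carrier \<S>" for U V W
  proof -
    obtain X Y Z :: "('a, nat) gset" where
      XYZ: "finite_gset G X" "finite_gset G Y" "finite_gset G Z"
      and U: "U = gset_class G X" "V = gset_class G Y" "W = gset_class G Z"
      using UVW by (metis gset_class_cases)
    have "gset_iso G (gset_prod (gset_sum X Y) Z) (gset_sum (gset_prod X Z) (gset_prod Y Z))"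
      by (rule gset_isoI[of _ "\<lambda>(s, z). map_sum (\<lambda>x. (x, z)) (\<lambda>y. (y, z)) s"
            _ "case_sum (map_prod Inl id) (map_prod Inr id)"])
        (auto simp: gset_defs gset_closed XYZ)
    then show ?thesis
      using XYZ by (simp add: U gset_class_simps gset_class_eq)
  qed
  have null: "\<zero>\<^bsub>\<S>\<^esub> \<otimes>\<^bsub>\<S>\<^esub> U = \<zero>\<^bsub>\<S>\<^esub>" if U0: "U \<in> carrier \<S>" for U
  proof -
    obtain X :: "('a, nat) gset" where X: "finite_gset G X" and U: "U = gset_class G X"
      using U0 by (rule gset_class_cases)
    have "gset_iso G (gset_prod (trivial_gset ({} :: unit set)) X) (trivial_gset ({} :: unit set))"
      \<comment> \<open>Both point sets are empty, so any map can serve as the inverse.\<close>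
      by (rule gset_isoI[of _ fst _ undefined]) (auto simp: gset_defs)
    then show ?thesis
      using X by (simp add: U gset_class_simps gset_class_eq)
  qed
  have closed: "U \<oplus>\<^bsub>\<S>\<^esub> V \<in> carrier \<S>" "\<zero>\<^bsub>\<S>\<^esub> \<in> carrier \<S>" if "U \<in> carrier \<S>" "V \<in> carrier \<S>" for U V
    using that by (auto elim!: gset_class_cases simp: gset_class_simps)
  show "(U \<oplus>\<^bsub>\<S>\<^esub> V) \<otimes>\<^bsub>\<S>\<^esub> W = U \<otimes>\<^bsub>\<S>\<^esub> W \<oplus>\<^bsub>\<S>\<^esub> V \<otimes>\<^bsub>\<S>\<^esub> W"
    and "W \<otimes>\<^bsub>\<S>\<^esub> (U \<oplus>\<^bsub>\<S>\<^esub> V) = W \<otimes>\<^bsub>\<S>\<^esub> U \<oplus>\<^bsub>\<S>\<^esub> W \<otimes>\<^bsub>\<S>\<^esub> V"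
    if "U \<in> carrier \<S>" "V \<in> carrier \<S>" "W \<in> carrier \<S>" for U V W
    using distr[OF that] that closed(1) by (simp_all add: S.m_comm)
  show "\<zero>\<^bsub>\<S>\<^esub> \<otimes>\<^bsub>\<S>\<^esub> U = \<zero>\<^bsub>\<S>\<^esub>" and "U \<otimes>\<^bsub>\<S>\<^esub> \<zero>\<^bsub>\<S>\<^esub> = \<zero>\<^bsub>\<S>\<^esub>" if "U \<in> carrier \<S>" for U
    using null[OF that] that closed(2)[OF that that] by (simp_all add: S.m_comm)
qed

end

section \<open>Orbits, stabilizers and free points\<close>

text \<open>Free orbits are counted through their points, as
  \<open>card (free_points G X) div order G\<close>: points add up over disjoint unions without any
  bookkeeping of orbits.\<close>

definition free_points :: "('g, 'm) monoid_scheme \<Rightarrow> ('g, 'x) gset \<Rightarrow> 'x set" where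
  "free_points G X = {x \<in> fst X. \<forall>g \<in> carrier G. snd X g x = x \<longrightarrow> g = \<one>\<^bsub>G\<^esub>}"

definition restrict_gset :: "('g, 'x) gset \<Rightarrow> 'x set \<Rightarrow> ('g, 'x) gset" where
  "restrict_gset X Q = (Q, \<lambda>g. \<lambda>x \<in> Q. snd X g x)"

definition transitive_gset :: "('g, 'm) monoid_scheme \<Rightarrow> ('g, 'x) gset \<Rightarrow> bool" where
  "transitive_gset G X \<longleftrightarrow> finite_gset G X \<and> fst X \<noteq> {} \<and>
    (\<forall>x \<in> fst X. \<forall>y \<in> fst X. \<exists>g \<in> carrier G. snd X g x = y)"

definition gset_map :: "('g, 'm) monoid_scheme \<Rightarrow> ('g, 'x) gset \<Rightarrow> ('g, 'y) gset \<Rightarrow> ('x \<Rightarrow> 'y) \<Rightarrow> bool" where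
  "gset_map G X Y p \<longleftrightarrow> (\<forall>x \<in> fst X. p x \<in> fst Y) \<and>
    (\<forall>g \<in> carrier G. \<forall>x \<in> fst X. p (snd X g x) = snd Y g (p x))"

definition regular_gset :: "('g, 'm) monoid_scheme \<Rightarrow> ('g, 'g) gset" where
  "regular_gset G = (carrier G, \<lambda>g. \<lambda>x \<in> carrier G. g \<otimes>\<^bsub>G\<^esub> x)"

abbreviation stab where "stab G X \<equiv> stabilizer G (snd X)"

lemma gset_iso_card: "gset_iso G X Y \<Longrightarrow> card (fst X) = card (fst Y)"
  unfolding gset_iso_def using bij_betw_same_card by blast

lemma free_points_iso:
  assumes "gset_iso G X Y" and cl: "\<And>g x. g \<in> carrier G \<Longrightarrow> x \<in> fst X \<Longrightarrow> snd X g x \<in> fst X"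
  shows "card (free_points G X) = card (free_points G Y)"
  using assms(1)
proof (cases rule: gset_isoE)
  case (1 f f')
  have "f x \<in> free_points G Y" if "x \<in> free_points G X" for x
  proof -
    have x: "x \<in> fst X" using that by (simp add: free_points_def)
    have "g = \<one>\<^bsub>G\<^esub>" if g: "g \<in> carrier G" "snd Y g (f x) = f x" for g
    proof -
      have "f (snd X g x) = f x" using 1(5)[OF g(1) x] g(2) by simp
      then have "snd X g x = x" using 1(3) x cl[OF g(1) x] by metis
      then show ?thesis using \<open>x \<in> free_points G X\<close> g(1) by (simp add: free_points_def)
    qed
    then show ?thesis using 1(1)[OF x] by (simp add: free_points_def)
  qed
  moreover have "f' y \<in> free_points G X" if "y \<in> free_points G Y" for y
  proof -
    have y: "y \<in> fst Y" "f' y \<in> fst X" using that 1(2) by (auto simp: free_points_def)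
    have "g = \<one>\<^bsub>G\<^esub>" if g: "g \<in> carrier G" "snd X g (f' y) = f' y" for g
    proof -
      have "snd Y g y = y" using 1(5)[OF g(1) y(2)] 1(4)[OF y(1)] g(2) by simp
      then show ?thesis using \<open>y \<in> free_points G Y\<close> g(1) by (simp add: free_points_def)
    qed
    then show ?thesis using y(2) by (simp add: free_points_def)
  qed
  ultimately have "f ` free_points G X \<subseteq> free_points G Y" "f' ` free_points G Y \<subseteq> free_points G X"
    by blast+
  then have "bij_betw f (free_points G X) (free_points G Y)"
    using 1(3,4) by (intro bij_betw_byWitness[of _ f']) (simp_all add: free_points_def)
  then show ?thesis by (rule bij_betw_same_card)
qed

lemma free_points_sum:
  "free_points G (gset_sum X Y) = Inl ` free_points G X \<union> Inr ` free_points G Y"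
proof (rule Set.set_eqI)
  show "z \<in> free_points G (gset_sum X Y) \<longleftrightarrow> z \<in> Inl ` free_points G X \<union> Inr ` free_points G Y" for z
    by (cases z) (simp_all add: free_points_def gset_sum_def image_iff Plus_def cong: conj_cong)
qed

locale finite_group = group G for G (structure) +
  assumes finite_carrier: "finite (carrier G)"
begin

lemma order_pos: "order G > 0"
  using finite_carrier one_closed by (auto simp: order_def card_gt_0_iff)

lemma gset_action: "finite_gset G X \<Longrightarrow> group_action G (fst X) (snd X)"
  by (simp add: finite_gset_def)

text \<open>Comparing two translates becomes a condition on one group element; in this form
  equalities turn into statements about stabilizers.\<close>

lemma gset_cancel:
  assumes "finite_gset G X" "g \<in> carrier G" "h \<in> carrier G" "x \<in> fst X" "y \<in> fst X"
  shows "snd X g x = snd X h y \<longleftrightarrow> snd X (inv h \<otimes> g) x = y"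
  using assms gset_mult[OF assms(1)] gset_inv[OF assms(1)] gset_closed[OF assms(1)] inv_closed by metis

lemma orbit_invariant:
  assumes "finite_gset G X" "x \<in> fst X"
  shows "orbit G (snd X) x \<subseteq> fst X" "x \<in> orbit G (snd X) x"
    "\<And>g y. g \<in> carrier G \<Longrightarrow> y \<in> orbit G (snd X) x \<Longrightarrow> snd X g y \<in> orbit G (snd X) x"
proof -
  show "orbit G (snd X) x \<subseteq> fst X" using assms gset_closed[OF assms(1)] by (auto simp: orbit_def)
  show "x \<in> orbit G (snd X) x" using gset_one[OF assms] one_closed unfolding orbit_def by force
  show "snd X g y \<in> orbit G (snd X) x" if gy: "g \<in> carrier G" "y \<in> orbit G (snd X) x" for g y
  proof -
    obtain h where h: "h \<in> carrier G" "y = snd X h x" using gy(2) by (auto simp: orbit_def)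
    then have "snd X g y = snd X (g \<otimes> h) x" using gset_mult[OF assms(1) gy(1) _ assms(2)] by simp
    then show ?thesis using h gy(1) unfolding orbit_def by blast
  qed
qed

lemma finite_gset_restrict:
  assumes "finite_gset G X" "Q \<subseteq> fst X"
    "\<And>g x. g \<in> carrier G \<Longrightarrow> x \<in> Q \<Longrightarrow> snd X g x \<in> Q"
  shows "finite_gset G (restrict_gset X Q)"
  unfolding finite_gset_iff restrict_gset_def
  using assms gset_one[OF assms(1)] gset_mult[OF assms(1)] finite_subset[OF assms(2) gset_finite[OF assms(1)]]
  by (auto simp: subset_iff)

lemma complement_invariant:
  assumes "finite_gset G X" "\<And>g x. g \<in> carrier G \<Longrightarrow> x \<in> Q \<Longrightarrow> snd X g x \<in> Q"
    and "g \<in> carrier G" "x \<in> fst X - Q"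
  shows "snd X g x \<in> fst X - Q"
proof -
  have "snd X (inv g) (snd X g x) \<in> Q" if "snd X g x \<in> Q"
    by (rule assms(2)[OF inv_closed[OF assms(3)] that])
  then show ?thesis
    using gset_inv(1)[OF assms(1,3)] gset_closed[OF assms(1,3)] assms(4) by auto
qed

text \<open>Used to peel off one orbit at a time in the induction over G-sets.\<close>

lemma gset_iso_split:
  assumes "finite_gset G X" "Q \<subseteq> fst X" "\<And>g x. g \<in> carrier G \<Longrightarrow> x \<in> Q \<Longrightarrow> snd X g x \<in> Q"
  shows "gset_iso G (gset_sum (restrict_gset X Q) (restrict_gset X (fst X - Q))) X"
  by (rule gset_isoI[of _ "case_sum id id" _ "\<lambda>x. if x \<in> Q then Inl x else Inr x"])
    (use assms complement_invariant[OF assms(1,3)] in \<open>auto simp: gset_sum_def restrict_gset_def\<close>)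

section \<open>Transitive G-sets, their maps and their stabilizers\<close>

lemma transitive_orbit:
  assumes "finite_gset G X" "x \<in> fst X"
  shows "transitive_gset G (restrict_gset X (orbit G (snd X) x))"
  unfolding transitive_gset_def
proof (intro conjI ballI)
  let ?Q = "orbit G (snd X) x"
  note Q = orbit_invariant[OF assms]
  show "finite_gset G (restrict_gset X ?Q)" by (rule finite_gset_restrict[OF assms(1) Q(1,3)])
  show "fst (restrict_gset X ?Q) \<noteq> {}" using Q(2) by (auto simp: restrict_gset_def)
  fix y z assume "y \<in> fst (restrict_gset X ?Q)" "z \<in> fst (restrict_gset X ?Q)"
  then have yz: "y \<in> ?Q" "z \<in> ?Q" by (auto simp: restrict_gset_def)
  then obtain g h where "g \<in> carrier G" "h \<in> carrier G" "y = snd X g x" "z = snd X h x"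
    unfolding orbit_def by blast
  then have "snd X (h \<otimes> inv g) y = z" "h \<otimes> inv g \<in> carrier G"
    using gset_mult[OF assms(1), of h "inv g"] gset_inv[OF assms(1)] gset_closed[OF assms(1)] assms(2) by auto
  then show "\<exists>g \<in> carrier G. snd (restrict_gset X ?Q) g y = z"
    using yz by (auto simp: restrict_gset_def)
qed

text \<open>The image of a nonempty G-set is invariant and nonempty, so it is all of a transitive
  target. This bounds the size of an orbit over X from below.\<close>

lemma transitive_map_surj:
  assumes "finite_gset G Z" "fst Z \<noteq> {}" "transitive_gset G X" "gset_map G Z X p"
  shows "p ` fst Z = fst X"
proof
  show "p ` fst Z \<subseteq> fst X" using assms(4) by (auto simp: gset_map_def)
  obtain z where z: "z \<in> fst Z" using assms(2) by blast
  show "fst X \<subseteq> p ` fst Z"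
  proof
    fix x assume "x \<in> fst X"
    then obtain g where "g \<in> carrier G" "snd X g (p z) = x"
      using assms(3,4) z unfolding transitive_gset_def gset_map_def by blast
    then have "x = p (snd Z g z)" "snd Z g z \<in> fst Z"
      using assms(4) z gset_closed[OF assms(1)] by (auto simp: gset_map_def)
    then show "x \<in> p ` fst Z" by blast
  qed
qed

text \<open>If p (g z) = p (h z), then h^-1 g fixes p z, hence also z by the inclusion of
  stabilizers, so g z = h z. Surjectivity is automatic.\<close>

lemma transitive_map_iso:
  assumes "transitive_gset G Z" "transitive_gset G X" "gset_map G Z X p"
    and "z \<in> fst Z" "stab G X (p z) \<subseteq> stab G Z z"
  shows "gset_iso G Z X"
proof -
  have fin: "finite_gset G Z" "finite_gset G X" and pz: "p z \<in> fst X"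
    using assms by (auto simp: transitive_gset_def gset_map_def)
  have "inj_on p (fst Z)"
  proof (rule inj_onI)
    fix u v assume uv: "u \<in> fst Z" "v \<in> fst Z" "p u = p v"
    then obtain g h where g: "g \<in> carrier G" "h \<in> carrier G" "snd Z g z = u" "snd Z h z = v"
      using assms(1,4) unfolding transitive_gset_def by metis
    then have "snd X g (p z) = snd X h (p z)"
      using uv assms(3,4) by (auto simp: gset_map_def)
    then have "inv h \<otimes> g \<in> stab G X (p z)"
      using gset_cancel[OF fin(2) g(1,2) pz pz] g by (simp add: stabilizer_def)
    then have "snd Z (inv h \<otimes> g) z = z" using assms(5) by (auto simp: stabilizer_def)
    then show "u = v" using gset_cancel[OF fin(1) g(1,2) assms(4,4)] g by simp
  qed
  moreover have "p ` fst Z = fst X"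
    using transitive_map_surj[OF fin(1) _ assms(2,3)] assms(4) by blast
  ultimately show ?thesis
    using assms(3) unfolding gset_iso_def gset_map_def bij_betw_def by blast
qed

text \<open>In place of a coset space the orbit of (x, y) in X \<times> Y serves as common model:
  the stabilizer of (x, y) is the common stabilizer, so both projections from this orbit are
  isomorphisms.\<close>

lemma transitive_stab_iso:
  assumes X: "transitive_gset G X" and Y: "transitive_gset G Y"
    and xy: "x \<in> fst X" "y \<in> fst Y" "stab G X x = stab G Y y"
  shows "gset_iso G X Y"
proof -
  have fin: "finite_gset G X" "finite_gset G Y" using X Y by (auto simp: transitive_gset_def)
  let ?P = "gset_prod X Y"
  let ?Q = "restrict_gset ?P (orbit G (snd ?P) (x, y))"
  have P: "finite_gset G ?P" "(x, y) \<in> fst ?P" using xy finite_gset_prod[OF fin] by (auto simp: gset_prod_def)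
  have Q: "transitive_gset G ?Q" by (rule transitive_orbit[OF P])
  note inv = orbit_invariant[OF P]
  have z: "(x, y) \<in> fst ?Q" using inv by (simp add: restrict_gset_def)
  have st: "stab G ?Q (x, y) = stab G X x"
    using xy inv(2) by (auto simp: stabilizer_def restrict_gset_def gset_prod_def)
  have "gset_map G ?Q X fst" "gset_map G ?Q Y snd"
    using inv(1) by (auto simp: gset_map_def restrict_gset_def gset_prod_def)
  then have 1: "gset_iso G ?Q X" "gset_iso G ?Q Y"
    using transitive_map_iso[OF Q X _ z] transitive_map_iso[OF Q Y _ z] st xy(3) by auto
  have "finite_gset G ?Q" using Q by (simp add: transitive_gset_def)
  from gset_iso_trans[OF gset_iso_sym[OF this 1(1)] 1(2)] show ?thesis .
qed

lemma transitive_iso: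
  assumes "transitive_gset G X" "gset_iso G X Y" "finite_gset G Y"
  shows "transitive_gset G Y"
  using assms(2)
proof (cases rule: gset_isoE)
  case (1 f f')
  have "\<exists>g \<in> carrier G. snd Y g y = z" if "y \<in> fst Y" "z \<in> fst Y" for y z
  proof -
    obtain g where "g \<in> carrier G" "snd X g (f' y) = f' z"
      using assms(1) 1(2) \<open>y \<in> fst Y\<close> \<open>z \<in> fst Y\<close> unfolding transitive_gset_def by metis
    then show ?thesis using 1(5)[of g "f' y"] 1(2,4) that by auto
  qed
  moreover have "fst Y \<noteq> {}" using assms(1) 1(1) by (auto simp: transitive_gset_def)
  ultimately show ?thesis using assms(3) by (auto simp: transitive_gset_def)
qed

lemma transitive_card:
  assumes "transitive_gset G X" "x \<in> fst X"
  shows "card (fst X) * card (stab G X x) = order G"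
proof -
  have fin: "finite_gset G X" using assms by (simp add: transitive_gset_def)
  interpret group_action G "fst X" "snd X" by (rule gset_action[OF fin])
  have "y \<in> orbit G (snd X) x" if y: "y \<in> fst X" for y
  proof -
    obtain g where "g \<in> carrier G" "snd X g x = y"
      using assms y unfolding transitive_gset_def by blast
    then show ?thesis by (auto simp: orbit_def)
  qed
  then have "orbit G (snd X) x = fst X"
    using orbit_invariant(1)[OF fin assms(2)] by blast
  then show ?thesis using orbit_stabilizer_theorem[OF assms(2)] by simp
qed

text \<open>All stabilizers in X have |G| / |X| elements, so an inclusion between them is an
  equality and the sets \<open>M y\<close> partition X. Translations inject one block into another,
  so all blocks have the same size; it divides |X|, which divides |G|.\<close>

lemma transitive_fixed_dvd:
  assumes "transitive_gset G X" "x \<in> fst X"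
  shows "card {y \<in> fst X. stab G X x \<subseteq> stab G X y} dvd order G"
proof -
  have fin: "finite_gset G X" using assms by (simp add: transitive_gset_def)
  define M where "M x = {y \<in> fst X. stab G X x \<subseteq> stab G X y}" for x
  have finM: "finite (M y)" for y using gset_finite[OF fin] by (simp add: M_def)
  have M_eq: "M y = {z \<in> fst X. stab G X y = stab G X z}" if y: "y \<in> fst X" for y
  proof -
    have "stab G X y = stab G X z" if "z \<in> fst X" "stab G X y \<subseteq> stab G X z" for z
    proof (rule card_subset_eq[OF _ that(2)])
      show "finite (stab G X z)" using finite_carrier by (auto simp: stabilizer_def)
      have "card (fst X) * card (stab G X y) = card (fst X) * card (stab G X z)" "card (fst X) > 0"
        using transitive_card[OF assms(1) y] transitive_card[OF assms(1) that(1)]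
          gset_finite[OF fin] y by (auto simp: card_gt_0_iff)
      then show "card (stab G X y) = card (stab G X z)" by simp
    qed
    then show ?thesis by (auto simp: M_def)
  qed
  have le: "card (M y) \<le> card (M (snd X g y))" if g: "g \<in> carrier G" and y: "y \<in> fst X" for g y
  proof (rule card_inj_on_le)
    interpret group_action G "fst X" "snd X" by (rule gset_action[OF fin])
    show "inj_on (snd X g) (M y)" by (rule inj_on_subset[OF inj_prop[OF g]]) (simp add: M_def)
    show "snd X g ` M y \<subseteq> M (snd X g y)"
    proof clarify
      fix z assume "z \<in> M y"
      then have z: "z \<in> fst X" "stab G X y \<subseteq> stab G X z" by (auto simp: M_def)
      have "k \<in> stab G X (snd X g z)" if k: "k \<in> stab G X (snd X g y)" for k
      proof -
        have kc: "k \<in> carrier G" "snd X k (snd X g y) = snd X g y" using k by (auto simp: stabilizer_def)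
        \<comment> \<open>Stabilizers are conjugate along the orbit: \<open>k\<close> fixes g y
          exactly if its conjugate by \<open>inv g\<close> fixes y.\<close>
        then have "snd X (inv g \<otimes> (k \<otimes> g)) y = y"
          using gset_cancel[OF fin, of "k \<otimes> g" g y y] gset_mult[OF fin, of k g y] g y by simp
        then have "inv g \<otimes> (k \<otimes> g) \<in> stab G X y" using g kc by (simp add: stabilizer_def)
        then have "inv g \<otimes> (k \<otimes> g) \<in> stab G X z" using z(2) by blast
        then show ?thesis
          using gset_cancel[OF fin, of "k \<otimes> g" g z z] gset_mult[OF fin, of k g z] g z(1) kc
          by (simp add: stabilizer_def)
      qed
      then show "snd X g z \<in> M (snd X g y)" using gset_closed[OF fin g z(1)] by (auto simp: M_def)
    qed
  qed (rule finM)
  have eq: "card (M y) = card (M x)" if "y \<in> fst X" for y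
  proof -
    have *: "card (M u) \<le> card (M v)" if "u \<in> fst X" "v \<in> fst X" for u v
      using assms(1) le that unfolding transitive_gset_def by metis
    show ?thesis using *[OF that assms(2)] *[OF assms(2) that] by simp
  qed
  have "card (M x) * card (M ` fst X) = card (\<Union> (M ` fst X))"
  proof (rule card_partition)
    show "c \<inter> d = {}" if "c \<in> M ` fst X" "d \<in> M ` fst X" "c \<noteq> d" for c d
      using that M_eq by auto
  qed (use gset_finite[OF fin] finM eq in auto)
  also have "\<Union> (M ` fst X) = fst X" by (auto simp: M_def)
  finally have "card (M x) dvd card (fst X)" by (metis dvd_triv_left)
  also have "card (fst X) dvd order G" using transitive_card[OF assms] by (metis dvd_triv_left)
  finally show ?thesis by (simp add: M_def)
qed

text \<open>The free points form an invariant subset, and by the orbit-stabilizer theorem it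
  decomposes into orbits with |G| points each.\<close>

lemma free_points_dvd:
  assumes "finite_gset G X" shows "order G dvd card (free_points G X)"
proof -
  interpret group_action G "fst X" "snd X" by (rule gset_action[OF assms])
  let ?C = "orbit G (snd X) ` free_points G X"
  have sub: "free_points G X \<subseteq> fst X" by (auto simp: free_points_def)
  have un: "\<Union> ?C = free_points G X"
  proof
    show "free_points G X \<subseteq> \<Union> ?C" using orbit_invariant(2)[OF assms] sub by blast
    have "snd X g x \<in> free_points G X" if "x \<in> free_points G X" "g \<in> carrier G" for g x
    proof -
      have x: "x \<in> fst X" using that sub by blast
      have "h = \<one>" if h: "h \<in> carrier G" "snd X h (snd X g x) = snd X g x" for h
      proof -
        \<comment> \<open>Freeness passes along an orbit by conjugation.\<close>
        have "snd X (inv g \<otimes> (h \<otimes> g)) x = x"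
          using gset_cancel[OF assms, of "h \<otimes> g" g x x] gset_mult[OF assms, of h g x] h \<open>g \<in> carrier G\<close> x by simp
        then have "inv g \<otimes> (h \<otimes> g) = \<one>"
          using \<open>x \<in> free_points G X\<close> h \<open>g \<in> carrier G\<close> by (auto simp: free_points_def)
        then show ?thesis using h \<open>g \<in> carrier G\<close>
          by (metis inv_closed inv_inv inv_equality l_cancel_one m_closed r_cancel_one' inv_comm)
      qed
      then show ?thesis using gset_closed[OF assms \<open>g \<in> carrier G\<close> x] by (auto simp: free_points_def)
    qed
    then show "\<Union> ?C \<subseteq> free_points G X" by (auto simp: orbit_def)
  qed
  have fin: "finite (free_points G X)" using sub gset_finite[OF assms] finite_subset by blast
  have "order G * card ?C = card (\<Union> ?C)"
  proof (rule card_partition)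
    show "card c = order G" if c: "c \<in> ?C" for c
    proof -
      obtain x where x: "x \<in> free_points G X" "c = orbit G (snd X) x" using c by blast
      have "stabilizer G (snd X) x = {\<one>}"
        using x(1) gset_one[OF assms] sub by (auto simp: stabilizer_def free_points_def)
      then show ?thesis using orbit_stabilizer_theorem[of x] x sub by auto
    qed
    show "c \<inter> d = {}" if "c \<in> ?C" "d \<in> ?C" "c \<noteq> d" for c d
      using disjoint_union[of c d] that sub unfolding orbits_def by blast
  qed (use fin un in auto)
  then show ?thesis using un by (metis dvd_triv_left)
qed

lemma finite_regular_gset: "finite_gset G (regular_gset G)"
  by (subst finite_gset_iff) (auto simp: regular_gset_def finite_carrier m_assoc)

text \<open>Every point (h, y) is free, since g h = h forces g = 1. Divided by |G|, this count is
  the source of the rule p(x a) = q(a).\<close>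

lemma free_points_regular_prod:
  "finite_gset G Y \<Longrightarrow> card (free_points G (gset_prod (regular_gset G) Y)) = order G * card (fst Y)"
proof -
  have "free_points G (gset_prod (regular_gset G) Y) = carrier G \<times> fst Y"
    by (auto simp: free_points_def gset_prod_def regular_gset_def r_cancel_one)
  then show ?thesis by (simp add: order_def card_cartesian_product)
qed

end

section \<open>The Burnside ring\<close>

lemma add_pow_int_0: "[(0 :: int)] \<cdot>\<^bsub>R\<^esub> x = \<zero>\<^bsub>R\<^esub>"
  by (simp add: add_pow_def)

locale burnside = finite_group
begin

sublocale S: comm_semiring \<S> by (rule comm_semiring_gset)

abbreviation "B \<equiv> burnside_ring G"

lemma B_eq: "B = S.\<G>" by (simp add: burnside_ring_def)

sublocale B: cring B unfolding B_eq by (rule S.cring_grothendieck)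

definition burnside_elem where "burnside_elem X = S.difference (gset_class G X) \<zero>\<^bsub>\<S>\<^esub>"

lemma burnside_elem_closed [simp]: "finite_gset G X \<Longrightarrow> burnside_elem X \<in> carrier B"
  by (simp add: burnside_elem_def B_eq gset_class_closed)

lemma burnside_elem_cong: "finite_gset G X \<Longrightarrow> gset_iso G X Y \<Longrightarrow> burnside_elem X = burnside_elem Y"
  by (simp add: burnside_elem_def gset_class_eq)

lemma burnside_elem_sum: "finite_gset G X \<Longrightarrow> finite_gset G Y \<Longrightarrow> burnside_elem (gset_sum X Y) = burnside_elem X \<oplus>\<^bsub>B\<^esub> burnside_elem Y"
  by (simp add: burnside_elem_def B_eq gset_class_closed S.difference_add gset_class_sum finite_gset_sum)

lemma burnside_elem_prod: "finite_gset G X \<Longrightarrow> finite_gset G Y \<Longrightarrow> burnside_elem (gset_prod X Y) = burnside_elem X \<otimes>\<^bsub>B\<^esub> burnside_elem Y"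
  by (simp add: burnside_elem_def B_eq gset_class_closed S.difference_mult gset_class_prod finite_gset_prod)

lemma burnside_elem_one: "burnside_elem (trivial_gset {()}) = \<one>\<^bsub>B\<^esub>"
  by (simp add: burnside_elem_def B_eq S.one_G gset_class_one)

lemma burnside_elem_empty: "finite_gset G X \<Longrightarrow> fst X = {} \<Longrightarrow> burnside_elem X = \<zero>\<^bsub>B\<^esub>"
proof -
  assume X: "finite_gset G X" "fst X = {}"
  have "gset_iso G X (trivial_gset ({} :: unit set))"
    by (rule gset_isoI[of _ undefined _ undefined]) (use X in \<open>auto simp: trivial_gset_def\<close>)
  then show ?thesis using X by (simp add: burnside_elem_def B_eq S.zero_G gset_class_zero gset_class_eq)
qed

lemma B_cases:
  assumes "b \<in> carrier B"
  obtains X Y :: "('a, nat) gset" where "finite_gset G X" "finite_gset G Y" "b = burnside_elem X \<ominus>\<^bsub>B\<^esub> burnside_elem Y"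
proof -
  obtain U V where UV: "U \<in> carrier \<S>" "V \<in> carrier \<S>" "b = S.difference U V"
    using assms unfolding B_eq by (rule S.carrier_G_cases)
  obtain X Y :: "('a, nat) gset" where "finite_gset G X" "U = gset_class G X"
    "finite_gset G Y" "V = gset_class G Y"
    using UV(1,2) by (metis gset_class_cases)
  then show thesis
    using that[of X Y] UV S.difference_eq_minus[of U V] by (simp add: burnside_elem_def B_eq)
qed

text \<open>An additive isomorphism invariant factors through the semiring of classes and then
  through its Grothendieck ring. The sum of two G-sets on natural numbers lives on
  \<open>nat + nat\<close>, so additivity is phrased with a copy Z of it on natural numbers.\<close>

lemma B_extend:
  fixes n :: "('a, nat) gset \<Rightarrow> int"
  assumes inv: "\<And>X Y. finite_gset G X \<Longrightarrow> gset_iso G X Y \<Longrightarrow> n X = n Y"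
    and add: "\<And>X Y Z. finite_gset G X \<Longrightarrow> finite_gset G Y \<Longrightarrow> gset_iso G (gset_sum X Y) Z \<Longrightarrow> n Z = n X + n Y"
  obtains H where "\<And>X :: ('a, nat) gset. finite_gset G X \<Longrightarrow> H (burnside_elem X) = n X"
    "\<And>x y. x \<in> carrier B \<Longrightarrow> y \<in> carrier B \<Longrightarrow> H (x \<oplus>\<^bsub>B\<^esub> y) = H x + H y"
proof -
  define h where "h U = n (SOME X. X \<in> U)" for U
  have h: "h (gset_class G X) = n X" if "finite_gset G X" for X
  proof -
    have "(SOME Y. Y \<in> gset_class G X) \<in> gset_class G X"
      using gset_class_nonempty[OF that] by (rule some_in_eq[THEN iffD2])
    then have "gset_iso G X (SOME Y. Y \<in> gset_class G X)" by (simp add: gset_class_def)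
    then show ?thesis using inv[OF that] by (simp add: h_def)
  qed
  have h_add: "h (U \<oplus>\<^bsub>\<S>\<^esub> V) = h U + h V" if UV: "U \<in> carrier \<S>" "V \<in> carrier \<S>" for U V
  proof -
    obtain X Y :: "('a, nat) gset" where XY: "finite_gset G X" "U = gset_class G X"
      "finite_gset G Y" "V = gset_class G Y"
      using UV by (metis gset_class_cases)
    obtain Z :: "('a, nat) gset" where Z: "finite_gset G Z" "gset_iso G (gset_sum X Y) Z"
      using gset_representative[OF finite_gset_sum[OF XY(1,3)]] .
    have "U \<oplus>\<^bsub>\<S>\<^esub> V = gset_class G Z"
      using XY gset_class_sum[OF XY(1,3)] gset_class_eq[OF finite_gset_sum[OF XY(1,3)] Z(2)] by simp
    then show ?thesis using h[OF Z(1)] h[OF XY(1)] h[OF XY(3)] add[OF XY(1,3) Z(2)] XY by simp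
  qed
  obtain H where H: "\<And>a b. a \<in> carrier \<S> \<Longrightarrow> b \<in> carrier \<S> \<Longrightarrow> H (S.difference a b) = h a - h b"
    "\<And>x y. x \<in> carrier S.\<G> \<Longrightarrow> y \<in> carrier S.\<G> \<Longrightarrow> H (x \<oplus>\<^bsub>S.\<G>\<^esub> y) = H x + H y"
    using S.grothendieck_extend[of h] h_add by blast
  have "h \<zero>\<^bsub>\<S>\<^esub> = 0" using h_add[of "\<zero>\<^bsub>\<S>\<^esub>" "\<zero>\<^bsub>\<S>\<^esub>"] by simp
  then have "H (burnside_elem X) = n X" if "finite_gset G X" for X :: "('a, nat) gset"
    using H(1)[OF gset_class_closed[OF that] S.zero_closed] h[OF that] by (simp add: burnside_elem_def)
  then show thesis using that[of H] H(2) by (simp add: B_eq)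
qed

section \<open>Counting points and free orbits\<close>

lemma additive_minus:
  fixes H :: "_ \<Rightarrow> int"
  assumes "\<And>x y. x \<in> carrier B \<Longrightarrow> y \<in> carrier B \<Longrightarrow> H (x \<oplus>\<^bsub>B\<^esub> y) = H x + H y"
    and "x \<in> carrier B" "y \<in> carrier B"
  shows "H (x \<ominus>\<^bsub>B\<^esub> y) = H x - H y"
proof -
  have "(x \<ominus>\<^bsub>B\<^esub> y) \<oplus>\<^bsub>B\<^esub> y = x" using assms(2,3) by (simp add: B.minus_eq B.a_assoc B.l_neg)
  then show ?thesis using assms(1)[of "x \<ominus>\<^bsub>B\<^esub> y" y] assms(2,3) by simp
qed

text \<open>The mark at the trivial subgroup, that is, restriction of G-sets to the trivial group.
  Choice turns the map supplied by \<open>B_extend\<close> into a constant that later statements can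
  name.\<close>

definition point_count :: "_ \<Rightarrow> int" where
  "point_count = (SOME H. (\<forall>X :: ('a, nat) gset. finite_gset G X \<longrightarrow> H (burnside_elem X) = int (card (fst X))) \<and>
    (\<forall>x \<in> carrier B. \<forall>y \<in> carrier B. H (x \<oplus>\<^bsub>B\<^esub> y) = H x + H y))"

lemma point_count_props:
  "\<forall>X :: ('a, nat) gset. finite_gset G X \<longrightarrow> point_count (burnside_elem X) = int (card (fst X))"
  "\<forall>x \<in> carrier B. \<forall>y \<in> carrier B. point_count (x \<oplus>\<^bsub>B\<^esub> y) = point_count x + point_count y"
proof -
  have inv: "int (card (fst X)) = int (card (fst Y))" if "finite_gset G X" "gset_iso G X Y" for X Y :: "('a, nat) gset"
    using gset_iso_card[OF that(2)] by simp
  have add: "int (card (fst Z)) = int (card (fst X)) + int (card (fst Y))"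
    if "finite_gset G X" "finite_gset G Y" "gset_iso G (gset_sum X Y) Z" for X Y Z :: "('a, nat) gset"
    using gset_iso_card[OF that(3)] gset_finite[OF that(1)] gset_finite[OF that(2)]
    by (simp add: gset_sum_def card_Plus)
  obtain H where "\<And>X :: ('a, nat) gset. finite_gset G X \<Longrightarrow> H (burnside_elem X) = int (card (fst X))"
    "\<And>x y. x \<in> carrier B \<Longrightarrow> y \<in> carrier B \<Longrightarrow> H (x \<oplus>\<^bsub>B\<^esub> y) = H x + H y"
    using B_extend[of "\<lambda>X. int (card (fst X))", OF inv add] by blast
  then have "\<exists>H. (\<forall>X :: ('a, nat) gset. finite_gset G X \<longrightarrow> H (burnside_elem X) = int (card (fst X))) \<and>
    (\<forall>x \<in> carrier B. \<forall>y \<in> carrier B. H (x \<oplus>\<^bsub>B\<^esub> y) = H x + H y)" by blast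
  from someI_ex[OF this] show
    "\<forall>X :: ('a, nat) gset. finite_gset G X \<longrightarrow> point_count (burnside_elem X) = int (card (fst X))"
    "\<forall>x \<in> carrier B. \<forall>y \<in> carrier B. point_count (x \<oplus>\<^bsub>B\<^esub> y) = point_count x + point_count y"
    unfolding point_count_def by blast+
qed

text \<open>Passes from points in \<open>nat\<close> to all point types: the unit element comes from
  a set over \<open>unit\<close>, the regular set from one over the group.\<close>

lemma point_count_brk: assumes "finite_gset G X" shows "point_count (burnside_elem X) = int (card (fst X))"
proof -
  obtain Z :: "('a, nat) gset" where "finite_gset G Z" "gset_iso G X Z"
    using gset_representative[OF assms] .
  then show ?thesis using point_count_props(1) burnside_elem_cong[OF assms] gset_iso_card by metis
qed

lemma point_count_add: "x \<in> carrier B \<Longrightarrow> y \<in> carrier B \<Longrightarrow> point_count (x \<oplus>\<^bsub>B\<^esub> y) = point_count x + point_count y"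
  using point_count_props(2) by blast

lemma point_count_one: "point_count \<one>\<^bsub>B\<^esub> = 1"
  using point_count_brk[OF finite_gset_trivial[of "{()}"]] unfolding burnside_elem_one by (simp add: trivial_gset_def)

text \<open>Cardinality is multiplicative on products of G-sets; formal differences are then treated
  one factor at a time.\<close>

lemma point_count_mult:
  assumes "x \<in> carrier B" "y \<in> carrier B" shows "point_count (x \<otimes>\<^bsub>B\<^esub> y) = point_count x * point_count y"
proof -
  note minus = additive_minus[of point_count, OF point_count_add]
  have burnside_elem: "point_count (burnside_elem X \<otimes>\<^bsub>B\<^esub> burnside_elem Y) = point_count (burnside_elem X) * point_count (burnside_elem Y)"
    if "finite_gset G X" "finite_gset G Y" for X Y :: "('a, nat) gset"
    using point_count_brk[OF finite_gset_prod[OF that]] that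
    by (simp add: burnside_elem_prod point_count_brk) (simp add: gset_prod_def card_cartesian_product)
  obtain X X' :: "('a, nat) gset" where X: "finite_gset G X" "finite_gset G X'" "x = burnside_elem X \<ominus>\<^bsub>B\<^esub> burnside_elem X'"
    using assms(1) by (rule B_cases)
  obtain Y Y' :: "('a, nat) gset" where Y: "finite_gset G Y" "finite_gset G Y'" "y = burnside_elem Y \<ominus>\<^bsub>B\<^esub> burnside_elem Y'"
    using assms(2) by (rule B_cases)
  have l: "point_count (x \<otimes>\<^bsub>B\<^esub> burnside_elem Z) = point_count x * point_count (burnside_elem Z)" if "finite_gset G Z" for Z :: "('a, nat) gset"
  proof -
    have "x \<otimes>\<^bsub>B\<^esub> burnside_elem Z = burnside_elem X \<otimes>\<^bsub>B\<^esub> burnside_elem Z \<ominus>\<^bsub>B\<^esub> burnside_elem X' \<otimes>\<^bsub>B\<^esub> burnside_elem Z"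
      using X that by (simp add: B.minus_eq B.l_distr B.l_minus)
    then show ?thesis using X that by (simp add: minus burnside_elem left_diff_distrib)
  qed
  have "x \<otimes>\<^bsub>B\<^esub> y = x \<otimes>\<^bsub>B\<^esub> burnside_elem Y \<ominus>\<^bsub>B\<^esub> x \<otimes>\<^bsub>B\<^esub> burnside_elem Y'"
    using assms(1) Y by (simp add: B.minus_eq B.r_distr B.r_minus)
  then show ?thesis using assms(1) Y by (simp add: minus l right_diff_distrib)
qed

text \<open>H counts free orbits. The division by |G| is exact by \<open>free_points_dvd\<close> and
  so respects sums; on the product of the regular set with Y it removes the factor |G| and leaves
  |Y|.\<close>

lemma free_orbits_hom:
  obtains H :: "_ \<Rightarrow> int" where
    "\<And>x y. x \<in> carrier B \<Longrightarrow> y \<in> carrier B \<Longrightarrow> H (x \<oplus>\<^bsub>B\<^esub> y) = H x + H y"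
    "\<And>b. b \<in> carrier B \<Longrightarrow> H (burnside_elem (regular_gset G) \<otimes>\<^bsub>B\<^esub> b) = point_count b"
proof -
  let ?n = "\<lambda>X :: ('a, nat) gset. int (card (free_points G X) div order G)"
  note iso = free_points_iso[OF _ gset_closed]
  have inv: "?n X = ?n Y" if "finite_gset G X" "gset_iso G X Y" for X Y
    using iso[OF that(2,1)] by simp
  have add: "?n Z = ?n X + ?n Y"
    if "finite_gset G X" "finite_gset G Y" "gset_iso G (gset_sum X Y) Z" for X Y Z
  proof -
    have "finite (free_points G X)" "finite (free_points G Y)"
      using gset_finite[OF that(1)] gset_finite[OF that(2)] by (auto simp: free_points_def)
    then have "card (free_points G (gset_sum X Y)) = card (free_points G X) + card (free_points G Y)"
      unfolding free_points_sum by (subst card_Un_disjoint) (auto simp: card_image)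
    then show ?thesis
      using iso[OF that(3) finite_gset_sum[OF that(1,2)]] free_points_dvd[OF that(1)]
      by (simp add: div_plus_div_distrib_dvd_left)
  qed
  obtain H where H: "\<And>X :: ('a, nat) gset. finite_gset G X \<Longrightarrow> H (burnside_elem X) = ?n X"
    "\<And>x y. x \<in> carrier B \<Longrightarrow> y \<in> carrier B \<Longrightarrow> H (x \<oplus>\<^bsub>B\<^esub> y) = H x + H y"
    using B_extend[of ?n, OF inv add] by blast
  let ?r = "burnside_elem (regular_gset G)"
  have r: "?r \<in> carrier B" using finite_regular_gset by simp
  have H_reg: "H (?r \<otimes>\<^bsub>B\<^esub> burnside_elem Y) = point_count (burnside_elem Y)" if Y: "finite_gset G Y" for Y :: "('a, nat) gset"
  proof -
    note P = finite_gset_prod[OF finite_regular_gset Y]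
    obtain Z :: "('a, nat) gset" where Z: "finite_gset G Z" "gset_iso G (gset_prod (regular_gset G) Y) Z"
      using gset_representative[OF P] .
    have "?r \<otimes>\<^bsub>B\<^esub> burnside_elem Y = burnside_elem Z"
      using burnside_elem_prod[OF finite_regular_gset Y] burnside_elem_cong[OF P Z(2)] by simp
    moreover have "card (free_points G Z) = order G * card (fst Y)"
      using iso[OF Z(2) P] free_points_regular_prod[OF Y] by simp
    ultimately show ?thesis using H(1)[OF Z(1)] point_count_brk[OF Y] order_pos by simp
  qed
  have "H (?r \<otimes>\<^bsub>B\<^esub> b) = point_count b" if b: "b \<in> carrier B" for b
  proof -
    obtain X Y :: "('a, nat) gset" where XY: "finite_gset G X" "finite_gset G Y" "b = burnside_elem X \<ominus>\<^bsub>B\<^esub> burnside_elem Y"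
      using b by (rule B_cases)
    have "?r \<otimes>\<^bsub>B\<^esub> b = ?r \<otimes>\<^bsub>B\<^esub> burnside_elem X \<ominus>\<^bsub>B\<^esub> ?r \<otimes>\<^bsub>B\<^esub> burnside_elem Y"
      using XY r by (simp add: B.minus_eq B.r_distr B.r_minus)
    then show ?thesis
      using XY r by (simp add: additive_minus[of H, OF H(2)] additive_minus[of point_count, OF point_count_add] H_reg)
  qed
  then show thesis using that H(2) by blast
qed

section \<open>Multiplication by the classes of transitive G-sets\<close>

definition transitive_classes where
  "transitive_classes = {burnside_elem X | X :: ('a, nat) gset. transitive_gset G X}"

text \<open>The error term of the triangular criterion. Sizes are read off from
  \<open>point_count\<close> because the generators are elements of B and no longer sets.\<close>

definition larger where
  "larger k = Idl\<^bsub>B\<^esub> {s \<in> transitive_classes. k < nat (point_count s)}"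

lemma transitive_classes_closed: "transitive_classes \<subseteq> carrier B"
  by (auto simp: transitive_classes_def transitive_gset_def)

lemma burnside_elem_transitive: "transitive_gset G X \<Longrightarrow> burnside_elem X \<in> transitive_classes"
proof -
  assume X: "transitive_gset G X"
  then have fin: "finite_gset G X" by (simp add: transitive_gset_def)
  obtain Z :: "('a, nat) gset" where Z: "finite_gset G Z" "gset_iso G X Z"
    using gset_representative[OF fin] .
  then show ?thesis
    using transitive_iso[OF X Z(2,1)] burnside_elem_cong[OF fin Z(2)] unfolding transitive_classes_def by blast
qed

text \<open>A transitive G-set is determined up to isomorphism by one point stabilizer, and a finite
  group has finitely many subsets.\<close>

lemma finite_transitive_classes: "finite transitive_classes"
proof -
  define rep where "rep K = (SOME X :: ('a, nat) gset. transitive_gset G X \<and> (\<exists>x \<in> fst X. stab G X x = K))" for K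
  have "transitive_classes \<subseteq> (\<lambda>K. burnside_elem (rep K)) ` Pow (carrier G)"
  proof
    fix s assume "s \<in> transitive_classes"
    then obtain X :: "('a, nat) gset" where X: "transitive_gset G X" "s = burnside_elem X"
      by (auto simp: transitive_classes_def)
    then obtain x where x: "x \<in> fst X" by (auto simp: transitive_gset_def)
    let ?K = "stab G X x"
    have "transitive_gset G (rep ?K) \<and> (\<exists>y \<in> fst (rep ?K). stab G (rep ?K) y = ?K)"
      unfolding rep_def by (rule someI[of _ X]) (use X x in auto)
    then obtain y where "y \<in> fst (rep ?K)" "stab G (rep ?K) y = ?K" "transitive_gset G (rep ?K)" by blast
    then have "gset_iso G X (rep ?K)" using transitive_stab_iso[OF X(1) _ x] by metis
    then have "s = burnside_elem (rep ?K)" using X burnside_elem_cong[of X] by (simp add: transitive_gset_def)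
    moreover have "?K \<in> Pow (carrier G)" by (auto simp: stabilizer_def)
    ultimately show "s \<in> (\<lambda>K. burnside_elem (rep K)) ` Pow (carrier G)" by blast
  qed
  then show ?thesis using finite_carrier by (auto intro: finite_subset)
qed

lemma larger_ideal: "ideal (larger k) B"
  unfolding larger_def by (rule B.genideal_ideal) (use transitive_classes_closed in auto)

lemma larger_self: "s \<in> transitive_classes \<Longrightarrow> k < nat (point_count s) \<Longrightarrow> s \<in> larger k"
  using B.genideal_self[of "{s \<in> transitive_classes. k < nat (point_count s)}"] transitive_classes_closed
  unfolding larger_def by blast

text \<open>
  The points of \<open>fiber_fixed Z p X x\<close> correspond to the orbits of Z that \<open>p\<close> maps bijectively onto
  the transitive set X: each such orbit meets the fiber over \<open>x\<close> in one point.
\<close>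

definition fiber_fixed where
  "fiber_fixed Z p X x = {z \<in> fst Z. p z = x \<and> stab G X x \<subseteq> stab G Z z}"

text \<open>Orbits of Z are removed one at a time. Each orbit C maps onto X, which rules out orbits
  smaller than X. If C is larger than X, its class lies in \<open>larger\<close>, and it contributes
  nothing to \<open>fiber_fixed\<close>, since a point there would make C isomorphic to X. Otherwise
  p is bijective on C, the classes agree and exactly one point is contributed.\<close>

lemma burnside_elem_over_transitive:
  assumes X: "transitive_gset G X" "x \<in> fst X"
  shows "finite_gset G Z \<Longrightarrow> gset_map G Z X p \<Longrightarrow>
    burnside_elem Z \<ominus>\<^bsub>B\<^esub> [int (card (fiber_fixed Z p X x))] \<cdot>\<^bsub>B\<^esub> burnside_elem X \<in> larger (card (fst X))"
proof (induction "card (fst Z)" arbitrary: Z rule: less_induct)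
  case less
  note Z = less.prems
  interpret J: ideal "larger (card (fst X))" B by (rule larger_ideal)
  have finX: "finite_gset G X" using X by (simp add: transitive_gset_def)
  show ?case
  proof (cases "fst Z = {}")
    case True
    then show ?thesis using Z finX J.zero_closed
      by (simp add: fiber_fixed_def burnside_elem_empty B.minus_eq add_pow_int_0)
  next
    case False
    then obtain z where z: "z \<in> fst Z" by blast
    define Q where "Q = orbit G (snd Z) z"
    note inv = orbit_invariant[OF Z(1) z, folded Q_def]
    define C where "C = restrict_gset Z Q"
    define W where "W = restrict_gset Z (fst Z - Q)"
    have C: "transitive_gset G C" unfolding C_def Q_def by (rule transitive_orbit[OF Z(1) z])
    then have finO: "finite_gset G C" by (simp add: transitive_gset_def)
    have finW: "finite_gset G W"
      unfolding W_def by (rule finite_gset_restrict[OF Z(1)])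
        (use complement_invariant[OF Z(1) inv(3)] in blast)+
    have fst: "fst C = Q" "fst W = fst Z - Q" by (simp_all add: C_def W_def restrict_gset_def)
    have maps: "gset_map G C X p" "gset_map G W X p"
      using Z(2) inv(1) by (auto simp: gset_map_def C_def W_def restrict_gset_def)
    have elem_Z: "burnside_elem Z = burnside_elem C \<oplus>\<^bsub>B\<^esub> burnside_elem W"
      using burnside_elem_cong[OF finite_gset_sum[OF finO finW] gset_iso_split[OF Z(1) inv(1,3), folded C_def W_def]]
        burnside_elem_sum[OF finO finW] by simp
    have "card (fst W) < card (fst Z)"
      unfolding fst by (rule psubset_card_mono[OF gset_finite[OF Z(1)]]) (use inv(1,2) in blast)
    then have IH: "burnside_elem W \<ominus>\<^bsub>B\<^esub> [int (card (fiber_fixed W p X x))] \<cdot>\<^bsub>B\<^esub> burnside_elem X \<in> larger (card (fst X))"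
      by (rule less.hyps[OF _ finW maps(2)])
    \<comment> \<open>Restricting the action does not change the stabilizer of a point, so the
      multiplicities add up over C and W.\<close>
    have "fiber_fixed Z p X x = fiber_fixed C p X x \<union> fiber_fixed W p X x"
      "fiber_fixed C p X x \<inter> fiber_fixed W p X x = {}"
      using inv(1) by (auto simp: fiber_fixed_def C_def W_def restrict_gset_def stabilizer_def)
    moreover have "finite (fiber_fixed C p X x)" "finite (fiber_fixed W p X x)"
      using gset_finite[OF finO] gset_finite[OF finW] by (auto simp: fiber_fixed_def)
    ultimately have card: "card (fiber_fixed Z p X x) = card (fiber_fixed C p X x) + card (fiber_fixed W p X x)"
      by (simp add: card_Un_disjoint)
    have surj: "p ` fst C = fst X"
      using transitive_map_surj[OF finO _ X(1) maps(1)] C by (auto simp: transitive_gset_def)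
    have orbit: "burnside_elem C \<ominus>\<^bsub>B\<^esub> [int (card (fiber_fixed C p X x))] \<cdot>\<^bsub>B\<^esub> burnside_elem X \<in> larger (card (fst X))"
    proof (cases "card (fst X) < card (fst C)")
      case True
      have "fiber_fixed C p X x = {}"
      proof (rule ccontr)
        assume "fiber_fixed C p X x \<noteq> {}"
        then obtain y where "y \<in> fst C" "p y = x" "stab G X x \<subseteq> stab G C y" by (auto simp: fiber_fixed_def)
        then have "gset_iso G C X" using transitive_map_iso[OF C X(1) maps(1)] by blast
        then show False using gset_iso_card True by fastforce
      qed
      then show ?thesis
        using larger_self[OF burnside_elem_transitive[OF C]] True finO finX by (simp add: point_count_brk B.minus_eq add_pow_int_0)
    next
      case False
      \<comment> \<open>A surjection onto X from a finite set with at most as many points is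
        injective.\<close>
      then have "inj_on p (fst C)"
        using surj gset_finite[OF finO] card_image_le[of "fst C" p] by (intro eq_card_imp_inj_on) auto
      then have bij: "bij_betw p (fst C) (fst X)" using surj by (simp add: bij_betw_def)
      then have iso: "gset_iso G C X" using maps(1) unfolding gset_iso_def gset_map_def by blast
      have "x \<in> p ` fst C" using surj X(2) by simp
      then obtain y where y: "y \<in> fst C" "p y = x" by auto
      have "stab G X x \<subseteq> stab G C y"
      proof
        fix g assume "g \<in> stab G X x"
        then have g: "g \<in> carrier G" "snd X g x = x" by (auto simp: stabilizer_def)
        then have "p (snd C g y) = p y" using maps(1) y by (auto simp: gset_map_def)
        then have "snd C g y = y"
          using \<open>inj_on p (fst C)\<close> gset_closed[OF finO g(1) y(1)] y(1) by (auto dest: inj_onD)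
        then show "g \<in> stab G C y" using g by (simp add: stabilizer_def)
      qed
      then have "fiber_fixed C p X x = {y}"
        using y \<open>inj_on p (fst C)\<close> by (auto simp: fiber_fixed_def dest: inj_onD)
      then show ?thesis
        using burnside_elem_cong[OF finO iso] finX J.zero_closed by (simp add: B.minus_eq B.r_neg)
    qed
    have "burnside_elem Z \<ominus>\<^bsub>B\<^esub> [int (card (fiber_fixed Z p X x))] \<cdot>\<^bsub>B\<^esub> burnside_elem X =
      (burnside_elem C \<ominus>\<^bsub>B\<^esub> [int (card (fiber_fixed C p X x))] \<cdot>\<^bsub>B\<^esub> burnside_elem X) \<oplus>\<^bsub>B\<^esub>
      (burnside_elem W \<ominus>\<^bsub>B\<^esub> [int (card (fiber_fixed W p X x))] \<cdot>\<^bsub>B\<^esub> burnside_elem X)"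
      unfolding card elem_Z using finO finW finX
      by (simp add: B.add.int_pow_mult B.minus_eq B.minus_add B.a_ac)
    also have "\<dots> \<in> larger (card (fst X))" using J.a_closed[OF orbit IH] .
    finally show ?thesis .
  qed
qed

text \<open>The projection Y \<times> X \<rightarrow> X is equivariant, and the stabilizer of x
  fixes (y, x) exactly if it fixes y. The multiplicity is thus the mark of Y at a point stabilizer
  of X.\<close>

lemma burnside_elem_prod_transitive:
  assumes X: "transitive_gset G X" "x \<in> fst X" and Y: "finite_gset G Y"
  shows "burnside_elem Y \<otimes>\<^bsub>B\<^esub> burnside_elem X \<ominus>\<^bsub>B\<^esub> [int (card {y \<in> fst Y. stab G X x \<subseteq> stab G Y y})] \<cdot>\<^bsub>B\<^esub> burnside_elem X
    \<in> larger (card (fst X))"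
proof -
  have finX: "finite_gset G X" using X by (simp add: transitive_gset_def)
  have "gset_map G (gset_prod Y X) X snd"
    by (auto simp: gset_map_def gset_prod_def)
  moreover have "fiber_fixed (gset_prod Y X) snd X x = {y \<in> fst Y. stab G X x \<subseteq> stab G Y y} \<times> {x}"
    using X(2) by (auto simp: fiber_fixed_def gset_prod_def stabilizer_def)
  ultimately show ?thesis
    using burnside_elem_over_transitive[OF X finite_gset_prod[OF Y finX], of snd] burnside_elem_prod[OF Y finX]
    by (simp add: card_cartesian_product)
qed

lemma burnside_separable_iff:
  fixes R :: "('r, 'l) ring_scheme"
  assumes "cring R"
  shows "separable_algebra R (burnside_algebra R G) \<longleftrightarrow> [order G] \<cdot>\<^bsub>R\<^esub> \<one>\<^bsub>R\<^esub> \<in> Units R"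
proof -
  interpret R: cring R by fact
  interpret E: scalar_ext R B by (intro scalar_ext.intro assms B.is_cring)
  \<comment> \<open>The goal uses a natural multiple of 1, both criteria use integer
    multiples.\<close>
  have ord: "[order G] \<cdot>\<^bsub>R\<^esub> \<one>\<^bsub>R\<^esub> = [int (order G)] \<cdot>\<^bsub>R\<^esub> \<one>\<^bsub>R\<^esub>"
    by (simp add: add_pow_int_ge)
  have alg: "burnside_algebra R G = scalar_extension R B" by (simp add: burnside_algebra_def)
  show ?thesis
  proof
    assume sep: "separable_algebra R (burnside_algebra R G)"
    obtain H :: "_ \<Rightarrow> int" where
      H: "\<And>x y. x \<in> carrier B \<Longrightarrow> y \<in> carrier B \<Longrightarrow> H (x \<oplus>\<^bsub>B\<^esub> y) = H x + H y"
        "\<And>b. b \<in> carrier B \<Longrightarrow> H (burnside_elem (regular_gset G) \<otimes>\<^bsub>B\<^esub> b) = point_count b"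
      using free_orbits_hom by blast
    \<comment> \<open>The regular set has |G| points, so this unit is the image of |G|.\<close>
    have "[point_count (burnside_elem (regular_gset G))] \<cdot>\<^bsub>R\<^esub> \<one>\<^bsub>R\<^esub> \<in> Units R"
      by (rule E.separable_imp_unit[OF sep[unfolded alg] H(1) point_count_add point_count_mult point_count_one _ H(2)])
        (simp_all add: finite_regular_gset)
    then show "[order G] \<cdot>\<^bsub>R\<^esub> \<one>\<^bsub>R\<^esub> \<in> Units R"
      unfolding ord by (simp add: point_count_brk finite_regular_gset) (simp add: regular_gset_def order_def)
  next
    assume unit: "[order G] \<cdot>\<^bsub>R\<^esub> \<one>\<^bsub>R\<^esub> \<in> Units R"
    \<comment> \<open>A factor of a unit in a commutative ring is a unit; this is applied to the
      multiplicities on the diagonal.\<close>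
    have unit_dvd: "[int m] \<cdot>\<^bsub>R\<^esub> \<one>\<^bsub>R\<^esub> \<in> Units R" if m: "m dvd order G" for m
    proof -
      obtain k where k: "order G = m * k" using m by blast
      have "([int m] \<cdot>\<^bsub>R\<^esub> \<one>\<^bsub>R\<^esub>) \<otimes>\<^bsub>R\<^esub> ([int k] \<cdot>\<^bsub>R\<^esub> \<one>\<^bsub>R\<^esub>) = [order G] \<cdot>\<^bsub>R\<^esub> \<one>\<^bsub>R\<^esub>"
        unfolding ord by (simp add: k R.add_pow_ldistr_int R.add.int_pow_pow mult.commute)
      then show ?thesis using unit R.unit_factor[of "[int m] \<cdot>\<^bsub>R\<^esub> \<one>\<^bsub>R\<^esub>" "[int k] \<cdot>\<^bsub>R\<^esub> \<one>\<^bsub>R\<^esub>"] by simp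
    qed
    show "separable_algebra R (burnside_algebra R G)"
      unfolding alg
    proof (rule E.separable_if_triangular[of transitive_classes "\<lambda>s. nat (point_count s)"])
      show "finite transitive_classes" "transitive_classes \<subseteq> carrier B"
        by (rule finite_transitive_classes transitive_classes_closed)+
      have "transitive_gset G (trivial_gset {()})"
        using finite_gset_trivial[of "{()}"] one_closed by (auto simp: transitive_gset_def trivial_gset_def)
      then show "\<one>\<^bsub>B\<^esub> \<in> transitive_classes" using burnside_elem_transitive burnside_elem_one by metis
      fix s assume "s \<in> transitive_classes"
      then obtain X :: "('a, nat) gset" where X: "transitive_gset G X" "s = burnside_elem X"
        by (auto simp: transitive_classes_def)
      then obtain x where x: "x \<in> fst X" by (auto simp: transitive_gset_def)
      have finX: "finite_gset G X" using X by (simp add: transitive_gset_def)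
      have larger: "larger (card (fst X)) = Idl\<^bsub>B\<^esub> {s' \<in> transitive_classes. nat (point_count s) < nat (point_count s')}"
        by (simp add: larger_def X point_count_brk finX)
      interpret J: ideal "larger (card (fst X))" B by (rule larger_ideal)
      \<comment> \<open>The product formula for Y = X; its coefficient divides |G| by
        \<open>transitive_fixed_dvd\<close>.\<close>
      have "s \<otimes>\<^bsub>B\<^esub> s \<ominus>\<^bsub>B\<^esub> [int (card {y \<in> fst X. stab G X x \<subseteq> stab G X y})] \<cdot>\<^bsub>B\<^esub> s
          \<in> larger (card (fst X))"
        using burnside_elem_prod_transitive[OF X(1) x finX] X(2) by simp
      then show "\<exists>m :: int. [m] \<cdot>\<^bsub>R\<^esub> \<one>\<^bsub>R\<^esub> \<in> Units R \<and> s \<otimes>\<^bsub>B\<^esub> s \<ominus>\<^bsub>B\<^esub> [m] \<cdot>\<^bsub>B\<^esub> s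
          \<in> Idl\<^bsub>B\<^esub> {s' \<in> transitive_classes. nat (point_count s) < nat (point_count s')}"
        using unit_dvd[OF transitive_fixed_dvd[OF X(1) x]] unfolding larger by blast
      fix b assume "b \<in> carrier B"
      then obtain Y Y' :: "('a, nat) gset" where
        Y: "finite_gset G Y" "finite_gset G Y'" "b = burnside_elem Y \<ominus>\<^bsub>B\<^esub> burnside_elem Y'"
        by (rule B_cases)
      obtain m m' :: int where m: "burnside_elem Y \<otimes>\<^bsub>B\<^esub> s \<ominus>\<^bsub>B\<^esub> [m] \<cdot>\<^bsub>B\<^esub> s \<in> larger (card (fst X))"
        "burnside_elem Y' \<otimes>\<^bsub>B\<^esub> s \<ominus>\<^bsub>B\<^esub> [m'] \<cdot>\<^bsub>B\<^esub> s \<in> larger (card (fst X))"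
        using burnside_elem_prod_transitive[OF X(1) x Y(1)] burnside_elem_prod_transitive[OF X(1) x Y(2)] X(2) by blast
      have s: "s \<in> carrier B" using X finX by simp
      \<comment> \<open>The coefficient is additive in the first factor, so the formal difference of
        Y and Y' gets m - m'.\<close>
      have "b \<otimes>\<^bsub>B\<^esub> s \<ominus>\<^bsub>B\<^esub> [(m - m')] \<cdot>\<^bsub>B\<^esub> s =
          (burnside_elem Y \<otimes>\<^bsub>B\<^esub> s \<ominus>\<^bsub>B\<^esub> [m] \<cdot>\<^bsub>B\<^esub> s) \<ominus>\<^bsub>B\<^esub> (burnside_elem Y' \<otimes>\<^bsub>B\<^esub> s \<ominus>\<^bsub>B\<^esub> [m'] \<cdot>\<^bsub>B\<^esub> s)"
        using s Y by (simp add: B.add.int_pow_diff B.minus_eq B.l_distr B.l_minus B.minus_add B.a_ac)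
      also have "\<dots> \<in> larger (card (fst X))"
        using J.a_closed[OF m(1) J.a_inv_closed[OF m(2)]] by (simp add: B.minus_eq)
      finally show "\<exists>m :: int. b \<otimes>\<^bsub>B\<^esub> s \<ominus>\<^bsub>B\<^esub> [m] \<cdot>\<^bsub>B\<^esub> s
          \<in> Idl\<^bsub>B\<^esub> {s' \<in> transitive_classes. nat (point_count s) < nat (point_count s')}"
        unfolding larger by blast
    qed
  qed
qed

end

theorem theorem4p1:
  fixes R :: "('r, 'l) ring_scheme" and G :: "('g, 'm) monoid_scheme"
  assumes "cring R" and "group G" and "finite (carrier G)"
  shows "separable_algebra R (burnside_algebra R G) \<longleftrightarrow>
    [order G] \<cdot>\<^bsub>R\<^esub> \<one>\<^bsub>R\<^esub> \<in> Units R"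
proof -
  interpret burnside G
    by (intro burnside.intro finite_group.intro finite_group_axioms.intro assms)
  show ?thesis by (rule burnside_separable_iff[OF assms(1)])
qed

end
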